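(* For every $d\ge1$, every $f\in L^1(\gamma_d)\cap L^2(\gamma_d)$, and every $t>0$, $$\gamma_d\bigl\{|R_2f|_{\mathrm{HS}}>t\bigr\}\le\frac{2\,\|f\|_{L^1(\gamma_d)}}{t},$$ where $R_2f=D^2\mathcal N^{-1}(f-\mathbb E f)$ is the second-order Gaussian Riesz transform. The constant is independent of $d$. The operator $R_2$ extends uniquely from $L^1(\gamma_d)\cap L^2(\gamma_d)$ to $L^1(\gamma_d)$ by convergence in measure (that is, if $f_k\in L^1\cap L^2$ and $f_k\to f$ in $L^1(\gamma_d)$, then $R_2f_k$ converges in measure to a limit depending only on $f$), and the same estimate holds for the extension.
   Context: $\gamma_d$ is the standard Gaussian measure on $\mathbb R^d$ and $\mathbb E$ is integration against it. Hermite polynomials: $H_k(x)=(-1)^ke^{x^2/2}\frac{d^k}{dx^k}e^{-x^2/2}$, $H_\alpha(x)=\prod_iH_{\alpha_i}(x_i)$. The $n$-th Wiener chaos is $\mathcal C_n=\operatorname{span}\{H_\alpha:|\alpha|=n\}$, and $L^2(\gamma_d)=\bigoplus_{n\ge0}\mathcal C_n$ orthogonally; write $u=\sum_nu_n$, $u_n\in\mathcal C_n$. The Ornstein--Uhlenbeck operator $\mathcal N=-\Delta+x\cdot D$ is defined spectrally by $\operatorname{Dom}(\mathcal N)=\{u\in L^2(\gamma_d):\sum_nn^2\|u_n\|_2^2<\infty\}$, $\mathcal N u=\sum_nn\,u_n$, and $\mathcal N^{-1}u:=\sum_{n\ge1}u_n/n$. Elements of $\operatorname{Dom}(\mathcal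 N)$ have weak Hessians $D^2u=(\partial_i\partial_ju)_{i,j}$ in $L^2(\gamma_d;\mathbb R^{d\times d})$, so $R_2f$ is defined for $f\in L^2(\gamma_d)$. $|A|_{\mathrm{HS}}^2=\sum_{i,j}A_{ij}^2$ is the Hilbert--Schmidt norm. *)

theory Defs
  imports "HOL-Probability.Probability"
begin

section \<open>Gaussian measure and function spaces\<close>

text \<open>
  \<open>\<real>\<^sup>d\<close> is the type \<open>real ^ 'n\<close> with \<open>d = CARD('n)\<close>, so a statement that is polymorphic in
  \<open>'n :: finite\<close> quantifies over all \<open>d \<ge> 1\<close>. Elements of the Lebesgue spaces are represented by
  Borel functions, not by classes modulo null sets.
\<close>

definition gauss :: "(real ^ 'n::finite) measure" where
  "gauss = density lborel (\<lambda>x. ennreal (\<Prod>i\<in>UNIV. std_normal_density (x $ i)))"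

lemma space_gauss [simp]: "space gauss = UNIV"
  and sets_gauss [simp, measurable_cong]: "sets gauss = sets borel"
  by (simp_all add: gauss_def)

definition L1 :: "(real ^ 'n::finite \<Rightarrow> real) set" where
  "L1 = {f. integrable gauss f}"

definition L2 :: "(real ^ 'n::finite \<Rightarrow> real) set" where
  "L2 = {f. f \<in> borel_measurable gauss \<and> integrable gauss (\<lambda>x. (f x)\<^sup>2)}"

definition L1_norm :: "(real ^ 'n::finite \<Rightarrow> real) \<Rightarrow> real" where
  "L1_norm f = (\<integral>x. \<bar>f x\<bar> \<partial>gauss)"

definition L2_sums :: "(nat \<Rightarrow> real ^ 'n::finite \<Rightarrow> real) \<Rightarrow> (real ^ 'n \<Rightarrow> real) \<Rightarrow> bool" where
  "L2_sums U u \<longleftrightarrow> (\<forall>n. U n \<in> L2) \<and> u \<in> L2 \<and>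
     (\<lambda>N. \<integral>x. (u x - (\<Sum>n<N. U n x))\<^sup>2 \<partial>gauss) \<longlonglongrightarrow> 0"


section \<open>Wiener chaos\<close>

definition hermite :: "nat \<Rightarrow> real \<Rightarrow> real" where
  "hermite k x = (-1) ^ k * exp (x\<^sup>2 / 2) * (deriv ^^ k) (\<lambda>y. exp (- y\<^sup>2 / 2)) x"

definition hermite_multi :: "('n::finite \<Rightarrow> nat) \<Rightarrow> real ^ 'n \<Rightarrow> real" where
  "hermite_multi \<alpha> x = (\<Prod>i\<in>UNIV. hermite (\<alpha> i) (x $ i))"

text \<open>
  The linear span of the \<open>H\<^sub>\<alpha>\<close> with \<open>|\<alpha>| = n\<close>, written out since function types are not an instance
  of \<open>real_vector\<close>; the index set is finite.
\<close>
definition chaos :: "nat \<Rightarrow> (real ^ 'n::finite \<Rightarrow> real) set" where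
  "chaos n = {\<lambda>x. \<Sum>\<alpha> | (\<Sum>i\<in>UNIV. \<alpha> i) = n. c \<alpha> * hermite_multi \<alpha> x | c. True}"

text \<open>
  The components \<open>u\<^sub>n\<close> of the orthogonal decomposition \<open>u = \<Sum>n. u\<^sub>n\<close>. They are unique as
  functions, not only almost everywhere, because elements of \<open>chaos n\<close> are polynomials.
\<close>
definition chaos_part :: "(real ^ 'n::finite \<Rightarrow> real) \<Rightarrow> nat \<Rightarrow> real ^ 'n \<Rightarrow> real" where
  "chaos_part u = (THE U. (\<forall>n. U n \<in> chaos n) \<and> L2_sums U u)"

text \<open>\<open>\<N>\<^sup>-\<^sup>1 u = \<Sum>n\<ge>1. u\<^sub>n / n\<close> in \<open>L\<^sup>2\<close>, up to the choice of a representative.\<close>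
definition OU_inv :: "(real ^ 'n::finite \<Rightarrow> real) \<Rightarrow> real ^ 'n \<Rightarrow> real" where
  "OU_inv u = (SOME v. L2_sums (\<lambda>n x. chaos_part u (Suc n) x / real (Suc n)) v)"


section \<open>Weak Hessian and the second-order Riesz transform\<close>

definition partial :: "'n::finite \<Rightarrow> (real ^ 'n \<Rightarrow> real) \<Rightarrow> real ^ 'n \<Rightarrow> real" where
  "partial i \<phi> x = frechet_derivative \<phi> (at x) (axis i 1)"

primrec Ck :: "nat \<Rightarrow> (real ^ 'n::finite \<Rightarrow> real) \<Rightarrow> bool" where
  "Ck 0 \<phi> \<longleftrightarrow> continuous_on UNIV \<phi>"
| "Ck (Suc k) \<phi> \<longleftrightarrow> (\<forall>x. \<phi> differentiable at x) \<and> (\<forall>i. Ck k (partial i \<phi>))"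

definition test_function :: "(real ^ 'n::finite \<Rightarrow> real) \<Rightarrow> bool" where
  "test_function \<phi> \<longleftrightarrow> (\<forall>k. Ck k \<phi>) \<and> compact (closure {x. \<phi> x \<noteq> 0})"

text \<open>
  Weak derivatives are taken with respect to Lebesgue measure. Functions in \<open>L\<^sup>2\<close> of the Gaussian
  measure are locally square integrable, so both integrals exist.
\<close>
definition is_weak_hessian ::
    "(real ^ 'n::finite \<Rightarrow> real) \<Rightarrow> (real ^ 'n \<Rightarrow> real ^ 'n ^ 'n) \<Rightarrow> bool" where
  "is_weak_hessian v A \<longleftrightarrow>
     (\<forall>i j. (\<lambda>x. A x $ i $ j) \<in> L2 \<and>
        (\<forall>\<phi>. test_function \<phi> \<longrightarrow>
           (\<integral>x. v x * partial i (partial j \<phi>) x \<partial>lborel) = (\<integral>x. A x $ i $ j * \<phi> x \<partial>lborel)))"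

definition weak_hessian :: "(real ^ 'n::finite \<Rightarrow> real) \<Rightarrow> real ^ 'n \<Rightarrow> real ^ 'n ^ 'n" where
  "weak_hessian v = (SOME A. is_weak_hessian v A)"

definition riesz2 :: "(real ^ 'n::finite \<Rightarrow> real) \<Rightarrow> real ^ 'n \<Rightarrow> real ^ 'n ^ 'n" where
  "riesz2 f = weak_hessian (OU_inv (\<lambda>x. f x - (\<integral>y. f y \<partial>gauss)))"

definition hs_norm :: "real ^ 'n::finite ^ 'n \<Rightarrow> real" where
  "hs_norm A = sqrt (\<Sum>i\<in>UNIV. \<Sum>j\<in>UNIV. (A $ i $ j)\<^sup>2)"

lemma hs_norm_eq_norm: "hs_norm A = norm A"
  by (simp add: hs_norm_def norm_vec_def L2_set_def sum_nonneg)


section \<open>Extension by convergence in measure\<close>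

definition converges_in_measure ::
    "(nat \<Rightarrow> real ^ 'n::finite \<Rightarrow> real ^ 'n ^ 'n) \<Rightarrow> (real ^ 'n \<Rightarrow> real ^ 'n ^ 'n) \<Rightarrow> bool" where
  "converges_in_measure F G \<longleftrightarrow>
     (\<forall>\<epsilon>>0. (\<lambda>k. measure gauss {x. hs_norm (F k x - G x) > \<epsilon>}) \<longlonglongrightarrow> 0)"

definition extends_in_measure ::
    "((real ^ 'n::finite \<Rightarrow> real) \<Rightarrow> real ^ 'n \<Rightarrow> real ^ 'n ^ 'n) \<Rightarrow>
     ((real ^ 'n \<Rightarrow> real) \<Rightarrow> real ^ 'n \<Rightarrow> real ^ 'n ^ 'n) \<Rightarrow> bool" where
  "extends_in_measure R T \<longleftrightarrow>
     (\<forall>f\<in>L1. T f \<in> borel_measurable gauss) \<and>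
     (\<forall>f\<in>L1 \<inter> L2. AE x in gauss. T f x = R f x) \<and>
     (\<forall>f\<in>L1. \<forall>F. (\<forall>k. F k \<in> L1 \<inter> L2) \<and> (\<lambda>k. L1_norm (\<lambda>x. F k x - f x)) \<longlonglongrightarrow> 0 \<longrightarrow>
        converges_in_measure (\<lambda>k. R (F k)) (T f))"

end

theory Submission
  imports Defs
begin

text \<open>
  Split \<open>f\<close> by a two-sided obstacle problem. The minimiser \<open>w\<close> of
  \<open>E (|Dw|\<^sup>2 / 2 - f w + t |w|)\<close> satisfies \<open>\<N> w = f - g\<close> with \<open>|g| \<le> t\<close> and \<open>g = t sgn w\<close> where
  \<open>w \<noteq> 0\<close>. Testing the equation against \<open>sgn w\<close> gives \<open>t \<gamma>{w \<noteq> 0} \<le> \<integral>\<^bsub>{w \<noteq> 0}\<^esub> |f|\<close>. On \<open>{w = 0}\<close>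
  both \<open>Dw\<close> and \<open>D\<^sup>2w\<close> vanish almost everywhere, so \<open>g = f\<close> there; hence
  \<open>\<parallel>g\<parallel>\<^sub>1 \<le> \<parallel>f\<parallel>\<^sub>1\<close>, and \<open>R\<^sub>2 f = R\<^sub>2 g\<close> on \<open>{w = 0}\<close>. Since \<open>R\<^sub>2\<close> is a contraction of \<open>L\<^sup>2\<close> and
  \<open>\<parallel>g\<parallel>\<^sub>2\<^sup>2 \<le> t \<parallel>g\<parallel>\<^sub>1\<close>, the two contributions \<open>\<gamma>{w \<noteq> 0}\<close> and \<open>\<gamma>{|R\<^sub>2 g| > t}\<close> are each at most
  \<open>\<parallel>f\<parallel>\<^sub>1 / t\<close>, which is where the constant \<open>2\<close> comes from.
\<close>

section \<open>The Gaussian measure\<close>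

text \<open>The constant must not depend on the dimension, which rules out covering arguments: they
  pay for \<open>d\<close>, and Gaussian measure is not doubling. The only quantitative input
  besides the splitting is the energy identity of the Hermite expansion: the entries of the Hessian
  of \<open>v\<close> have total square norm \<Sum> n (n - 1) |v_n|^2, and n (n - 1) <= n^2. Weak
  derivatives are therefore encoded as shifts of Hermite coefficients; functions are built from
  square-summable coefficients, and polynomials, for which calculus is exact, approximate them
  together with their derivatives. Two obstacles shape the rest. The Ornstein-Uhlenbeck operator
  annihilates constants, so the quadratic energy does not control the mean; an extra term \<delta>
  |w|^2 / 2 restores strong convexity, and \<delta> tends to 0 only in the final estimate. Moreover,
  the transform is an arbitrary choice among weak Hessians in the Lebesgue sense, so coefficient
  Hessians must be shown to be weak Hessians, and weak Hessians to be unique up to null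
  sets.\<close>

definition gdens :: "real ^ 'n::finite \<Rightarrow> real" where
  "gdens x = (\<Prod>i\<in>UNIV. std_normal_density (x $ i))"

lemma gdens_pos: "gdens x > 0"
  unfolding gdens_def by (intro prod_pos) (auto simp: normal_density_pos)

lemma gdens_nonneg [simp]: "gdens x \<ge> 0"
  using gdens_pos[of x] by simp

lemma continuous_gdens: "continuous_on UNIV (gdens :: real ^ 'n::finite \<Rightarrow> real)"
  unfolding gdens_def normal_density_def by (intro continuous_intros) auto

lemma borel_gdens [measurable]: "(gdens :: real ^ 'n::finite \<Rightarrow> real) \<in> borel_measurable borel"
  by (rule borel_measurable_continuous_onI[OF continuous_gdens])

lemma gauss_eq: "gauss = density lborel (\<lambda>x. ennreal (gdens x))"
  unfolding gauss_def gdens_def ..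

lemma integrable_gauss_iff:
  fixes f :: "real ^ 'n::finite \<Rightarrow> real"
  assumes "f \<in> borel_measurable borel"
  shows "integrable gauss f \<longleftrightarrow> integrable lborel (\<lambda>x. gdens x * f x)"
  unfolding gauss_eq using assms by (subst integrable_density) auto

lemma integral_gauss_eq:
  fixes f :: "real ^ 'n::finite \<Rightarrow> real"
  assumes "f \<in> borel_measurable borel"
  shows "(\<integral>x. f x \<partial>gauss) = (\<integral>x. gdens x * f x \<partial>lborel)"
  unfolding gauss_eq using assms by (subst integral_density) auto

text \<open>The density is positive everywhere, so Gaussian and Lebesgue null sets agree. Uniqueness
  of weak Hessians, a Lebesgue statement, transfers to \<open>gauss\<close> in this way.\<close>

lemma AE_gauss_iff:
  fixes P :: "real ^ 'n::finite \<Rightarrow> bool"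
  shows "(AE x in gauss. P x) \<longleftrightarrow> (AE x in lborel. P x)"
proof -
  have "(AE x in gauss. P x) \<longleftrightarrow> (AE x in lborel. 0 < ennreal (gdens x) \<longrightarrow> P x)"
    unfolding gauss_eq by (rule AE_density) auto
  then show ?thesis
    by (simp add: gdens_pos)
qed

text \<open>Tonelli in coordinates. The product formula for \<open>lborel\<close> runs over the
  vectors of \<open>Basis\<close>, so the factors are first reindexed through
  \<open>axis_index\<close>.\<close>

lemma nn_integral_gauss_prod:
  fixes g :: "'n::finite \<Rightarrow> real \<Rightarrow> ennreal"
  assumes g[measurable]: "\<And>i. g i \<in> borel_measurable borel"
  shows "(\<integral>\<^sup>+ x. (\<Prod>i\<in>UNIV. g i (x $ i)) \<partial>(gauss :: (real ^ 'n) measure)) =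
    (\<Prod>i\<in>UNIV. \<integral>\<^sup>+ s. ennreal (std_normal_density s) * g i s \<partial>lborel)"
proof -
  define h where "h b s = ennreal (std_normal_density s) * g (axis_index b) s" for b :: "real ^ 'n" and s
  have B: "(Basis :: (real ^ 'n) set) = range (\<lambda>i. axis i 1)"
    by (auto simp: Basis_vec_def)
  have inj: "inj (\<lambda>i::'n. axis i (1::real))"
    by (auto simp: inj_on_def axis_eq_axis)
  have [measurable]: "h b \<in> borel_measurable borel" for b
    unfolding h_def by measurable
  have "(\<integral>\<^sup>+ x. (\<Prod>i\<in>UNIV. g i (x $ i)) \<partial>(gauss :: (real ^ 'n) measure)) =
    (\<integral>\<^sup>+ x. ennreal (gdens x) * (\<Prod>i\<in>UNIV. g i (x $ i)) \<partial>lborel)"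
    unfolding gauss_eq by (subst nn_integral_density) auto
  also have "\<dots> = (\<integral>\<^sup>+ x. (\<Prod>b\<in>Basis. h b (x \<bullet> b)) \<partial>lborel)"
    by (intro nn_integral_cong)
      (simp add: B prod.reindex[OF inj] h_def axis_index_axis inner_axis prod.distrib gdens_def
        prod_ennreal)
  also have "\<dots> = (\<Prod>b\<in>Basis. \<integral>\<^sup>+ s. h b s \<partial>lborel)"
    by (rule nn_integral_lborel_prod) auto
  also have "\<dots> = (\<Prod>i\<in>UNIV. \<integral>\<^sup>+ s. ennreal (std_normal_density s) * g i s \<partial>lborel)"
    by (simp add: B prod.reindex[OF inj] h_def axis_index_axis)
  finally show ?thesis .
qed

lemma prob_space_gauss: "prob_space (gauss :: (real ^ 'n::finite) measure)"
proof
  have 1: "(\<integral>\<^sup>+ s. ennreal (std_normal_density s) \<partial>lborel) = 1"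
    using nn_integral_eq_integral[of lborel "std_normal_density"]
    by (simp add: integrable_normal_density)
  show "emeasure (gauss :: (real ^ 'n) measure) (space gauss) = 1"
    using nn_integral_gauss_prod[of "\<lambda>_::'n. \<lambda>_. 1"] by (simp add: 1 del: space_gauss)
qed

interpretation gauss: prob_space "gauss :: (real ^ 'n::finite) measure"
  by (rule prob_space_gauss)

text \<open>Completing the square: \<open>exp (c * s)\<close> times the standard density is a
  constant multiple of the normal density with mean \<open>c\<close>. The absolute value is handled
  by exp (K |s|) <= exp (K s) + exp (-K s).\<close>

lemma std_normal_exp_finite:
  "(\<integral>\<^sup>+ s. ennreal (std_normal_density s) * ennreal (exp (K * \<bar>s\<bar>)) \<partial>lborel) < \<infinity>"
proof -
  have shift: "std_normal_density s * exp (c * s) = exp (c\<^sup>2 / 2) * normal_density c 1 s" for c s :: real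
    unfolding normal_density_def by (simp add: exp_add[symmetric] power2_eq_square field_simps)
  have int: "integrable lborel (\<lambda>s. std_normal_density s * exp (c * s))" for c :: real
    unfolding shift by (intro integrable_mult_right integrable_normal_density) auto
  have "integrable lborel (\<lambda>s. std_normal_density s * exp (K * s) + std_normal_density s * exp ((-K) * s))"
    by (intro Bochner_Integration.integrable_add int)
  then have "integrable lborel (\<lambda>s. std_normal_density s * exp (K * \<bar>s\<bar>))"
  proof (rule Bochner_Integration.integrable_bound)
    have "std_normal_density s * exp (K * \<bar>s\<bar>) \<le>
        std_normal_density s * exp (K * s) + std_normal_density s * exp (- K * s)" for s
      by (cases "s \<ge> 0") (simp_all add: normal_density_nonneg)
    then show "AE s in lborel. norm (std_normal_density s * exp (K * \<bar>s\<bar>)) \<le>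
        norm (std_normal_density s * exp (K * s) + std_normal_density s * exp (- K * s))"
      by (intro AE_I2) (simp add: normal_density_nonneg abs_mult)
  qed measurable
  then have "(\<integral>\<^sup>+ s. ennreal (std_normal_density s * exp (K * \<bar>s\<bar>)) \<partial>lborel) =
      ennreal (\<integral>s. std_normal_density s * exp (K * \<bar>s\<bar>) \<partial>lborel)"
    by (rule nn_integral_eq_integral) (simp add: normal_density_nonneg)
  also have "\<dots> < \<infinity>"
    by simp
  finally show ?thesis
    by (simp add: ennreal_mult normal_density_nonneg)
qed

section \<open>Functions of exponential growth\<close>

abbreviation abs_sum :: "real ^ 'n::finite \<Rightarrow> real" where
  "abs_sum x \<equiv> \<Sum>i\<in>UNIV. \<bar>x $ i\<bar>"

text \<open>An algebra of functions that contains the polynomials and the bounded continuous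
  functions and lies in \<open>L2\<close>. The exponent is the l1 norm because its exponential
  factors over the coordinates; one constant in both places keeps a single witness.\<close>

definition exp_growth :: "(real ^ 'n::finite \<Rightarrow> real) \<Rightarrow> bool" where
  "exp_growth f \<longleftrightarrow> continuous_on UNIV f \<and> (\<exists>K. \<forall>x. \<bar>f x\<bar> \<le> K * exp (K * abs_sum x))"

lemma exp_growth_continuous: "exp_growth f \<Longrightarrow> continuous_on UNIV f"
  by (simp add: exp_growth_def)

lemma exp_growth_borel: "exp_growth f \<Longrightarrow> f \<in> borel_measurable borel"
  by (simp add: exp_growth_def borel_measurable_continuous_onI)

lemma exp_growth_const [intro, simp]: "exp_growth (\<lambda>x. c)"
proof -
  have "\<bar>c\<bar> \<le> \<bar>c\<bar> * exp (\<bar>c\<bar> * abs_sum x)" for x :: "real ^ 'n::finite"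
    using mult_left_mono[of 1 "exp (\<bar>c\<bar> * abs_sum x)" "\<bar>c\<bar>"]
    by (simp add: sum_nonneg)
  then show ?thesis
    unfolding exp_growth_def by (auto intro!: exI[of _ "\<bar>c\<bar>"])
qed

lemma exp_growth_bounded:
  assumes "continuous_on UNIV f" "\<And>x. \<bar>f x\<bar> \<le> B"
  shows "exp_growth f"
proof -
  obtain K where K: "\<And>x :: real^'a. \<bar>B\<bar> \<le> K * exp (K * abs_sum x)"
    using exp_growth_const[of B] unfolding exp_growth_def by metis
  show ?thesis
    unfolding exp_growth_def using assms K by (meson abs_ge_self order_trans)
qed

lemma exp_growth_component [intro, simp]: "exp_growth (\<lambda>x. x $ i)"
proof -
  have "\<bar>x $ i\<bar> \<le> exp (abs_sum x)" for x :: "real ^ 'n::finite" and i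
  proof -
    have "\<bar>x $ i\<bar> \<le> abs_sum x"
      by (intro member_le_sum) auto
    also have "\<dots> \<le> exp (abs_sum x)"
      using exp_ge_add_one_self[of "\<Sum>i\<in>UNIV. \<bar>x $ i\<bar>"] by linarith
    finally show ?thesis .
  qed
  then show ?thesis
    unfolding exp_growth_def by (intro conjI exI[of _ 1] continuous_intros) auto
qed

lemma exp_growth_exp: "exp_growth (\<lambda>x. exp (c * abs_sum x))"
proof -
  have "\<bar>exp (c * abs_sum x)\<bar> \<le> max 1 c * exp (max 1 c * abs_sum x)"
    for x :: "real ^ 'n::finite"
  proof -
    have "exp (c * abs_sum x) \<le> 1 * exp (max 1 c * abs_sum x)"
      by (auto intro!: mult_right_mono sum_nonneg)
    also have "\<dots> \<le> max 1 c * exp (max 1 c * abs_sum x)"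
      by (intro mult_right_mono) auto
    finally show ?thesis by simp
  qed
  then show ?thesis
    unfolding exp_growth_def by (intro conjI exI[of _ "max 1 c"] continuous_intros) auto
qed

lemma exp_growth_add [intro]:
  assumes "exp_growth f" "exp_growth g"
  shows "exp_growth (\<lambda>x. f x + g x)"
proof -
  obtain K L where K: "\<And>x. \<bar>f x\<bar> \<le> K * exp (K * abs_sum x)"
    and L: "\<And>x. \<bar>g x\<bar> \<le> L * exp (L * abs_sum x)"
    using assms unfolding exp_growth_def by blast
  have "K \<ge> 0" "L \<ge> 0"
    using K[of 0] L[of 0] by auto
  have "\<bar>f x + g x\<bar> \<le> (K + L) * exp ((K + L) * abs_sum x)" for x
  proof -
    have "\<bar>f x + g x\<bar> \<le> K * exp (K * abs_sum x) + L * exp (L * abs_sum x)"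
      using K[of x] L[of x] by linarith
    also have "\<dots> \<le> K * exp ((K + L) * abs_sum x) + L * exp ((K + L) * abs_sum x)"
      using \<open>K \<ge> 0\<close> \<open>L \<ge> 0\<close> by (intro add_mono mult_left_mono) (auto intro!: mult_right_mono sum_nonneg)
    finally show ?thesis by (simp add: algebra_simps)
  qed
  then show ?thesis
    using assms unfolding exp_growth_def by (auto intro!: continuous_intros)
qed

lemma exp_growth_mult [intro]:
  assumes "exp_growth f" "exp_growth g"
  shows "exp_growth (\<lambda>x. f x * g x)"
proof -
  obtain K L where K: "\<And>x. \<bar>f x\<bar> \<le> K * exp (K * abs_sum x)"
    and L: "\<And>x. \<bar>g x\<bar> \<le> L * exp (L * abs_sum x)"
    using assms unfolding exp_growth_def by blast
  have "K \<ge> 0" "L \<ge> 0"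
    using K[of 0] L[of 0] by auto
  \<comment> \<open>A single constant has to dominate both the factor \<open>K * L\<close> and the
    rate \<open>K + L\<close>.\<close>
  define M where "M = max (K * L) (K + L)"
  have "M \<ge> 0"
    using \<open>K \<ge> 0\<close> \<open>L \<ge> 0\<close> by (simp add: M_def le_max_iff_disj)
  have "\<bar>f x * g x\<bar> \<le> M * exp (M * abs_sum x)" for x
  proof -
    have "\<bar>f x * g x\<bar> \<le> (K * exp (K * abs_sum x)) * (L * exp (L * abs_sum x))"
      unfolding abs_mult by (intro mult_mono K L) (auto simp: \<open>K \<ge> 0\<close>)
    also have "\<dots> = (K * L) * exp ((K + L) * abs_sum x)"
      by (simp add: algebra_simps exp_add)
    also have "\<dots> \<le> M * exp (M * abs_sum x)"
      using \<open>M \<ge> 0\<close> \<open>K \<ge> 0\<close> \<open>L \<ge> 0\<close>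
      by (intro mult_mono) (auto simp: M_def intro!: mult_right_mono sum_nonneg)
    finally show ?thesis .
  qed
  then show ?thesis
    using assms unfolding exp_growth_def by (auto intro!: continuous_intros)
qed

lemma exp_growth_cmult [intro]: "exp_growth f \<Longrightarrow> exp_growth (\<lambda>x. c * f x)"
  using exp_growth_mult[OF exp_growth_const] .

lemma exp_growth_minus [intro]: "exp_growth f \<Longrightarrow> exp_growth (\<lambda>x. - f x)"
  using exp_growth_cmult[of f "-1"] by simp

lemma exp_growth_diff [intro]:
  assumes "exp_growth f" "exp_growth g"
  shows "exp_growth (\<lambda>x. f x - g x)"
  using exp_growth_add[OF assms(1) exp_growth_minus[OF assms(2)]] by simp

lemma exp_growth_sum [intro]:
  "(\<And>a. a \<in> S \<Longrightarrow> exp_growth (f a)) \<Longrightarrow> exp_growth (\<lambda>x. \<Sum>a\<in>S. f a x)"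
  by (induction S rule: infinite_finite_induct) auto

lemma exp_growth_prod [intro]:
  "(\<And>a. a \<in> S \<Longrightarrow> exp_growth (f a)) \<Longrightarrow> exp_growth (\<lambda>x. \<Prod>a\<in>S. f a x)"
  by (induction S rule: infinite_finite_induct) auto

lemma integrable_exp_gauss:
  "integrable (gauss :: (real ^ 'n::finite) measure) (\<lambda>x. exp (K * abs_sum x))"
proof -
  have "(\<integral>\<^sup>+ x. ennreal (exp (K * abs_sum x)) \<partial>(gauss :: (real ^ 'n) measure)) =
    (\<integral>\<^sup>+ x. (\<Prod>i\<in>UNIV. ennreal (exp (K * \<bar>x $ i\<bar>))) \<partial>(gauss :: (real ^ 'n) measure))"
    by (intro nn_integral_cong) (simp add: sum_distrib_left exp_sum prod_ennreal)
  also have "\<dots> = (\<Prod>i\<in>(UNIV::'n set). \<integral>\<^sup>+ s. ennreal (std_normal_density s) * ennreal (exp (K * \<bar>s\<bar>)) \<partial>lborel)"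
    by (rule nn_integral_gauss_prod[of "\<lambda>_ s. ennreal (exp (K * \<bar>s\<bar>))"]) auto
  also have "\<dots> < \<infinity>"
    using std_normal_exp_finite[of K] by (simp add: less_top[symmetric] power_eq_top_ennreal)
  finally show ?thesis
    by (intro integrableI_bounded) auto
qed

lemma exp_growth_integrable:
  assumes "exp_growth f"
  shows "integrable gauss f"
proof -
  obtain K where K: "\<And>x. \<bar>f x\<bar> \<le> K * exp (K * abs_sum x)"
    using assms unfolding exp_growth_def by blast
  have "integrable gauss (\<lambda>x::real^'a. K * exp (K * abs_sum x))"
    by (intro integrable_mult_right integrable_exp_gauss)
  moreover have "f \<in> borel_measurable gauss"
    using exp_growth_borel[OF assms] by simp
  moreover have "norm (f x) \<le> norm (K * exp (K * abs_sum x))" for x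
    using K[of x] by simp
  ultimately show ?thesis
    using Bochner_Integration.integrable_bound by blast
qed

section \<open>Integration by parts\<close>

text \<open>Only the derivative along coordinate lines is asked for, so product and chain rules stay
  one-dimensional and no joint differentiability has to be established.\<close>

definition has_partial :: "'n::finite \<Rightarrow> (real ^ 'n \<Rightarrow> real) \<Rightarrow> (real ^ 'n \<Rightarrow> real) \<Rightarrow> bool" where
  "has_partial i F F' \<longleftrightarrow> (\<forall>x. ((\<lambda>s. F (x + s *\<^sub>R axis i 1)) has_real_derivative F' x) (at 0))"

lemma has_partial_at:
  assumes "has_partial i F F'"
  shows "((\<lambda>s. F (x + s *\<^sub>R axis i 1)) has_real_derivative F' (x + s *\<^sub>R axis i 1)) (at s)"
proof -
  have "((\<lambda>u. F ((x + s *\<^sub>R axis i 1) + u *\<^sub>R axis i 1)) has_real_derivative F' (x + s *\<^sub>R axis i 1)) (at 0)"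
    using assms unfolding has_partial_def by blast
  then have "((\<lambda>u. F (x + (u + s) *\<^sub>R axis i 1)) has_real_derivative F' (x + s *\<^sub>R axis i 1)) (at 0)"
    by (simp add: algebra_simps)
  then show ?thesis
    using DERIV_shift[of "\<lambda>s. F (x + s *\<^sub>R axis i 1)" "F' (x + s *\<^sub>R axis i 1)" 0 s] by simp
qed

lemma has_partial_mult:
  assumes "has_partial i F F'" "has_partial i G G'"
  shows "has_partial i (\<lambda>x. F x * G x) (\<lambda>x. F' x * G x + F x * G' x)"
  using assms unfolding has_partial_def
  by (auto intro!: derivative_eq_intros simp: algebra_simps)

lemma has_partial_const [simp]: "has_partial i (\<lambda>x. c) (\<lambda>x. 0)"
  unfolding has_partial_def by auto

lemma has_partial_cmult:
  "has_partial i F F' \<Longrightarrow> has_partial i (\<lambda>x. c * F x) (\<lambda>x. c * F' x)"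
  using has_partial_mult[OF has_partial_const[of i c]] by simp

lemma has_partial_sum:
  "(\<And>a. a \<in> S \<Longrightarrow> has_partial i (f a) (f' a)) \<Longrightarrow>
    has_partial i (\<lambda>x. \<Sum>a\<in>S. f a x) (\<lambda>x. \<Sum>a\<in>S. f' a x)"
  unfolding has_partial_def by (auto intro!: derivative_eq_intros)

lemma has_partial_compose:
  assumes "has_partial i F F'" "\<And>y. (g has_real_derivative g' y) (at y)"
  shows "has_partial i (\<lambda>x. g (F x)) (\<lambda>x. g' (F x) * F' x)"
  unfolding has_partial_def
proof
  fix x
  have "((\<lambda>s. F (x + s *\<^sub>R axis i 1)) has_real_derivative F' x) (at 0)"
    using assms(1) unfolding has_partial_def by blast
  from DERIV_chain2[OF _ this, of g "g' (F x)"] show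
    "((\<lambda>s. g (F (x + s *\<^sub>R axis i 1))) has_real_derivative g' (F x) * F' x) (at 0)"
    using assms(2)[of "F x"] by simp
qed

lemma has_partial_prod_component:
  fixes h :: "'n::finite \<Rightarrow> real \<Rightarrow> real"
  assumes "\<And>y. (h i has_real_derivative h' y) (at y)"
  shows "has_partial i (\<lambda>x. \<Prod>j\<in>UNIV. h j (x $ j))
    (\<lambda>x. h' (x $ i) * (\<Prod>j\<in>UNIV - {i}. h j (x $ j)))"
  unfolding has_partial_def
proof
  fix x :: "real ^ 'n"
  have eq: "(\<Prod>j\<in>UNIV. h j ((x + s *\<^sub>R axis i 1) $ j)) =
      h i (x $ i + s) * (\<Prod>j\<in>UNIV - {i}. h j (x $ j))" for s
    by (subst prod.remove[of _ i]) (auto intro!: prod.cong simp: axis_def)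
  have "((\<lambda>s. h i (x $ i + s)) has_real_derivative h' (x $ i)) (at 0)"
    using assms[of "x $ i"] DERIV_shift[of "h i" "h' (x $ i)" 0 "x $ i"] by (simp add: add.commute)
  then show "((\<lambda>s. \<Prod>j\<in>UNIV. h j ((x + s *\<^sub>R axis i 1) $ j)) has_real_derivative
     h' (x $ i) * (\<Prod>j\<in>UNIV - {i}. h j (x $ j))) (at 0)"
    unfolding eq by (rule DERIV_cmult_right)
qed

lemma integral_lborel_shift:
  fixes f :: "'a::euclidean_space \<Rightarrow> real"
  assumes [measurable]: "f \<in> borel_measurable borel"
  shows "(\<integral>x. f (x + c) \<partial>lborel) = (\<integral>x. f x \<partial>lborel)"
proof -
  have "(\<integral>x. f x \<partial>lborel) = (\<integral>x. f x \<partial>distr lborel borel ((+) c))"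
    by (simp only: lborel_distr_plus)
  also have "\<dots> = (\<integral>x. f (x + c) \<partial>lborel)"
    by (subst integral_distr) (auto simp: add.commute)
  finally show ?thesis ..
qed

lemma integrable_lborel_shift:
  fixes f :: "'a::euclidean_space \<Rightarrow> real"
  assumes "integrable lborel f"
  shows "integrable lborel (\<lambda>x. f (x + c))"
proof -
  have [measurable]: "f \<in> borel_measurable borel"
    using assms by (auto dest: borel_measurable_integrable)
  have "integrable (distr lborel borel ((+) c)) f"
    using assms lborel_distr_plus[of c] by simp
  then show ?thesis
    by (subst (asm) integrable_distr_eq) (auto simp: add.commute)
qed

text \<open>The average of \<open>K'\<close> over unit shifts in direction \<open>i\<close> is an increment of \<open>K\<close>, which integrates
  to \<open>0\<close> by translation invariance.\<close>
lemma integral_partial_eq_0: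
  fixes K :: "real ^ 'n::finite \<Rightarrow> real"
  assumes d: "has_partial i K K'" and K: "integrable lborel K" and K': "integrable lborel K'"
    and cont: "continuous_on UNIV K'"
  shows "(\<integral>x. K' x \<partial>lborel) = 0"
proof -
  let ?e = "axis i 1 :: real ^ 'n"
  let ?g = "\<lambda>s x. indicator {0..1::real} s * K' (x + s *\<^sub>R ?e)"
  have [measurable]: "K' \<in> borel_measurable borel" "K \<in> borel_measurable borel"
    using K K' by (auto dest: borel_measurable_integrable)
  have FTC: "(\<integral>s. ?g s x \<partial>lborel) = K (x + ?e) - K x" for x
  proof -
    have "(\<integral>s. K' (x + s *\<^sub>R ?e) * indicator {0..1} s \<partial>lborel) = K (x + 1 *\<^sub>R ?e) - K (x + 0 *\<^sub>R ?e)"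
    proof (rule integral_FTC_Icc_real)
      show "((\<lambda>s. K (x + s *\<^sub>R ?e)) has_real_derivative K' (x + s *\<^sub>R ?e)) (at s)" for s
        using d by (rule has_partial_at)
      show "isCont (\<lambda>s. K' (x + s *\<^sub>R ?e)) s" for s
        by (rule continuous_on_interior[of UNIV] continuous_on_compose2[OF cont])+
          (auto intro!: continuous_intros)
    qed auto
    then show ?thesis by (simp add: mult.commute)
  qed
  have int: "integrable (lborel \<Otimes>\<^sub>M lborel) (\<lambda>(s, x). ?g s x)"
  proof (rule lborel_pair.Fubini_integrable)
    have "(\<integral>x. norm (?g s x) \<partial>lborel) = indicator {0..1} s * (\<integral>x. norm (K' x) \<partial>lborel)" for s
      using integral_lborel_shift[of "\<lambda>x. norm (K' x)" "s *\<^sub>R ?e"] by (simp add: abs_mult)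
    then show "integrable lborel (\<lambda>s. \<integral>x. norm (case (s, x) of (s, x) \<Rightarrow> ?g s x) \<partial>lborel)"
      by (simp add: integrable_mult_left_iff)
    show "AE s in lborel. integrable lborel (\<lambda>x. case (s, x) of (s, x) \<Rightarrow> ?g s x)"
      by (auto intro!: AE_I2 integrable_mult_right integrable_lborel_shift K')
  qed measurable
  have "(\<integral>x. K' x \<partial>lborel) = (\<integral>s. indicator {0..1} s * (\<integral>x. K' x \<partial>lborel) \<partial>(lborel :: real measure))"
    by simp
  also have "\<dots> = (\<integral>s. (\<integral>x. ?g s x \<partial>lborel) \<partial>lborel)"
    by (simp add: integral_lborel_shift)
  also have "\<dots> = (\<integral>x. (\<integral>s. ?g s x \<partial>lborel) \<partial>lborel)"
    using lborel_pair.Fubini_integral[OF int] by simp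
  also have "\<dots> = (\<integral>x. K (x + ?e) - K x \<partial>lborel)"
    by (simp only: FTC)
  also have "\<dots> = 0"
    by (subst Bochner_Integration.integral_diff)
      (auto intro!: integrable_lborel_shift K simp: integral_lborel_shift)
  finally show ?thesis .
qed

lemma has_partial_gdens: "has_partial (i :: 'n::finite) gdens (\<lambda>x. - (x $ i) * gdens x)"
proof -
  have d: "(std_normal_density has_real_derivative - y * std_normal_density y) (at y)" for y :: real
    unfolding std_normal_density_def by (auto intro!: derivative_eq_intros simp: field_simps)
  have eq: "(\<lambda>x :: real ^ 'n. - (x $ i) * std_normal_density (x $ i) *
      (\<Prod>j\<in>UNIV - {i}. std_normal_density (x $ j))) = (\<lambda>x. - (x $ i) * gdens x)"
    unfolding gdens_def by (subst prod.remove[of UNIV i]) (auto simp: mult.assoc)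
  show ?thesis
    using has_partial_prod_component[of "\<lambda>_. std_normal_density" i, OF d]
    unfolding eq gdens_def[symmetric] .
qed

text \<open>The derivative of \<open>gdens x * (F x * G x)\<close> integrates to 0, and
  differentiating the density produces the factor \<open>- (x $ i)\<close>. Thus
  \<open>x $ i * G x - G' x\<close> is the Gaussian adjoint of the \<open>i\<close>-th
  derivative.\<close>

lemma gauss_ibp:
  assumes F: "has_partial i F F'" and G: "has_partial i G G'"
    and g: "exp_growth F" "exp_growth F'" "exp_growth G" "exp_growth G'"
  shows "(\<integral>x. F' x * G x \<partial>gauss) = (\<integral>x. F x * (x $ i * G x - G' x) \<partial>gauss)"
proof -
  let ?h = "\<lambda>x. F' x * G x - F x * (x $ i * G x - G' x)"
  have h: "exp_growth ?h" "exp_growth (\<lambda>x. F x * G x)" "exp_growth (\<lambda>x. F' x * G x)"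
    "exp_growth (\<lambda>x. F x * (x $ i * G x - G' x))"
    by (intro exp_growth_diff exp_growth_mult exp_growth_component g)+
  note meas = h[THEN exp_growth_borel]
  note int = h[THEN exp_growth_integrable]
  have "has_partial i (\<lambda>x. gdens x * (F x * G x))
     (\<lambda>x. - (x $ i) * gdens x * (F x * G x) + gdens x * (F' x * G x + F x * G' x))"
    by (intro has_partial_mult has_partial_gdens F G)
  also have "(\<lambda>x. - (x $ i) * gdens x * (F x * G x) + gdens x * (F' x * G x + F x * G' x)) =
    (\<lambda>x. gdens x * ?h x)"
    by (auto simp: algebra_simps)
  finally have "(\<integral>x. gdens x * ?h x \<partial>lborel) = 0"
    using int meas
    by (intro integral_partial_eq_0[where K = "\<lambda>x. gdens x * (F x * G x)"])
       (simp_all add: integrable_gauss_iff[symmetric] continuous_on_mult continuous_gdens exp_growth_continuous[OF h(1)])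
  then have "(\<integral>x. ?h x \<partial>gauss) = 0"
    using meas by (simp add: integral_gauss_eq)
  then show ?thesis
    using int by simp
qed

section \<open>Hermite polynomials\<close>

text \<open>The probabilists' Hermite polynomials by their three-term recurrence, which is easier to
  induct on than the iterated derivative in \<open>hermite\<close>; the two are identified in
  \<open>hermite_eq\<close>.\<close>

fun he :: "nat \<Rightarrow> real \<Rightarrow> real" where
  "he 0 x = 1"
| "he (Suc 0) x = x"
| "he (Suc (Suc k)) x = x * he (Suc k) x - real (Suc k) * he k x"

text \<open>A form of the recurrence that covers \<open>k = 0\<close>: there the truncated index
  \<open>k - 1\<close> is 0 and the factor \<open>real k\<close> removes the term.
  \<open>down\<close> relies on the same convention.\<close>

lemma he_times: "x * he k x = he (Suc k) x + real k * he (k - 1) x"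
  by (cases k) auto

text \<open>Differentiating the recurrence leaves a multiple of
  \<open>x * he k x - real k * he (k - 1) x\<close> next to \<open>he (Suc k) x\<close>, and the
  recurrence itself turns that difference back into \<open>he (Suc k) x\<close>.\<close>

lemma DERIV_he: "(he k has_real_derivative real k * he (k - 1) x) (at x)"
proof (induction k x rule: he.induct)
  case (3 k x)
  have "((\<lambda>x. x * he (Suc k) x - real (Suc k) * he k x) has_real_derivative
      (he (Suc k) x + real (Suc k) * he k x * x) - real (Suc k) * (real k * he (k - 1) x)) (at x)"
    using 3 by (auto intro!: derivative_eq_intros)
  moreover have "(he (Suc k) x + real (Suc k) * he k x * x) - real (Suc k) * (real k * he (k - 1) x) =
      he (Suc k) x + real (Suc k) * (x * he k x - real k * he (k - 1) x)"
    by (simp only: right_diff_distrib mult_ac add_diff_eq)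
  moreover have "\<dots> = real (Suc (Suc k)) * he (Suc k) x"
    by (simp only: he_times) (simp add: algebra_simps)
  ultimately have "((\<lambda>x. x * he (Suc k) x - real (Suc k) * he k x) has_real_derivative
      real (Suc (Suc k)) * he (Suc k) x) (at x)"
    by (simp only:)
  then show ?case
    by (simp only: he.simps diff_Suc_1)
qed (auto intro!: derivative_eq_intros)

text \<open>Rodrigues' formula. One more differentiation produces the factor
  \<open>real k * he (k - 1) x - x * he k x\<close>, which is \<open>- he (Suc k) x\<close>; hence
  the alternating sign.\<close>

lemma deriv_funpow_gaussian:
  "(deriv ^^ k) (\<lambda>y::real. exp (- y\<^sup>2 / 2)) = (\<lambda>x. (-1) ^ k * he k x * exp (- x\<^sup>2 / 2))"
proof (induction k)
  case (Suc k)
  have "deriv (\<lambda>x. (-1) ^ k * he k x * exp (- x\<^sup>2 / 2)) x = (-1) ^ Suc k * he (Suc k) x * exp (- x\<^sup>2 / 2)" for x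
  proof (rule DERIV_imp_deriv)
    have "((\<lambda>x. (-1) ^ k * he k x * exp (- x\<^sup>2 / 2)) has_real_derivative
        (-1) ^ k * (real k * he (k - 1) x) * exp (- x\<^sup>2 / 2) +
        (-1) ^ k * he k x * (exp (- x\<^sup>2 / 2) * (- x))) (at x)"
      by (auto intro!: derivative_eq_intros DERIV_he simp: algebra_simps)
    moreover have "(-1) ^ k * (real k * he (k - 1) x) * exp (- x\<^sup>2 / 2) +
        (-1) ^ k * he k x * (exp (- x\<^sup>2 / 2) * (- x)) =
        (-1) ^ k * (real k * he (k - 1) x - x * he k x) * exp (- x\<^sup>2 / 2)"
      by (simp add: algebra_simps)
    ultimately show "((\<lambda>x. (-1) ^ k * he k x * exp (- x\<^sup>2 / 2)) has_real_derivative
        (-1) ^ Suc k * he (Suc k) x * exp (- x\<^sup>2 / 2)) (at x)"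
      by (simp add: he_times)
  qed
  then show ?case
    by (simp only: funpow.simps comp_def Suc.IH)
qed auto

lemma hermite_eq: "hermite k x = he k x"
proof -
  have "hermite k x = ((-1) ^ k * (-1) ^ k) * he k x * (exp (x\<^sup>2 / 2) * exp (- x\<^sup>2 / 2))"
    unfolding hermite_def deriv_funpow_gaussian by (simp only: mult_ac)
  then show ?thesis
    by (simp flip: power_mult_distrib exp_add)
qed

lemma hermite_0 [simp]: "hermite 0 x = 1"
  by (simp add: hermite_eq)

lemma hermite_times: "x * hermite k x = hermite (Suc k) x + real k * hermite (k - 1) x"
  by (simp add: hermite_eq he_times)

lemma DERIV_hermite: "(hermite k has_real_derivative real k * hermite (k - 1) x) (at x)"
  using DERIV_he[of k x] by (simp add: hermite_eq[abs_def])

lemma exp_growth_hermite: "exp_growth (\<lambda>x. hermite k (x $ i))"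
proof -
  \<comment> \<open>Two consecutive indices are carried along because the recurrence reaches back
    two steps.\<close>
  have "exp_growth (\<lambda>x :: real ^ 'n. he k (x $ i)) \<and> exp_growth (\<lambda>x :: real ^ 'n. he (Suc k) (x $ i))"
    for i :: "'n::finite" and k
    by (induction k) (auto intro!: exp_growth_diff exp_growth_mult)
  from this[THEN conjunct1] show ?thesis
    by (simp only: hermite_eq)
qed

section \<open>Multi-indices and Hermite polynomials in several variables\<close>

abbreviation up :: "'n \<Rightarrow> ('n \<Rightarrow> nat) \<Rightarrow> ('n \<Rightarrow> nat)" where
  "up i \<alpha> \<equiv> \<alpha>(i := Suc (\<alpha> i))"

abbreviation down :: "'n \<Rightarrow> ('n \<Rightarrow> nat) \<Rightarrow> ('n \<Rightarrow> nat)" where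
  "down i \<alpha> \<equiv> \<alpha>(i := \<alpha> i - 1)"

definition deg :: "('n::finite \<Rightarrow> nat) \<Rightarrow> nat" where
  "deg \<alpha> = (\<Sum>i\<in>UNIV. \<alpha> i)"

text \<open>This multi-index factorial is the squared norm of \<open>hermite_multi \<alpha>\<close>,
  as \<open>hermite_orthogonal\<close> shows.\<close>

definition mfact :: "('n::finite \<Rightarrow> nat) \<Rightarrow> real" where
  "mfact \<alpha> = (\<Prod>i\<in>UNIV. fact (\<alpha> i))"

lemma mfact_pos [simp]: "mfact \<alpha> > 0"
  unfolding mfact_def by (intro prod_pos) auto

lemma mfact_nonzero [simp]: "mfact \<alpha> \<noteq> 0"
  using mfact_pos[of \<alpha>] by linarith

lemma mfact_nonneg [simp]: "mfact \<alpha> \<ge> 0"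
  using mfact_pos[of \<alpha>] by linarith

lemma deg_up [simp]: "deg (up i \<alpha>) = Suc (deg \<alpha>)"
  unfolding deg_def by (subst (1 2) sum.remove[of UNIV i]) auto

lemma mfact_up: "mfact (up i \<alpha>) = real (Suc (\<alpha> i)) * mfact \<alpha>"
  unfolding mfact_def by (subst (1 2) prod.remove[of UNIV i]) (auto simp: algebra_simps)

lemma deg_eq_0_iff: "deg \<alpha> = 0 \<longleftrightarrow> \<alpha> = (\<lambda>_. 0)"
  unfolding deg_def by auto

lemma component_times_hermite_multi:
  "x $ i * hermite_multi \<alpha> x = hermite_multi (up i \<alpha>) x + real (\<alpha> i) * hermite_multi (down i \<alpha>) x"
proof -
  have "x $ i * hermite_multi \<alpha> x = (x $ i * hermite (\<alpha> i) (x $ i)) * (\<Prod>j\<in>UNIV - {i}. hermite (\<alpha> j) (x $ j))"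
    unfolding hermite_multi_def by (subst prod.remove[of UNIV i]) auto
  also have "\<dots> = hermite (Suc (\<alpha> i)) (x $ i) * (\<Prod>j\<in>UNIV - {i}. hermite (\<alpha> j) (x $ j)) +
      real (\<alpha> i) * (hermite (\<alpha> i - 1) (x $ i) * (\<Prod>j\<in>UNIV - {i}. hermite (\<alpha> j) (x $ j)))"
    by (simp only: hermite_times) (simp add: algebra_simps)
  also have "hermite (Suc (\<alpha> i)) (x $ i) * (\<Prod>j\<in>UNIV - {i}. hermite (\<alpha> j) (x $ j)) = hermite_multi (up i \<alpha>) x"
    unfolding hermite_multi_def by (subst prod.remove[of UNIV i]) auto
  also have "hermite (\<alpha> i - 1) (x $ i) * (\<Prod>j\<in>UNIV - {i}. hermite (\<alpha> j) (x $ j)) = hermite_multi (down i \<alpha>) x"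
    unfolding hermite_multi_def by (subst prod.remove[of UNIV i]) auto
  finally show ?thesis .
qed

lemma has_partial_hermite_multi:
  "has_partial i (hermite_multi \<alpha>) (\<lambda>x. real (\<alpha> i) * hermite_multi (down i \<alpha>) x)"
proof -
  have "(\<lambda>x. real (\<alpha> i) * hermite (\<alpha> i - 1) (x $ i) * (\<Prod>j\<in>UNIV - {i}. hermite (\<alpha> j) (x $ j))) =
      (\<lambda>x. real (\<alpha> i) * hermite_multi (down i \<alpha>) x)"
    unfolding hermite_multi_def by (subst prod.remove[of UNIV i]) (auto simp: mult.assoc)
  then show ?thesis
    using has_partial_prod_component[of "\<lambda>j. hermite (\<alpha> j)" i, OF DERIV_hermite]
    by (simp add: hermite_multi_def[abs_def])
qed

lemma exp_growth_hermite_multi [intro, simp]: "exp_growth (hermite_multi \<alpha>)"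
  unfolding hermite_multi_def[abs_def] by (intro exp_growth_prod exp_growth_hermite)

lemma hermite_multi_0 [simp]: "hermite_multi (\<lambda>_. 0) x = 1"
  by (simp add: hermite_multi_def)

text \<open>The adjoint of the \<open>i\<close>-th derivative raises the \<open>i\<close>-th index
  of a Hermite polynomial. This identity is the reason why weak derivatives appear as
  \<open>up i\<close> on coefficients.\<close>

lemma hermite_ibp:
  assumes "has_partial i G G'" "exp_growth G" "exp_growth G'"
  shows "(\<integral>x. G' x * hermite_multi \<alpha> x \<partial>gauss) = (\<integral>x. G x * hermite_multi (up i \<alpha>) x \<partial>gauss)"
proof -
  have "x $ i * hermite_multi \<alpha> x - real (\<alpha> i) * hermite_multi (down i \<alpha>) x = hermite_multi (up i \<alpha>) x" for x
    by (simp add: component_times_hermite_multi)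
  then show ?thesis
    using gauss_ibp[OF assms(1) has_partial_hermite_multi[of i \<alpha>] assms(2,3)]
    by (auto simp del: fun_upd_apply)
qed

text \<open>Induction on the degree of \<alpha>. Integration by parts lowers \<alpha> and \<beta> in
  a common direction at the price of a factor \<open>real (\<beta> i)\<close>, and these factors
  build up \<open>mfact \<alpha>\<close>. At \<alpha> = 0 a nonzero \<beta> is a raised index, and
  the derivative of the constant 1 vanishes.\<close>

lemma hermite_orthogonal:
  "(\<integral>x. hermite_multi \<alpha> x * hermite_multi \<beta> x \<partial>(gauss :: (real ^ 'n::finite) measure)) = (if \<alpha> = \<beta> then mfact \<alpha> else 0)"
proof (induction "deg \<alpha>" arbitrary: \<alpha> \<beta>)
  case 0
  then have \<alpha>: "\<alpha> = (\<lambda>_. 0)"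
    by (simp add: deg_eq_0_iff)
  show ?case
  proof (cases "\<beta> = \<alpha>")
    case True
    then show ?thesis
      using gauss.prob_space[where 'n = 'n] by (simp add: \<alpha> mfact_def)
  next
    case False
    then obtain i where "\<beta> i \<noteq> 0"
      using \<alpha> by auto
    then have \<beta>: "\<beta> = up i (down i \<beta>)"
      by auto
    have "(\<integral>x. 0 * hermite_multi (down i \<beta>) x \<partial>(gauss :: (real ^ 'n) measure)) =
        (\<integral>x. 1 * hermite_multi (up i (down i \<beta>)) x \<partial>gauss)"
      by (rule hermite_ibp) auto
    then show ?thesis
      using False \<beta> by (simp add: \<alpha>)
  qed
next
  case (Suc n)
  then have "deg \<alpha> \<noteq> 0"
    by simp
  then obtain i where i: "\<alpha> i \<noteq> 0"
    by (auto simp: deg_eq_0_iff)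
  define \<alpha>' where "\<alpha>' = down i \<alpha>"
  have \<alpha>: "\<alpha> = up i \<alpha>'"
    using i by (auto simp: \<alpha>'_def)
  have n: "n = deg \<alpha>'"
    using Suc(2) unfolding \<alpha> by simp
  have "(\<integral>x. hermite_multi \<alpha> x * hermite_multi \<beta> x \<partial>(gauss :: (real ^ 'n) measure)) =
      (\<integral>x. hermite_multi \<beta> x * hermite_multi (up i \<alpha>') x \<partial>gauss)"
    unfolding \<alpha> by (simp only: mult.commute)
  also have "\<dots> = (\<integral>x. real (\<beta> i) * hermite_multi (down i \<beta>) x * hermite_multi \<alpha>' x \<partial>gauss)"
    by (rule hermite_ibp[symmetric, OF has_partial_hermite_multi]) auto
  also have "\<dots> = real (\<beta> i) * (\<integral>x. hermite_multi \<alpha>' x * hermite_multi (down i \<beta>) x \<partial>gauss)"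
    unfolding integral_mult_right_zero[symmetric] by (simp only: mult_ac)
  also have "\<dots> = real (\<beta> i) * (if \<alpha>' = down i \<beta> then mfact \<alpha>' else 0)"
    using Suc(1)[OF n, of "down i \<beta>"] by (simp only:)
  also have "\<dots> = (if \<alpha> = \<beta> then mfact \<alpha> else 0)"
  proof (cases "\<alpha> = \<beta>")
    case True
    then have "\<beta> i = Suc (\<alpha>' i)" "\<alpha>' = down i \<beta>"
      using i by (auto simp: \<alpha>'_def)
    then show ?thesis
      using True \<alpha> mfact_up[of \<alpha>' i] by auto
  next
    case False
    have "\<beta> i = 0 \<or> \<alpha>' \<noteq> down i \<beta>"
    proof (rule ccontr)
      assume "\<not> (\<beta> i = 0 \<or> \<alpha>' \<noteq> down i \<beta>)"
      then have "up i \<alpha>' = \<beta>"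
        by auto
      then show False
        using False \<alpha> by simp
    qed
    then show ?thesis
      using False by auto
  qed
  finally show ?case .
qed

section \<open>The space \<open>L\<^sup>2\<close>\<close>

lemma L2I: "f \<in> borel_measurable borel \<Longrightarrow> integrable gauss (\<lambda>x. (f x)\<^sup>2) \<Longrightarrow> f \<in> L2"
  by (simp add: L2_def)

lemma L2_borel [measurable_dest]: "f \<in> L2 \<Longrightarrow> f \<in> borel_measurable borel"
  unfolding L2_def using measurable_cong_sets[OF sets_gauss refl] by blast

lemma L2_integrable_square: "f \<in> L2 \<Longrightarrow> integrable gauss (\<lambda>x. (f x)\<^sup>2)"
  by (simp add: L2_def)

lemma exp_growth_L2: "exp_growth f \<Longrightarrow> f \<in> L2"
  using exp_growth_integrable[OF exp_growth_mult[of f f]] exp_growth_borel[of f]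
  by (auto intro!: L2I simp: power2_eq_square)

lemma L2_bounded:
  assumes [measurable]: "f \<in> borel_measurable borel" and "\<And>x. \<bar>f x\<bar> \<le> B"
  shows "f \<in> L2"
proof (rule L2I)
  have "(f x)\<^sup>2 \<le> B\<^sup>2" for x
    using assms(2)[of x] by (metis abs_ge_zero power2_abs power_mono)
  then show "integrable gauss (\<lambda>x. (f x)\<^sup>2)"
    by (intro gauss.integrable_const_bound[where B = "B\<^sup>2"]) auto
qed fact

lemma L2_integrable_mult:
  assumes [measurable]: "f \<in> L2" "g \<in> L2"
  shows "integrable gauss (\<lambda>x. f x * g x)"
proof (rule Bochner_Integration.integrable_bound)
  show "integrable gauss (\<lambda>x. (f x)\<^sup>2 + (g x)\<^sup>2)"
    using assms by (intro Bochner_Integration.integrable_add L2_integrable_square)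
  have "\<bar>f x * g x\<bar> \<le> (f x)\<^sup>2 + (g x)\<^sup>2" for x
  proof -
    have "0 \<le> (\<bar>f x\<bar> - \<bar>g x\<bar>)\<^sup>2" by simp
    then have "2 * (\<bar>f x\<bar> * \<bar>g x\<bar>) \<le> (f x)\<^sup>2 + (g x)\<^sup>2"
      by (simp add: power2_diff)
    moreover have "0 \<le> \<bar>f x\<bar> * \<bar>g x\<bar>"
      by simp
    ultimately show ?thesis
      unfolding abs_mult by linarith
  qed
  then show "AE x in gauss. norm (f x * g x) \<le> norm ((f x)\<^sup>2 + (g x)\<^sup>2)"
    by (intro AE_I2) (auto simp: abs_of_nonneg)
qed measurable

lemma L2_const [simp]: "(\<lambda>x. c) \<in> L2"
  by (intro exp_growth_L2) simp

lemma L2_integrable: "f \<in> L2 \<Longrightarrow> integrable gauss f"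
  using L2_integrable_mult[of f "\<lambda>x. 1"] by simp

lemma L2_add [intro]:
  assumes "f \<in> L2" "g \<in> L2"
  shows "(\<lambda>x. f x + g x) \<in> L2"
proof (rule L2I)
  have "integrable gauss (\<lambda>x. (f x)\<^sup>2 + (g x)\<^sup>2 + 2 * (f x * g x))"
    using assms by (intro Bochner_Integration.integrable_add integrable_mult_right
        L2_integrable_square L2_integrable_mult)
  then show "integrable gauss (\<lambda>x. (f x + g x)\<^sup>2)"
    by (simp add: power2_sum mult.assoc)
qed (use assms in measurable)

lemma L2_cmult [intro]: "f \<in> L2 \<Longrightarrow> (\<lambda>x. c * f x) \<in> L2"
  unfolding L2_def by (auto simp: power_mult_distrib)

lemma L2_diff [intro]:
  assumes "f \<in> L2" "g \<in> L2"
  shows "(\<lambda>x. f x - g x) \<in> L2"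
  using L2_add[OF assms(1) L2_cmult[OF assms(2), of "-1"]] by simp

lemma L2_sum [intro]: "(\<And>a. a \<in> S \<Longrightarrow> f a \<in> L2) \<Longrightarrow> (\<lambda>x. \<Sum>a\<in>S. f a x) \<in> L2"
  by (induction S rule: infinite_finite_induct) auto

lemma L2_abs [intro]: "f \<in> L2 \<Longrightarrow> (\<lambda>x. \<bar>f x\<bar>) \<in> L2"
  unfolding L2_def by auto

lemma L2_bounded_mult:
  assumes [measurable]: "f \<in> L2" "b \<in> borel_measurable borel" and B: "\<And>x. \<bar>b x\<bar> \<le> B"
  shows "(\<lambda>x. b x * f x) \<in> L2"
proof (rule L2I)
  show "integrable gauss (\<lambda>x. (b x * f x)\<^sup>2)"
  proof (rule Bochner_Integration.integrable_bound)
    show "integrable gauss (\<lambda>x. B\<^sup>2 * (f x)\<^sup>2)"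
      by (intro integrable_mult_right L2_integrable_square assms)
    have "(b x)\<^sup>2 \<le> B\<^sup>2" for x
      using B[of x] by (metis abs_ge_zero power2_abs power_mono)
    then show "AE x in gauss. norm ((b x * f x)\<^sup>2) \<le> norm (B\<^sup>2 * (f x)\<^sup>2)"
      by (intro AE_I2) (auto simp: power_mult_distrib intro!: mult_right_mono)
  qed measurable
qed measurable

section \<open>The Gaussian norm and its inequalities\<close>

definition nrm :: "(real ^ 'n::finite \<Rightarrow> real) \<Rightarrow> real" where
  "nrm f = sqrt (\<integral>x. (f x)\<^sup>2 \<partial>gauss)"

lemma nrm_nonneg [simp]: "nrm f \<ge> 0"
  by (simp add: nrm_def)

lemma nrm_square: "(nrm f)\<^sup>2 = (\<integral>x. (f x)\<^sup>2 \<partial>gauss)"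
  by (simp add: nrm_def)

lemma nrm_cmult: "nrm (\<lambda>x. c * f x) = \<bar>c\<bar> * nrm f"
  by (simp add: nrm_def power_mult_distrib real_sqrt_mult)

lemma nrm_minus_commute: "nrm (\<lambda>x. f x - g x) = nrm (\<lambda>x. g x - f x)"
  by (simp add: nrm_def power2_commute)

text \<open>A quadratic form in \<open>a\<close> and \<open>b\<close> is nonnegative, and
  \<open>a = nrm g\<close>, \<open>b = nrm f\<close> gives the claim. The absolute value stands
  inside the integral because L1 bounds are derived from this version.\<close>

lemma gauss_Cauchy_Schwarz_abs:
  assumes f: "f \<in> L2" and g: "g \<in> L2"
  shows "(\<integral>x. \<bar>f x * g x\<bar> \<partial>gauss) \<le> nrm f * nrm g"
proof -
  have [measurable]: "f \<in> borel_measurable borel" "g \<in> borel_measurable borel"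
    using f g by auto
  let ?I = "\<integral>x. \<bar>f x * g x\<bar> \<partial>gauss"
  have fg: "integrable gauss (\<lambda>x. \<bar>f x * g x\<bar>)"
    using L2_integrable_mult[OF f g] by simp
  have quad: "0 \<le> a\<^sup>2 * (nrm f)\<^sup>2 + b\<^sup>2 * (nrm g)\<^sup>2 - 2 * a * b * ?I" for a b
  proof -
    have "0 \<le> (\<integral>x. (a * \<bar>f x\<bar> - b * \<bar>g x\<bar>)\<^sup>2 \<partial>gauss)"
      by simp
    also have "\<dots> = (\<integral>x. a\<^sup>2 * (f x)\<^sup>2 + b\<^sup>2 * (g x)\<^sup>2 - 2 * a * b * \<bar>f x * g x\<bar> \<partial>gauss)"
      by (intro Bochner_Integration.integral_cong)
        (auto simp: power2_diff power_mult_distrib abs_mult)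
    also have "\<dots> = a\<^sup>2 * (nrm f)\<^sup>2 + b\<^sup>2 * (nrm g)\<^sup>2 - 2 * a * b * ?I"
      using L2_integrable_square[OF f] L2_integrable_square[OF g] fg by (simp add: nrm_square)
    finally show ?thesis .
  qed
  show ?thesis
  proof (cases "nrm f * nrm g = 0")
    case False
    then have "nrm f * nrm g > 0"
      by (simp add: less_le)
    moreover have "2 * (nrm f * nrm g) * ?I \<le> 2 * (nrm f * nrm g) * (nrm f * nrm g)"
      using quad[of "nrm g" "nrm f"] by (simp add: power2_eq_square algebra_simps)
    ultimately show ?thesis
      using mult_le_cancel_left_pos[of "2 * (nrm f * nrm g)" ?I "nrm f * nrm g"] by linarith
  next
    case True
    show ?thesis
    proof (rule ccontr)
      assume "\<not> ?thesis"
      then have I: "?I > 0"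
        using True by simp
      from True consider "nrm f = 0" | "nrm g = 0"
        by auto
      then show False
      proof cases
        \<comment> \<open>When one norm vanishes the form is linear in the corresponding
          coefficient. The chosen one makes the mixed term exceed the remaining square, so the form
          would be negative.\<close>
        case 1
        then show False
          using quad[of "((nrm g)\<^sup>2 + 1) / ?I" 1] I zero_le_power2[of "nrm g"] by (simp del: zero_le_power2)
      next
        case 2
        then show False
          using quad[of 1 "((nrm f)\<^sup>2 + 1) / ?I"] I zero_le_power2[of "nrm f"] by (simp del: zero_le_power2)
      qed
    qed
  qed
qed

lemma gauss_Cauchy_Schwarz:
  assumes "f \<in> L2" "g \<in> L2"
  shows "\<bar>\<integral>x. f x * g x \<partial>gauss\<bar> \<le> nrm f * nrm g"
  using gauss_Cauchy_Schwarz_abs[OF assms] integral_abs_bound[of gauss "\<lambda>x. f x * g x"] by linarith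

lemma nrm_const [simp]: "nrm (\<lambda>x :: real ^ 'n::finite. c) = \<bar>c\<bar>"
  using gauss.prob_space[where 'n = 'n] by (simp add: nrm_def)

lemma L1_le_nrm: "f \<in> L2 \<Longrightarrow> (\<integral>x. \<bar>f x\<bar> \<partial>gauss) \<le> nrm f"
  using gauss_Cauchy_Schwarz_abs[of f "\<lambda>x. 1"] by simp

lemma nrm_triangle:
  assumes f: "f \<in> L2" and g: "g \<in> L2"
  shows "nrm (\<lambda>x. f x + g x) \<le> nrm f + nrm g"
proof (rule power2_le_imp_le)
  have "(nrm (\<lambda>x. f x + g x))\<^sup>2 = (nrm f)\<^sup>2 + (nrm g)\<^sup>2 + 2 * (\<integral>x. f x * g x \<partial>gauss)"
    using L2_integrable_square[OF f] L2_integrable_square[OF g] L2_integrable_mult[OF f g]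
    by (simp add: nrm_square power2_sum mult.assoc)
  also have "\<dots> \<le> (nrm f + nrm g)\<^sup>2"
    using gauss_Cauchy_Schwarz[OF f g] by (simp add: power2_sum)
  finally show "(nrm (\<lambda>x. f x + g x))\<^sup>2 \<le> (nrm f + nrm g)\<^sup>2" .
qed simp

section \<open>Norm convergence and completeness\<close>

definition L2_tendsto :: "(nat \<Rightarrow> real ^ 'n::finite \<Rightarrow> real) \<Rightarrow> (real ^ 'n \<Rightarrow> real) \<Rightarrow> bool" where
  "L2_tendsto F f \<longleftrightarrow> (\<forall>n. F n \<in> L2) \<and> f \<in> L2 \<and> (\<lambda>n. nrm (\<lambda>x. F n x - f x)) \<longlonglongrightarrow> 0"

lemma L2_tendsto_inner:
  assumes "L2_tendsto F f" "L2_tendsto G g"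
  shows "(\<lambda>n. \<integral>x. F n x * G n x \<partial>gauss) \<longlonglongrightarrow> (\<integral>x. f x * g x \<partial>gauss)"
proof -
  have L2: "F n \<in> L2" "G n \<in> L2" "f \<in> L2" "g \<in> L2" for n
    using assms by (auto simp: L2_tendsto_def)
  let ?a = "\<lambda>n. nrm (\<lambda>x. F n x - f x)" and ?b = "\<lambda>n. nrm (\<lambda>x. G n x - g x)"
  have "norm ((\<integral>x. F n x * G n x \<partial>gauss) - (\<integral>x. f x * g x \<partial>gauss)) \<le>
     ?a n * ?b n + ?a n * nrm g + nrm f * ?b n" for n
  proof -
    have "(\<integral>x. F n x * G n x \<partial>gauss) - (\<integral>x. f x * g x \<partial>gauss) =
        (\<integral>x. F n x * G n x - f x * g x \<partial>gauss)"
      using L2 by (simp add: L2_integrable_mult)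
    also have "\<dots> = (\<integral>x. (F n x - f x) * (G n x - g x) + (F n x - f x) * g x + f x * (G n x - g x) \<partial>gauss)"
      by (simp add: algebra_simps)
    also have "\<dots> = (\<integral>x. (F n x - f x) * (G n x - g x) \<partial>gauss) + (\<integral>x. (F n x - f x) * g x \<partial>gauss) +
        (\<integral>x. f x * (G n x - g x) \<partial>gauss)"
      using L2 by (simp only: Bochner_Integration.integral_add Bochner_Integration.integrable_add
          L2_integrable_mult L2_diff)
    finally have eq: "(\<integral>x. F n x * G n x \<partial>gauss) - (\<integral>x. f x * g x \<partial>gauss) = \<dots>" .
    show ?thesis
      unfolding eq real_norm_def
      using gauss_Cauchy_Schwarz[OF L2_diff[OF L2(1)[of n] L2(3)] L2_diff[OF L2(2)[of n] L2(4)]]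
        gauss_Cauchy_Schwarz[OF L2_diff[OF L2(1)[of n] L2(3)] L2(4)]
        gauss_Cauchy_Schwarz[OF L2(3) L2_diff[OF L2(2)[of n] L2(4)]]
      by linarith
  qed
  then have ev: "\<forall>\<^sub>F n in sequentially. norm ((\<integral>x. F n x * G n x \<partial>gauss) - (\<integral>x. f x * g x \<partial>gauss)) \<le>
     ?a n * ?b n + ?a n * nrm g + nrm f * ?b n"
    by (intro always_eventually allI)
  have "(\<lambda>n. ?a n * ?b n + ?a n * nrm g + nrm f * ?b n) \<longlonglongrightarrow> 0 * 0 + 0 * nrm g + nrm f * 0"
    using assms by (intro tendsto_intros) (auto simp: L2_tendsto_def)
  then have "(\<lambda>n. ?a n * ?b n + ?a n * nrm g + nrm f * ?b n) \<longlonglongrightarrow> 0"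
    by simp
  from Lim_null_comparison[OF ev this] show ?thesis
    by (rule LIM_zero_cancel)
qed

lemma L2_tendsto_const: "f \<in> L2 \<Longrightarrow> L2_tendsto (\<lambda>n. f) f"
  by (simp add: L2_tendsto_def)

lemma L2_tendsto_inner_const:
  assumes "L2_tendsto F f" "g \<in> L2"
  shows "(\<lambda>n. \<integral>x. F n x * g x \<partial>gauss) \<longlonglongrightarrow> (\<integral>x. f x * g x \<partial>gauss)"
  using L2_tendsto_inner[OF assms(1) L2_tendsto_const[OF assms(2)]] .

lemma L2_tendsto_abs:
  assumes "L2_tendsto F f"
  shows "L2_tendsto (\<lambda>n x. \<bar>F n x\<bar>) (\<lambda>x. \<bar>f x\<bar>)"
  unfolding L2_tendsto_def
proof (intro conjI allI)
  show L2: "(\<lambda>x. \<bar>F n x\<bar>) \<in> L2" "(\<lambda>x. \<bar>f x\<bar>) \<in> L2" for n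
    using assms by (auto simp: L2_tendsto_def)
  show "(\<lambda>n. nrm (\<lambda>x. \<bar>F n x\<bar> - \<bar>f x\<bar>)) \<longlonglongrightarrow> 0"
  proof (rule tendsto_sandwich[OF _ _ tendsto_const])
    show "(\<lambda>n. nrm (\<lambda>x. F n x - f x)) \<longlonglongrightarrow> 0"
      using assms by (auto simp: L2_tendsto_def)
    have "nrm (\<lambda>x. \<bar>F n x\<bar> - \<bar>f x\<bar>) \<le> nrm (\<lambda>x. F n x - f x)" for n
      unfolding nrm_def
    proof (intro real_sqrt_le_mono integral_mono)
      show "(\<bar>F n x\<bar> - \<bar>f x\<bar>)\<^sup>2 \<le> (F n x - f x)\<^sup>2" for x
        using abs_triangle_ineq3[of "F n x" "f x"] by (rule abs_le_square_iff[THEN iffD1])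
    qed (use L2 assms in \<open>auto intro!: L2_integrable_square L2_diff simp: L2_tendsto_def\<close>)
    then show "\<forall>\<^sub>F n in sequentially. nrm (\<lambda>x. \<bar>F n x\<bar> - \<bar>f x\<bar>) \<le> nrm (\<lambda>x. F n x - f x)"
      by simp
  qed auto
qed

lemma L2_tendsto_add:
  assumes "L2_tendsto F f" "L2_tendsto G g"
  shows "L2_tendsto (\<lambda>n x. F n x + G n x) (\<lambda>x. f x + g x)"
  unfolding L2_tendsto_def
proof (intro conjI allI)
  have L2: "F n \<in> L2" "G n \<in> L2" "f \<in> L2" "g \<in> L2" for n
    using assms by (auto simp: L2_tendsto_def)
  show "(\<lambda>x. F n x + G n x) \<in> L2" "(\<lambda>x. f x + g x) \<in> L2" for n
    using L2 by auto
  show "(\<lambda>n. nrm (\<lambda>x. (F n x + G n x) - (f x + g x))) \<longlonglongrightarrow> 0"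
  proof (rule tendsto_sandwich[OF _ _ tendsto_const])
    show "(\<lambda>n. nrm (\<lambda>x. F n x - f x) + nrm (\<lambda>x. G n x - g x)) \<longlonglongrightarrow> 0"
      using tendsto_add[of "\<lambda>n. nrm (\<lambda>x. F n x - f x)" 0 _ "\<lambda>n. nrm (\<lambda>x. G n x - g x)" 0] assms
      by (auto simp: L2_tendsto_def)
    have "nrm (\<lambda>x. (F n x + G n x) - (f x + g x)) \<le> nrm (\<lambda>x. F n x - f x) + nrm (\<lambda>x. G n x - g x)" for n
      using nrm_triangle[OF L2_diff[OF L2(1)[of n] L2(3)] L2_diff[OF L2(2)[of n] L2(4)]]
      by (simp add: algebra_simps)
    then show "\<forall>\<^sub>F n in sequentially. nrm (\<lambda>x. (F n x + G n x) - (f x + g x)) \<le>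
        nrm (\<lambda>x. F n x - f x) + nrm (\<lambda>x. G n x - g x)"
      by simp
  qed auto
qed

text \<open>Serves to pass to the limit in bounded nonlinear functions of an approximating sequence,
  for which dominated convergence needs pointwise limits.\<close>

lemma L2_tendsto_AE_subseq:
  assumes "L2_tendsto F f"
  obtains r where "strict_mono r" "AE x in gauss. (\<lambda>n. F (r n) x) \<longlonglongrightarrow> f x"
proof -
  have L2: "F n \<in> L2" "f \<in> L2" for n
    using assms by (auto simp: L2_tendsto_def)
  have lim: "(\<lambda>n. (nrm (\<lambda>x. F n x - f x))\<^sup>2) \<longlonglongrightarrow> 0\<^sup>2"
    using assms by (intro tendsto_power) (auto simp: L2_tendsto_def)
  have "\<exists>r::nat\<Rightarrow>nat. strict_mono r \<and> (AE x in gauss. (\<lambda>n. (F (r n) x - f x)\<^sup>2) \<longlonglongrightarrow> 0)"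
  proof (rule tendsto_L1_AE_subseq)
    show "integrable gauss (\<lambda>x. (F n x - f x)\<^sup>2)" for n
      by (intro L2_integrable_square L2_diff L2)
    show "(\<lambda>n. \<integral>x. norm ((F n x - f x)\<^sup>2) \<partial>gauss) \<longlonglongrightarrow> 0"
      using lim by (simp add: nrm_square)
  qed
  then obtain r :: "nat \<Rightarrow> nat" where r: "strict_mono r"
    "AE x in gauss. (\<lambda>n. (F (r n) x - f x)\<^sup>2) \<longlonglongrightarrow> 0"
    by blast
  have "AE x in gauss. (\<lambda>n. F (r n) x) \<longlonglongrightarrow> f x"
    using r(2)
  proof eventually_elim
    case (elim x)
    have "(\<lambda>n. sqrt ((F (r n) x - f x)\<^sup>2)) \<longlonglongrightarrow> sqrt 0"
      using elim by (intro tendsto_real_sqrt)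
    then show ?case
      by (auto simp: tendsto_rabs_zero_iff intro: LIM_zero_cancel)
  qed
  then show ?thesis
    using r(1) that by blast
qed

text \<open>Along a fast subsequence the increments are summable in L1, hence almost everywhere;
  Fatou's lemma then bounds the norm distance from \<open>F m\<close> to the pointwise
  limit.\<close>

lemma L2_complete:
  assumes L2: "\<And>n. F n \<in> L2"
    and Cauchy: "\<And>e. e > 0 \<Longrightarrow> \<exists>N. \<forall>m\<ge>N. \<forall>n\<ge>N. nrm (\<lambda>x. F m x - F n x) < e"
  obtains f where "L2_tendsto F f"
proof -
  have [measurable]: "F n \<in> borel_measurable borel" for n
    using L2 by auto
  have "\<exists>N. \<forall>m\<ge>N. \<forall>n\<ge>N. nrm (\<lambda>x. F m x - F n x) < (1/2) ^ k" for k :: nat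
    by (rule Cauchy) simp
  then obtain N where N: "\<And>k m n. m \<ge> N k \<Longrightarrow> n \<ge> N k \<Longrightarrow> nrm (\<lambda>x. F m x - F n x) < (1/2) ^ k"
    by metis
  \<comment> \<open>The sum makes \<open>r\<close> monotone and still keeps \<open>r k\<close> above
    \<open>N k\<close>.\<close>
  define r where "r k = (\<Sum>j\<le>k. N j)" for k
  have r_ge: "r k \<ge> N k" and r_Suc: "r (Suc k) \<ge> r k" for k
    by (auto simp: r_def member_le_sum)
  have r_mono: "mono r"
    using r_Suc by (rule incseq_SucI)
  let ?D = "\<lambda>k x. \<bar>F (r (Suc k)) x - F (r k) x\<bar>"
  have D: "(\<integral>\<^sup>+ x. ennreal (?D k x) \<partial>gauss) \<le> ennreal ((1/2) ^ k)" for k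
  proof -
    have "(\<integral>\<^sup>+ x. ennreal (?D k x) \<partial>gauss) = ennreal (\<integral>x. ?D k x \<partial>gauss)"
      using L2 by (intro nn_integral_eq_integral) (auto intro!: L2_integrable L2_diff)
    also have "\<dots> \<le> ennreal ((1/2) ^ k)"
      using L1_le_nrm[OF L2_diff[OF L2 L2], of "r (Suc k)" "r k"] N[of k "r (Suc k)" "r k"] r_ge[of k] r_Suc[of k]
      by (intro ennreal_leI) linarith
    finally show ?thesis .
  qed
  have "(\<integral>\<^sup>+ x. (\<Sum>k. ennreal (?D k x)) \<partial>gauss) = (\<Sum>k. \<integral>\<^sup>+ x. ennreal (?D k x) \<partial>gauss)"
    by (rule nn_integral_suminf) measurable
  also have "\<dots> \<le> (\<Sum>k. ennreal ((1/2) ^ k))"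
    using D by (intro suminf_le) auto
  also have "\<dots> = ennreal (\<Sum>k. (1/2) ^ k)"
    by (intro suminf_ennreal2) (auto simp: summable_geometric)
  finally have "(\<integral>\<^sup>+ x. (\<Sum>k. ennreal (?D k x)) \<partial>gauss) \<noteq> \<infinity>"
    by (auto simp: top_unique)
  then have "AE x in gauss. (\<Sum>k. ennreal (?D k x)) \<noteq> \<infinity>"
    by (intro nn_integral_noteq_infinite) measurable
  then have conv: "AE x in gauss. convergent (\<lambda>k. F (r k) x)"
  proof eventually_elim
    case (elim x)
    then have "summable (\<lambda>k. ?D k x)"
      by (intro summable_suminf_not_top) auto
    then have "summable (\<lambda>k. F (r (Suc k)) x - F (r k) x)"
      by (rule summable_rabs_cancel)
    then have "convergent (\<lambda>n. \<Sum>k<n. F (r (Suc k)) x - F (r k) x)"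
      by (simp add: summable_iff_convergent)
    then have "convergent (\<lambda>n. (\<Sum>k<n. F (r (Suc k)) x - F (r k) x) + F (r 0) x)"
      by (rule convergent_add) (rule convergent_const)
    then show ?case
      by (simp only: sum_lessThan_telescope[of "\<lambda>k. F (r k) x"]) simp
  qed
  define f where "f x = lim (\<lambda>k. F (r k) x)" for x
  have [measurable]: "f \<in> borel_measurable borel"
    unfolding f_def by measurable
  have bound: "(\<integral>\<^sup>+ x. ennreal ((F m x - f x)\<^sup>2) \<partial>gauss) \<le> ennreal (((1/2) ^ k)\<^sup>2)" if "m \<ge> N k" for m k
  proof -
    have "(\<integral>\<^sup>+ x. ennreal ((F m x - f x)\<^sup>2) \<partial>gauss) =
        (\<integral>\<^sup>+ x. liminf (\<lambda>n. ennreal ((F m x - F (r n) x)\<^sup>2)) \<partial>gauss)"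
    proof (rule nn_integral_cong_AE, use conv in eventually_elim)
      case (elim x)
      then have "(\<lambda>n. F (r n) x) \<longlonglongrightarrow> f x"
        unfolding f_def by (simp add: convergent_LIMSEQ_iff)
      then have "(\<lambda>n. ennreal ((F m x - F (r n) x)\<^sup>2)) \<longlonglongrightarrow> ennreal ((F m x - f x)\<^sup>2)"
        by (intro tendsto_intros)
      then show ?case
        by (intro lim_imp_Liminf[symmetric]) auto
    qed
    also have "\<dots> \<le> liminf (\<lambda>n. \<integral>\<^sup>+ x. ennreal ((F m x - F (r n) x)\<^sup>2) \<partial>gauss)"
      by (rule nn_integral_liminf) measurable
    also have "\<dots> \<le> ennreal (((1/2) ^ k)\<^sup>2)"
    proof (rule Liminf_le)
      show "\<forall>\<^sub>F n in sequentially. (\<integral>\<^sup>+ x. ennreal ((F m x - F (r n) x)\<^sup>2) \<partial>gauss) \<le> ennreal (((1/2) ^ k)\<^sup>2)"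
        using eventually_ge_at_top[of k]
      proof eventually_elim
        case (elim n)
        have "N k \<le> r n"
          using r_ge[of k] monoD[OF r_mono elim] by linarith
        then have "(nrm (\<lambda>x. F m x - F (r n) x))\<^sup>2 \<le> ((1/2) ^ k)\<^sup>2"
          using N[OF that] by (intro power_mono) (auto simp: less_imp_le)
        moreover have "(\<integral>\<^sup>+ x. ennreal ((F m x - F (r n) x)\<^sup>2) \<partial>gauss) = ennreal ((nrm (\<lambda>x. F m x - F (r n) x))\<^sup>2)"
          unfolding nrm_square
          by (intro nn_integral_eq_integral L2_integrable_square L2_diff L2) auto
        ultimately show ?case
          by (simp add: ennreal_leI)
      qed
    qed auto
    finally show ?thesis .
  qed
  have diff: "(\<lambda>x. F m x - f x) \<in> L2" if "m \<ge> N k" for m k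
  proof (rule L2I)
    show "integrable gauss (\<lambda>x. (F m x - f x)\<^sup>2)"
      using bound[OF that] by (intro integrableI_bounded) (auto simp: less_top[symmetric] top_unique)
  qed measurable
  have fL2: "f \<in> L2"
    using L2_diff[OF L2[of "N 0"] diff[of 0 "N 0"]] by simp
  have "nrm (\<lambda>x. F m x - f x) \<le> (1/2) ^ k" if "m \<ge> N k" for m k
  proof -
    have "ennreal ((nrm (\<lambda>x. F m x - f x))\<^sup>2) \<le> ennreal (((1/2) ^ k)\<^sup>2)"
      using bound[OF that] nn_integral_eq_integral[OF L2_integrable_square[OF diff[OF that]]]
      by (simp add: nrm_square)
    then have "(nrm (\<lambda>x. F m x - f x))\<^sup>2 \<le> ((1/2) ^ k)\<^sup>2"
      by (subst (asm) ennreal_le_iff) auto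
    then show ?thesis
      by (rule power2_le_imp_le) simp
  qed note bd = this
  have "(\<lambda>n. nrm (\<lambda>x. F n x - f x)) \<longlonglongrightarrow> 0"
  proof (rule LIMSEQ_I)
    fix e :: real
    assume "e > 0"
    then obtain k where "(1/2 :: real) ^ k < e"
      using real_arch_pow_inv[of e "1/2"] by auto
    then show "\<exists>no. \<forall>n\<ge>no. norm (nrm (\<lambda>x. F n x - f x) - 0) < e"
      using bd[of k] by (intro exI[of _ "N k"]) (auto intro: order.strict_trans1)
  qed
  then show ?thesis
    using that L2 fL2 by (auto simp: L2_tendsto_def)
qed

section \<open>Completeness of the Hermite polynomials\<close>

text \<open>The positive and negative parts of \<open>h\<close> are densities of two measures that
  agree, with finite values, on all boxes. Boxes are closed under intersection and generate the
  Borel sets, so the measures agree, and then the densities do.\<close>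

lemma AE_eq_0_if_integral_box_eq_0:
  fixes h :: "real ^ 'n::finite \<Rightarrow> real"
  assumes [measurable]: "h \<in> borel_measurable borel"
    and int: "\<And>a b. integrable lborel (\<lambda>x. indicator (box a b) x * h x)"
    and zero: "\<And>a b. (\<integral>x. indicator (box a b) x * h x \<partial>lborel) = 0"
  shows "AE x in lborel. h x = 0"
proof -
  let ?p = "\<lambda>x. ennreal (h x)" and ?m = "\<lambda>x. ennreal (- h x)"
  have em: "emeasure (density lborel ?p) (box a b) = emeasure (density lborel ?m) (box a b)"
    and fin: "emeasure (density lborel ?p) (box a b) \<noteq> \<infinity>" for a b :: "real ^ 'n"
  proof -
    have 1: "emeasure (density lborel ?p) (box a b) = (\<integral>\<^sup>+ x. ennreal (indicator (box a b) x * h x) \<partial>lborel)"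
      by (subst emeasure_density) (auto intro!: nn_integral_cong simp: indicator_def)
    have 2: "emeasure (density lborel ?m) (box a b) = (\<integral>\<^sup>+ x. ennreal (- (indicator (box a b) x * h x)) \<partial>lborel)"
      by (subst emeasure_density) (auto intro!: nn_integral_cong simp: indicator_def)
    have fin1: "(\<integral>\<^sup>+ x. ennreal (indicator (box a b) x * h x) \<partial>lborel) \<noteq> \<infinity>"
      and fin2: "(\<integral>\<^sup>+ x. ennreal (- (indicator (box a b) x * h x)) \<partial>lborel) \<noteq> \<infinity>"
      using int[of a b] by (auto simp: real_integrable_def)
    then show "emeasure (density lborel ?p) (box a b) \<noteq> \<infinity>"
      using 1 by simp
    have "enn2real (\<integral>\<^sup>+ x. ennreal (indicator (box a b) x * h x) \<partial>lborel) =
        enn2real (\<integral>\<^sup>+ x. ennreal (- (indicator (box a b) x * h x)) \<partial>lborel)"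
      using zero[of a b] real_lebesgue_integral_def[OF int[of a b]] by simp
    then show "emeasure (density lborel ?p) (box a b) = emeasure (density lborel ?m) (box a b)"
      unfolding 1 2 using fin1 fin2
      by (cases "\<integral>\<^sup>+ x. ennreal (indicator (box a b) x * h x) \<partial>lborel";
          cases "\<integral>\<^sup>+ x. ennreal (- (indicator (box a b) x * h x)) \<partial>lborel") simp_all
  qed
  have "density lborel ?p = density lborel ?m"
  proof (rule measure_eqI_generator_eq[where E = "range (\<lambda>(a, b). box a b)" and \<Omega> = UNIV
        and A = "\<lambda>n. box (- (real n *\<^sub>R One)) (real n *\<^sub>R One)"])
    show "Int_stable (range (\<lambda>(a, b). box a b :: (real ^ 'n) set))"
      by (auto simp: Int_stable_def box_Int_box)
    show "sets (density lborel ?p) = sigma_sets UNIV (range (\<lambda>(a, b). box a b))"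
      "sets (density lborel ?m) = sigma_sets UNIV (range (\<lambda>(a, b). box a b))"
      by (simp_all add: borel_eq_box)
    show "(\<Union>n. box (- (real n *\<^sub>R One)) (real n *\<^sub>R One)) = (UNIV :: (real ^ 'n) set)"
      by (rule UN_box_eq_UNIV)
    show "emeasure (density lborel ?p) X = emeasure (density lborel ?m) X"
      if "X \<in> range (\<lambda>(a, b). box a b)" for X
      using that em by auto
  qed (use fin in auto)
  then have "AE x in lborel. ?p x = ?m x"
    by (intro sigma_finite_measure.density_unique[OF sigma_finite_lborel]) auto
  then show ?thesis
  proof eventually_elim
    \<comment> \<open>\<open>ennreal\<close> cuts negative values to 0, so one of the two sides is 0
      and their equality forces \<open>h x = 0\<close>.\<close>
    case (elim x)
    then show ?case
      by (cases "h x \<ge> 0") (simp_all add: ennreal_neg ennreal_eq_zero_iff)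
  qed
qed

text \<open>A class that contains \<open>L2\<close>, consists of integrable functions and is stable
  under multiplication by polynomials. The moment argument relies on this stability, and so does the
  term \<open>x $ i * D i x\<close> of the differential operator.\<close>

definition tame :: "(real ^ 'n::finite \<Rightarrow> real) \<Rightarrow> bool" where
  "tame f \<longleftrightarrow> f \<in> borel_measurable borel \<and>
     (\<forall>c. integrable gauss (\<lambda>x. f x * exp (c * abs_sum x)))"

lemma tame_borel [measurable_dest]: "tame f \<Longrightarrow> f \<in> borel_measurable borel"
  by (simp add: tame_def)

lemma tame_integrable: "tame f \<Longrightarrow> integrable gauss f"
  unfolding tame_def by (auto dest!: spec[of _ 0])

lemma L2_tame: "f \<in> L2 \<Longrightarrow> tame f"
  unfolding tame_def by (intro conjI allI L2_integrable_mult exp_growth_L2[OF exp_growth_exp] L2_borel)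

lemma tame_mult_exp_growth:
  assumes [measurable]: "tame f" and g: "exp_growth g"
  shows "tame (\<lambda>x. f x * g x)"
  unfolding tame_def
proof (intro conjI allI)
  have [measurable]: "g \<in> borel_measurable borel"
    using g by (rule exp_growth_borel)
  obtain K where K: "\<And>x. \<bar>g x\<bar> \<le> K * exp (K * abs_sum x)"
    using g unfolding exp_growth_def by blast
  show "(\<lambda>x. f x * g x) \<in> borel_measurable borel"
    by measurable
  fix c
  show "integrable gauss (\<lambda>x. f x * g x * exp (c * abs_sum x))"
  proof (rule Bochner_Integration.integrable_bound)
    show "integrable gauss (\<lambda>x. K * (f x * exp ((K + c) * abs_sum x)))"
      using assms by (intro integrable_mult_right) (simp add: tame_def)
    have "\<bar>f x * g x * exp (c * abs_sum x)\<bar> \<le> \<bar>K * (f x * exp ((K + c) * abs_sum x))\<bar>" for x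
    proof -
      have "\<bar>f x * g x * exp (c * abs_sum x)\<bar> \<le>
         \<bar>f x\<bar> * \<bar>K * exp (K * abs_sum x)\<bar> * exp (c * abs_sum x)"
        unfolding abs_mult[of "f x * g x"] abs_mult[of "f x"]
        by (intro mult_mono mult_left_mono order_trans[OF K]) auto
      also have "\<dots> = \<bar>K * (f x * exp ((K + c) * abs_sum x))\<bar>"
        by (simp add: abs_mult exp_add distrib_right)
      finally show ?thesis .
    qed
    then show "AE x in gauss. norm (f x * g x * exp (c * abs_sum x))
        \<le> norm (K * (f x * exp ((K + c) * abs_sum x)))"
      by simp
  qed measurable
qed

lemma tame_mult_bounded:
  assumes [measurable]: "tame f" "b \<in> borel_measurable borel" and "\<And>x. \<bar>b x\<bar> \<le> 1"
  shows "tame (\<lambda>x. f x * b x)"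
  unfolding tame_def
proof (intro conjI allI)
  fix c
  show "integrable gauss (\<lambda>x. f x * b x * exp (c * abs_sum x))"
  proof (rule Bochner_Integration.integrable_bound)
    show "integrable gauss (\<lambda>x. f x * exp (c * abs_sum x))"
      using assms by (simp add: tame_def)
    show "AE x in gauss. norm (f x * b x * exp (c * abs_sum x))
        \<le> norm (f x * exp (c * abs_sum x))"
      using assms(3) by (intro AE_I2) (auto simp: abs_mult mult_left_le intro!: mult_right_mono)
  qed measurable
qed measurable

text \<open>Vanishing moments in the direction \<open>j\<close> make the characteristic functions of the images of
  \<open>G\<^sup>+ \<gamma>\<close> and \<open>G\<^sup>- \<gamma>\<close> under the \<open>j\<close>-th coordinate agree.\<close>
lemma integral_indicator_component_eq_0:
  fixes G :: "real ^ 'n::finite \<Rightarrow> real"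
  assumes G[measurable]: "tame G" and zero: "\<And>k. (\<integral>x. G x * hermite k (x $ j) \<partial>gauss) = 0"
    and B[measurable]: "B \<in> sets borel"
  shows "(\<integral>x. G x * indicator B (x $ j) \<partial>gauss) = 0"
proof -
  have intG: "integrable gauss G"
    using G by (rule tame_integrable)
  have eg: "exp_growth (\<lambda>x :: real ^ 'n. (x $ j) ^ k * hermite m (x $ j))" for k m
    by (intro exp_growth_mult exp_growth_hermite, induction k) auto
  have int: "integrable gauss (\<lambda>x. G x * ((x $ j) ^ k * hermite m (x $ j)))" for k m
    by (intro tame_integrable tame_mult_exp_growth G eg)
  \<comment> \<open>Multiplication by \<open>x $ j\<close> moves to neighbouring Hermite
    polynomials, so the monomial moments vanish too; \<open>m\<close> is kept arbitrary because it
    shifts in the induction.\<close>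
  have mom: "(\<integral>x. G x * ((x $ j) ^ k * hermite m (x $ j)) \<partial>gauss) = 0" for k m
  proof (induction k arbitrary: m)
    case 0
    then show ?case using zero[of m] by simp
  next
    case (Suc k)
    have "(\<integral>x. G x * ((x $ j) ^ Suc k * hermite m (x $ j)) \<partial>gauss) =
      (\<integral>x. G x * ((x $ j) ^ k * (x $ j * hermite m (x $ j))) \<partial>gauss)"
      by (simp add: mult_ac)
    also have "\<dots> = (\<integral>x. G x * ((x $ j) ^ k * hermite (Suc m) (x $ j)) +
        real m * (G x * ((x $ j) ^ k * hermite (m - 1) (x $ j))) \<partial>gauss)"
      by (simp only: hermite_times) (simp add: algebra_simps)
    also have "\<dots> = 0"
      by (subst Bochner_Integration.integral_add) (use int Suc.IH in auto)
    finally show ?case .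
  qed
  have mom0: "(\<integral>x. G x * (x $ j) ^ k \<partial>gauss) = 0" "integrable gauss (\<lambda>x. G x * (x $ j) ^ k)" for k
    using mom[of k 0] int[of k 0] by simp_all
  \<comment> \<open>The exponential series is integrated term by term against \<open>G\<close>. The
    majorant contains an exponential of \<open>abs_sum x\<close>, which is integrable against
    \<open>G\<close> because \<open>G\<close> is \<open>tame\<close>.\<close>
  have fourier: "(CLINT x|gauss. complex_of_real (G x) * iexp (t * x $ j)) = 0" for t
  proof -
    let ?s = "\<lambda>n x. \<Sum>k<n. complex_of_real (G x) * ((\<i> * of_real (t * x $ j)) ^ k /\<^sub>R fact k)"
    have "(\<lambda>n. CLINT x|gauss. ?s n x) \<longlonglongrightarrow> (CLINT x|gauss. complex_of_real (G x) * iexp (t * x $ j))"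
    proof (rule integral_dominated_convergence)
      show "integrable gauss (\<lambda>x. \<bar>G x * exp (\<bar>t\<bar> * abs_sum x)\<bar>)"
        using G by (intro integrable_abs) (simp add: tame_def)
      show "AE x in gauss. (\<lambda>n. ?s n x) \<longlonglongrightarrow> complex_of_real (G x) * iexp (t * x $ j)"
      proof (intro AE_I2)
        fix x
        have "(\<lambda>n. \<Sum>k<n. (\<i> * of_real (t * x $ j)) ^ k /\<^sub>R fact k) \<longlonglongrightarrow> iexp (t * x $ j)"
          using exp_converges[of "\<i> * of_real (t * x $ j) :: complex"] by (simp add: sums_def)
        from tendsto_mult[OF tendsto_const[of "complex_of_real (G x)"] this]
        show "(\<lambda>n. ?s n x) \<longlonglongrightarrow> complex_of_real (G x) * iexp (t * x $ j)"
          by (simp only: sum_distrib_left)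
      qed
      show "AE x in gauss. norm (?s n x) \<le> \<bar>G x * exp (\<bar>t\<bar> * abs_sum x)\<bar>" for n
      proof (intro AE_I2)
        fix x :: "real ^ 'n"
        have "norm (?s n x) \<le> (\<Sum>k<n. \<bar>G x\<bar> * (\<bar>t * x $ j\<bar> ^ k / fact k))"
          by (rule order_trans[OF norm_sum])
            (auto intro!: sum_mono simp: norm_mult norm_power divide_inverse mult_ac abs_mult)
        also have "\<dots> = \<bar>G x\<bar> * (\<Sum>k<n. \<bar>t * x $ j\<bar> ^ k / fact k)"
          by (simp only: sum_distrib_left)
        also have "(\<Sum>k<n. \<bar>t * x $ j\<bar> ^ k / fact k) \<le> (\<Sum>k. \<bar>t * x $ j\<bar> ^ k / fact k)"
          using summable_exp[of "\<bar>t * x $ j\<bar>"]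
          by (intro sum_le_suminf) (auto simp: divide_inverse mult.commute)
        also have "\<dots> = exp \<bar>t * x $ j\<bar>"
          by (simp add: exp_def divide_inverse scaleR_conv_of_real mult.commute)
        also have "\<dots> \<le> exp (\<bar>t\<bar> * abs_sum x)"
          by (auto simp: abs_mult intro!: mult_left_mono member_le_sum)
        finally show "norm (?s n x) \<le> \<bar>G x * exp (\<bar>t\<bar> * abs_sum x)\<bar>"
          by (simp add: abs_mult mult_left_mono)
      qed
    qed measurable
    moreover have "(CLINT x|gauss. ?s n x) = 0" for n
    proof -
      have eq: "complex_of_real (G x) * ((\<i> * of_real (t * x $ j)) ^ k /\<^sub>R fact k) =
         (\<i> * of_real t) ^ k / fact k * complex_of_real (G x * (x $ j) ^ k)" for k x
        by (simp add: power_mult_distrib scaleR_conv_of_real divide_inverse)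
      have i: "integrable gauss (\<lambda>x. (\<i> * of_real t) ^ k / fact k * complex_of_real (G x * (x $ j) ^ k))" for k
        by (intro integrable_mult_right integrable_of_real mom0)
      show ?thesis
        unfolding eq using i mom0(1)
        by (subst Bochner_Integration.integral_sum) (auto simp del: of_real_mult of_real_power)
    qed
    ultimately have "(\<lambda>n. 0) \<longlonglongrightarrow> (CLINT x|gauss. complex_of_real (G x) * iexp (t * x $ j))"
      by (simp only:)
    then show ?thesis
      by (rule LIMSEQ_unique[OF _ tendsto_const])
  qed
  have G0: "(\<integral>x. G x \<partial>gauss) = 0"
    using mom0(1)[of 0] by simp
  define p where "p = (\<lambda>x. max 0 (G x))"
  define q where "q = (\<lambda>x. max 0 (- G x))"
  have pq: "G x = p x - q x" "p x \<ge> 0" "q x \<ge> 0" for x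
    by (auto simp: p_def q_def max_def)
  have [measurable]: "p \<in> borel_measurable borel" "q \<in> borel_measurable borel"
    unfolding p_def q_def by measurable
  have int_pq: "integrable gauss p" "integrable gauss q"
    unfolding p_def q_def using intG by (auto intro!: integrable_max)
  \<comment> \<open>Both parts of \<open>G\<close> have the same mass \<open>m\<close>. Division by
    \<open>m\<close> turns them into probability laws, to which Levy's uniqueness theorem applies;
    mass 0 is a separate case.\<close>
  define m where "m = (\<integral>x. p x \<partial>gauss)"
  have mq: "m = (\<integral>x. q x \<partial>gauss)"
    using G0 int_pq unfolding m_def pq(1) by simp
  show ?thesis
  proof (cases "m = 0")
    case True
    then have "AE x in gauss. p x = 0" "AE x in gauss. q x = 0"
      using int_pq integral_nonneg_eq_0_iff_AE[of gauss p] integral_nonneg_eq_0_iff_AE[of gauss q] pq mq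
      by (auto simp: m_def)
    then have "AE x in gauss. G x * indicator B (x $ j) = 0"
      by eventually_elim (simp add: pq(1))
    then show ?thesis
      by (rule integral_eq_zero_AE)
  next
    case False
    moreover have "m \<ge> 0"
      unfolding m_def using pq(2) by (intro Bochner_Integration.integral_nonneg) auto
    ultimately have m: "m > 0"
      by simp
    define M where "M u = distr (density gauss (\<lambda>x. ennreal (u x / m))) borel (\<lambda>x. x $ j)"
      for u :: "real ^ 'n \<Rightarrow> real"
    have rd: "real_distribution (M u)"
      if [measurable]: "u \<in> borel_measurable borel" and u: "\<And>x. u x \<ge> 0" "integrable gauss u"
        "(\<integral>x. u x \<partial>gauss) = m" for u
    proof -
      have "prob_space (density gauss (\<lambda>x. ennreal (u x / m)))"
      proof
        have "(\<integral>\<^sup>+ x. ennreal (u x / m) \<partial>gauss) = ennreal (\<integral>x. u x / m \<partial>gauss)"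
          using u m by (intro nn_integral_eq_integral) auto
        also have "\<dots> = 1"
          using u m by simp
        finally show "emeasure (density gauss (\<lambda>x. ennreal (u x / m))) (space (density gauss (\<lambda>x. ennreal (u x / m)))) = 1"
          by (simp add: emeasure_density)
      qed
      then have "prob_space (M u)"
        unfolding M_def by (rule prob_space.prob_space_distr) measurable
      then show ?thesis
        by (auto simp: real_distribution_def real_distribution_axioms_def M_def)
    qed
    have ch: "char (M u) t = (CLINT x|gauss. complex_of_real (u x) * iexp (t * x $ j)) / of_real m"
      if [measurable]: "u \<in> borel_measurable borel" and u: "\<And>x. u x \<ge> 0" for u t
    proof -
      have "char (M u) t = (CLINT x|density gauss (\<lambda>x. ennreal (u x / m)). iexp (t * x $ j))"
        unfolding char_def M_def by (subst integral_distr) auto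
      also have "\<dots> = (CLINT x|gauss. (u x / m) *\<^sub>R iexp (t * x $ j))"
        using u m by (subst integral_density) auto
      also have "\<dots> = (CLINT x|gauss. (complex_of_real (u x) * iexp (t * x $ j)) / of_real m)"
        by (intro Bochner_Integration.integral_cong) (auto simp: scaleR_conv_of_real)
      finally show ?thesis
        by simp
    qed
    have i: "integrable gauss (\<lambda>x. complex_of_real (u x) * iexp (t * x $ j))"
      if "integrable gauss u" for u t
    proof -
      have [measurable]: "u \<in> borel_measurable gauss"
        using that by simp
      show ?thesis
        by (rule Bochner_Integration.integrable_bound[OF integrable_of_real[OF that, where ?'a = complex]])
          (auto simp: norm_mult)
    qed
    have "char (M p) = char (M q)"
    proof
      fix t
      have "(CLINT x|gauss. complex_of_real (p x) * iexp (t * x $ j)) -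
          (CLINT x|gauss. complex_of_real (q x) * iexp (t * x $ j)) =
          (CLINT x|gauss. complex_of_real (G x) * iexp (t * x $ j))"
        using i[OF int_pq(1)] i[OF int_pq(2)]
        by (subst Bochner_Integration.integral_diff[symmetric]) (auto simp: pq(1) algebra_simps)
      then show "char (M p) t = char (M q) t"
        using ch[of p t] ch[of q t] pq fourier[of t] by simp
    qed
    then have "M p = M q"
      using rd[of p] rd[of q] pq int_pq mq by (intro Levy_uniqueness) (auto simp: m_def)
    then have "emeasure (M p) B = emeasure (M q) B"
      by simp
    moreover have "emeasure (M u) B = ennreal ((\<integral>x. u x * indicator B (x $ j) \<partial>gauss) / m)"
      if [measurable]: "u \<in> borel_measurable borel" and u: "\<And>x. u x \<ge> 0" "integrable gauss u" for u
    proof -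
      have "emeasure (M u) B = (\<integral>\<^sup>+ x. ennreal (u x / m) * indicator ((\<lambda>x. x $ j) -` B) x \<partial>gauss)"
      proof -
        have [measurable]: "(\<lambda>x. x $ j) -` B \<in> sets (gauss :: (real ^ 'n) measure)"
          using measurable_sets[of "\<lambda>x. x $ j" "gauss :: (real ^ 'n) measure" borel B] by simp
        show ?thesis
          unfolding M_def
          by (subst emeasure_distr; (subst emeasure_density)?) (auto simp del: sets_gauss)
      qed
      also have "\<dots> = (\<integral>\<^sup>+ x. ennreal (u x * indicator B (x $ j) / m) \<partial>gauss)"
        by (intro nn_integral_cong) (auto simp: indicator_def)
      also have "\<dots> = ennreal (\<integral>x. u x * indicator B (x $ j) / m \<partial>gauss)"
      proof (rule nn_integral_eq_integral)
        show "integrable gauss (\<lambda>x. u x * indicator B (x $ j) / m)"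
          by (intro integrable_divide Bochner_Integration.integrable_bound[OF u(2)])
            (auto simp: indicator_def)
      qed (use u m in auto)
      finally show ?thesis
        by simp
    qed
    ultimately have "ennreal ((\<integral>x. p x * indicator B (x $ j) \<partial>gauss) / m) =
        ennreal ((\<integral>x. q x * indicator B (x $ j) \<partial>gauss) / m)"
      using pq int_pq by simp
    then have eq: "(\<integral>x. p x * indicator B (x $ j) \<partial>gauss) = (\<integral>x. q x * indicator B (x $ j) \<partial>gauss)"
      using m pq by (subst (asm) ennreal_inj) (auto intro!: divide_nonneg_pos Bochner_Integration.integral_nonneg)
    have "integrable gauss (\<lambda>x. u x * indicator B (x $ j))" if "integrable gauss u" for u :: "real ^ 'n \<Rightarrow> real"
    proof -
      have [measurable]: "u \<in> borel_measurable gauss"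
        using that by simp
      show ?thesis
        by (rule Bochner_Integration.integrable_bound[OF that]) (auto simp: indicator_def)
    qed
    then show ?thesis
      using int_pq eq by (simp add: pq(1) left_diff_distrib)
  qed
qed

text \<open>Coordinates are treated one at a time: in those of \<open>S\<close> the Hermite factors
  have already been traded for indicators, and all factors in the other directions join
  \<open>f\<close> as a weight in the one-dimensional uniqueness result. Once every coordinate is
  traded, \<open>f\<close> integrates to 0 over every box.\<close>

lemma tame_AE_eq_0:
  fixes f :: "real ^ 'n::finite \<Rightarrow> real"
  assumes f[measurable]: "tame f" and zero: "\<And>\<alpha>. (\<integral>x. f x * hermite_multi \<alpha> x \<partial>gauss) = 0"
  shows "AE x in gauss. f x = 0"
proof -
  have *: "\<And>\<alpha>. (\<integral>x. f x * ((\<Prod>i\<in>S. indicator (B i) (x $ i)) * (\<Prod>i\<in>UNIV - S. hermite (\<alpha> i) (x $ i))) \<partial>gauss) = 0"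
    if "finite S" and B[measurable]: "\<And>i. B i \<in> sets borel" for S and B :: "'n \<Rightarrow> real set"
    using \<open>finite S\<close>
  proof (induction S rule: finite_induct)
    case empty
    then show ?case
      using zero by (simp add: hermite_multi_def)
  next
    case (insert j S)
    let ?G = "\<lambda>x. (f x * (\<Prod>i\<in>S. indicator (B i) (x $ i))) * (\<Prod>i\<in>UNIV - insert j S. hermite (\<alpha> i) (x $ i))"
    have "tame ?G"
    proof (rule tame_mult_exp_growth[OF tame_mult_bounded[OF f]])
      show "\<bar>\<Prod>i\<in>S. indicator (B i) (x $ i) :: real\<bar> \<le> 1" for x :: "real ^ 'n"
        by (simp add: abs_prod) (intro prod_le_1, auto simp: indicator_def)
      show "exp_growth (\<lambda>x :: real ^ 'n. \<Prod>i\<in>UNIV - insert j S. hermite (\<alpha> i) (x $ i))"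
        by (intro exp_growth_prod exp_growth_hermite)
    qed measurable
    \<comment> \<open>The induction hypothesis holds for every multi-index, and updating \<alpha> at
      \<open>j\<close> supplies all Hermite moments in the next direction.\<close>
    moreover have "(\<integral>x. ?G x * hermite k (x $ j) \<partial>gauss) = 0" for k
    proof -
      have "(\<Prod>i\<in>UNIV - S. hermite ((\<alpha>(j := k)) i) (x $ i)) =
          hermite k (x $ j) * (\<Prod>i\<in>UNIV - insert j S. hermite (\<alpha> i) (x $ i))" for x
        using insert.hyps
        by (subst prod.remove[of "UNIV - S" j]) (auto intro!: prod.cong simp: Diff_insert2[symmetric])
      then show ?thesis
        using insert.IH[of "\<alpha>(j := k)"] by (simp add: mult_ac)
    qed
    ultimately have "(\<integral>x. ?G x * indicator (B j) (x $ j) \<partial>gauss) = 0"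
      by (rule integral_indicator_component_eq_0) auto
    then show ?case
      using insert.hyps by (simp add: mult_ac)
  qed
  have box: "indicator (box a b) x = (\<Prod>i\<in>UNIV. indicator {a $ i <..< b $ i} (x $ i) :: real)" for a b x :: "real ^ 'n"
  proof (cases "x \<in> box a b")
    case True
    then show ?thesis
      by (auto simp: mem_box_cart)
  next
    case False
    then obtain i where "x $ i \<notin> {a $ i <..< b $ i}"
      by (auto simp: mem_box_cart)
    then have "indicator {a $ i <..< b $ i} (x $ i) = (0 :: real)"
      by simp
    then show ?thesis
      using False by (auto intro!: prod_zero[symmetric])
  qed
  have "AE x in lborel. gdens x * f x = 0"
  proof (rule AE_eq_0_if_integral_box_eq_0)
    fix a b :: "real ^ 'n"
    let ?h = "\<lambda>x. f x * indicator (box a b) x"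
    have "tame ?h"
      by (intro tame_mult_bounded f) auto
    then have "integrable lborel (\<lambda>x. gdens x * ?h x)"
      using integrable_gauss_iff[of ?h] tame_integrable[of ?h] by simp
    then show "integrable lborel (\<lambda>x. indicator (box a b) x * (gdens x * f x))"
      by (simp add: mult_ac)
    have "(\<integral>x. ?h x \<partial>gauss) = 0"
      unfolding box using *[of UNIV "\<lambda>i. {a $ i <..< b $ i}"] by simp
    then show "(\<integral>x. indicator (box a b) x * (gdens x * f x) \<partial>lborel) = 0"
      by (subst (asm) integral_gauss_eq) (auto simp: mult_ac)
  qed measurable
  then have "AE x in lborel. f x = 0"
    by eventually_elim (use gdens_pos in \<open>auto simp: less_le\<close>)
  then show ?thesis
    by (simp add: AE_gauss_iff)
qed

section \<open>Hermite expansions\<close>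

text \<open>Coefficients are left unnormalised: expansions then carry
  \<open>1 / mfact \<alpha>\<close>, but a derivative shifts the index without any factor.\<close>

definition hcoef :: "(real ^ 'n::finite \<Rightarrow> real) \<Rightarrow> ('n \<Rightarrow> nat) \<Rightarrow> real" where
  "hcoef f \<alpha> = (\<integral>x. f x * hermite_multi \<alpha> x \<partial>gauss)"

definition degs :: "nat \<Rightarrow> ('n::finite \<Rightarrow> nat) set" where
  "degs N = {\<alpha>. deg \<alpha> < N}"

text \<open>The polynomial of degree below \<open>N\<close> with coefficients \<open>hcoef\<close> given by \<open>a\<close>.\<close>
definition hpoly :: "nat \<Rightarrow> (('n::finite \<Rightarrow> nat) \<Rightarrow> real) \<Rightarrow> real ^ 'n \<Rightarrow> real" where
  "hpoly N a x = (\<Sum>\<alpha>\<in>degs N. a \<alpha> / mfact \<alpha> * hermite_multi \<alpha> x)"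

lemma finite_degs [simp]: "finite (degs N :: ('n::finite \<Rightarrow> nat) set)"
proof (rule finite_subset)
  have "\<alpha> i \<le> deg \<alpha>" for \<alpha> :: "'n \<Rightarrow> nat" and i
    unfolding deg_def by (intro member_le_sum) auto
  then show "degs N \<subseteq> PiE (UNIV :: 'n set) (\<lambda>_. {..N})"
    unfolding degs_def by (auto simp: PiE_def) (meson le_trans less_imp_le)
  show "finite (PiE (UNIV :: 'n set) (\<lambda>_. {..N}))"
    by (intro finite_PiE) auto
qed

lemma degs_mono: "N \<le> M \<Longrightarrow> degs N \<subseteq> degs M"
  by (auto simp: degs_def)

lemma exp_growth_hpoly [intro, simp]: "exp_growth (hpoly N a)"
  unfolding hpoly_def[abs_def] by (intro exp_growth_sum exp_growth_cmult exp_growth_hermite_multi)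

lemma hpoly_L2 [simp]: "hpoly N a \<in> L2"
  by (intro exp_growth_L2 exp_growth_hpoly)

lemma hermite_multi_L2 [simp]: "hermite_multi \<alpha> \<in> L2"
  by (intro exp_growth_L2 exp_growth_hermite_multi)

lemma hcoef_add: "f \<in> L2 \<Longrightarrow> g \<in> L2 \<Longrightarrow> hcoef (\<lambda>x. f x + g x) \<alpha> = hcoef f \<alpha> + hcoef g \<alpha>"
  by (simp add: hcoef_def distrib_right L2_integrable_mult)

lemma hcoef_diff: "f \<in> L2 \<Longrightarrow> g \<in> L2 \<Longrightarrow> hcoef (\<lambda>x. f x - g x) \<alpha> = hcoef f \<alpha> - hcoef g \<alpha>"
  by (simp add: hcoef_def left_diff_distrib L2_integrable_mult)

lemma hcoef_cmult: "hcoef (\<lambda>x. c * f x) \<alpha> = c * hcoef f \<alpha>"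
  by (simp add: hcoef_def mult.assoc)

lemma hcoef_const: "hcoef (\<lambda>x. c) \<alpha> = (if \<alpha> = (\<lambda>_. 0) then c else 0)"
proof -
  have "hcoef (\<lambda>x. c) \<alpha> = c * (\<integral>x. hermite_multi (\<lambda>_. 0) x * hermite_multi \<alpha> x \<partial>gauss)"
    by (simp add: hcoef_def)
  then show ?thesis
    unfolding hermite_orthogonal by (auto simp: mfact_def)
qed

lemma inner_hpoly:
  assumes "f \<in> L2"
  shows "(\<integral>x. f x * hpoly N a x \<partial>gauss) = (\<Sum>\<alpha>\<in>degs N. hcoef f \<alpha> * a \<alpha> / mfact \<alpha>)"
proof -
  have "(\<integral>x. f x * hpoly N a x \<partial>gauss) = (\<integral>x. (\<Sum>\<alpha>\<in>degs N. a \<alpha> / mfact \<alpha> * (f x * hermite_multi \<alpha> x)) \<partial>gauss)"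
    by (simp add: hpoly_def sum_distrib_left mult_ac)
  also have "\<dots> = (\<Sum>\<alpha>\<in>degs N. a \<alpha> / mfact \<alpha> * hcoef f \<alpha>)"
    using assms by (subst Bochner_Integration.integral_sum) (auto simp: hcoef_def L2_integrable_mult)
  finally show ?thesis
    by (simp add: mult_ac)
qed

lemma nrm_square': "(nrm f)\<^sup>2 = (\<integral>x. f x * f x \<partial>gauss)"
  unfolding nrm_square by (simp add: power2_eq_square)

lemma hcoef_hpoly: "hcoef (hpoly N a) \<alpha> = (if deg \<alpha> < N then a \<alpha> else 0)"
proof -
  have "hcoef (hpoly N a) \<alpha> = (\<integral>x. hermite_multi \<alpha> x * hpoly N a x \<partial>gauss)"
    by (simp add: hcoef_def mult.commute)
  also have "\<dots> = (\<Sum>\<beta>\<in>degs N. hcoef (hermite_multi \<alpha>) \<beta> * a \<beta> / mfact \<beta>)"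
    by (rule inner_hpoly) simp
  also have "\<dots> = (\<Sum>\<beta>\<in>degs N. if \<beta> = \<alpha> then a \<beta> else 0)"
    by (intro sum.cong) (auto simp: hcoef_def hermite_orthogonal)
  also have "\<dots> = (if deg \<alpha> < N then a \<alpha> else 0)"
    by (subst sum.delta[OF finite_degs]) (simp add: degs_def)
  finally show ?thesis .
qed

lemma nrm_hpoly: "(nrm (hpoly N a))\<^sup>2 = (\<Sum>\<alpha>\<in>degs N. (a \<alpha>)\<^sup>2 / mfact \<alpha>)"
proof -
  have "(nrm (hpoly N a))\<^sup>2 = (\<integral>x. hpoly N a x * hpoly N a x \<partial>gauss)"
    by (rule nrm_square')
  also have "\<dots> = (\<Sum>\<alpha>\<in>degs N. (a \<alpha>)\<^sup>2 / mfact \<alpha>)"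
    by (subst inner_hpoly) (auto simp: hcoef_hpoly degs_def power2_eq_square)
  finally show ?thesis .
qed

lemma nrm_diff_hpoly:
  assumes "f \<in> L2"
  shows "(nrm (\<lambda>x. f x - hpoly N (hcoef f) x))\<^sup>2 = (nrm f)\<^sup>2 - (\<Sum>\<alpha>\<in>degs N. (hcoef f \<alpha>)\<^sup>2 / mfact \<alpha>)"
proof -
  let ?p = "hpoly N (hcoef f)"
  have "(nrm (\<lambda>x. f x - ?p x))\<^sup>2 = (\<integral>x. (f x)\<^sup>2 + (?p x)\<^sup>2 - 2 * (f x * ?p x) \<partial>gauss)"
    by (simp add: nrm_square power2_diff mult.assoc)
  also have "\<dots> = (nrm f)\<^sup>2 + (nrm ?p)\<^sup>2 - 2 * (\<integral>x. f x * ?p x \<partial>gauss)"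
    using assms by (simp add: nrm_square L2_integrable_square L2_integrable_mult)
  also have "\<dots> = (nrm f)\<^sup>2 - (\<Sum>\<alpha>\<in>degs N. (hcoef f \<alpha>)\<^sup>2 / mfact \<alpha>)"
    unfolding nrm_hpoly inner_hpoly[OF assms] by (simp add: power2_eq_square)
  finally show ?thesis .
qed

lemma Bessel:
  assumes "f \<in> L2"
  shows "(\<Sum>\<alpha>\<in>degs N. (hcoef f \<alpha>)\<^sup>2 / mfact \<alpha>) \<le> (nrm f)\<^sup>2"
  using nrm_diff_hpoly[OF assms, of N] zero_le_power2[of "nrm (\<lambda>x. f x - hpoly N (hcoef f) x)"]
  by linarith

lemma hcoef_tendsto:
  assumes "L2_tendsto F f"
  shows "(\<lambda>n. hcoef (F n) \<alpha>) \<longlonglongrightarrow> hcoef f \<alpha>"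
  unfolding hcoef_def by (intro L2_tendsto_inner_const assms) simp

lemma nrm_diff_hpoly_hpoly:
  assumes "N \<le> M"
  shows "(nrm (\<lambda>x. hpoly M a x - hpoly N a x))\<^sup>2 =
    (\<Sum>\<alpha>\<in>degs M. (a \<alpha>)\<^sup>2 / mfact \<alpha>) - (\<Sum>\<alpha>\<in>degs N. (a \<alpha>)\<^sup>2 / mfact \<alpha>)"
proof -
  have "hpoly N (hcoef (hpoly M a)) = hpoly N a"
    using assms by (auto simp: hpoly_def hcoef_hpoly degs_def intro!: sum.cong)
  moreover have "(\<Sum>\<alpha>\<in>degs N. (hcoef (hpoly M a) \<alpha>)\<^sup>2 / mfact \<alpha>) = (\<Sum>\<alpha>\<in>degs N. (a \<alpha>)\<^sup>2 / mfact \<alpha>)"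
    using assms by (auto simp: hcoef_hpoly degs_def intro!: sum.cong)
  ultimately show ?thesis
    using nrm_diff_hpoly[of "hpoly M a" N] by (simp add: nrm_hpoly)
qed

text \<open>Squared distances of partial sums are increments of a bounded monotone sequence.
  Derivatives, Hessians, the inverse operator and the multiplier of the obstacle problem are all
  produced this way from coefficient bounds.\<close>

lemma Riesz_Fischer:
  fixes a :: "('n::finite \<Rightarrow> nat) \<Rightarrow> real"
  assumes "\<And>N. (\<Sum>\<alpha>\<in>degs N. (a \<alpha>)\<^sup>2 / mfact \<alpha>) \<le> C"
  obtains f where "f \<in> L2" "hcoef f = a" "L2_tendsto (\<lambda>N. hpoly N a) f"
proof -
  let ?S = "\<lambda>N. \<Sum>\<alpha>\<in>degs N. (a \<alpha>)\<^sup>2 / mfact \<alpha>"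
  have mono: "mono ?S"
    by (intro monoI sum_mono2 degs_mono) auto
  have "convergent ?S"
    by (rule Bseq_mono_convergent)
      (use mono assms in \<open>auto intro!: BseqI'[where K = C] simp: mono_def sum_nonneg\<close>)
  then have C: "Cauchy ?S"
    by (rule convergent_Cauchy)
  obtain f where f: "L2_tendsto (\<lambda>N. hpoly N a) f"
  proof (rule L2_complete[of "\<lambda>N. hpoly N a"])
    fix e :: real
    assume "e > 0"
    then obtain N0 where N0: "\<And>m n. m \<ge> N0 \<Longrightarrow> n \<ge> N0 \<Longrightarrow> norm (?S m - ?S n) < e\<^sup>2"
      using C unfolding Cauchy_iff by (meson zero_less_power)
    have *: "nrm (\<lambda>x. hpoly m a x - hpoly n a x) < e" if "n \<ge> N0" "n \<le> m" for m n
    proof (rule power2_less_imp_less)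
      show "(nrm (\<lambda>x. hpoly m a x - hpoly n a x))\<^sup>2 < e\<^sup>2"
        using N0[of m n] that by (simp add: nrm_diff_hpoly_hpoly)
    qed (use \<open>e > 0\<close> in simp)
    have "nrm (\<lambda>x. hpoly m a x - hpoly n a x) < e" if "n \<ge> N0" "m \<ge> N0" for m n
      using *[of n m] *[of m n] that nrm_minus_commute[of "hpoly m a" "hpoly n a"] by (cases "n \<le> m") auto
    then show "\<exists>N. \<forall>m\<ge>N. \<forall>n\<ge>N. nrm (\<lambda>x. hpoly m a x - hpoly n a x) < e"
      by blast
  qed auto
  have "hcoef f \<alpha> = a \<alpha>" for \<alpha>
  proof (rule LIMSEQ_unique[OF hcoef_tendsto[OF f]])
    have "\<forall>\<^sub>F N in sequentially. hcoef (hpoly N a) \<alpha> = a \<alpha>"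
      using eventually_gt_at_top[of "deg \<alpha>"] by eventually_elim (simp add: hcoef_hpoly)
    then show "(\<lambda>N. hcoef (hpoly N a) \<alpha>) \<longlonglongrightarrow> a \<alpha>"
      by (rule tendsto_eventually)
  qed
  then show ?thesis
    using that f by (auto simp: L2_tendsto_def)
qed

lemma tame_diff: "tame f \<Longrightarrow> tame g \<Longrightarrow> tame (\<lambda>x. f x - g x)"
  unfolding tame_def by (auto simp: left_diff_distrib)

text \<open>Stated beyond \<open>L2\<close> for the sake of \<open>OU_eq_derivatives\<close>, where
  one side contains \<open>x $ i * D i x\<close>.\<close>

lemma tame_eq_AE:
  assumes "tame f" "tame g" and eq: "\<And>\<alpha>. hcoef f \<alpha> = hcoef g \<alpha>"
  shows "AE x in gauss. f x = g x"
proof -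
  have "(\<integral>x. (f x - g x) * hermite_multi \<alpha> x \<partial>gauss) = hcoef f \<alpha> - hcoef g \<alpha>" for \<alpha>
    using tame_integrable[OF tame_mult_exp_growth[OF assms(1) exp_growth_hermite_multi]]
      tame_integrable[OF tame_mult_exp_growth[OF assms(2) exp_growth_hermite_multi]]
    by (simp add: hcoef_def left_diff_distrib)
  then have "AE x in gauss. f x - g x = 0"
    using eq by (intro tame_AE_eq_0 tame_diff assms) auto
  then show ?thesis
    by eventually_elim simp
qed

lemma L2_eq_AE: "f \<in> L2 \<Longrightarrow> g \<in> L2 \<Longrightarrow> (\<And>\<alpha>. hcoef f \<alpha> = hcoef g \<alpha>) \<Longrightarrow> AE x in gauss. f x = g x"
  by (intro tame_eq_AE L2_tame)

text \<open>\<open>Riesz_Fischer\<close> supplies some limit with the coefficients of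
  \<open>f\<close>; completeness of the Hermite polynomials identifies it with
  \<open>f\<close>.\<close>

lemma L2_tendsto_hpoly:
  assumes f[measurable]: "f \<in> L2"
  shows "L2_tendsto (\<lambda>N. hpoly N (hcoef f)) f"
proof -
  obtain g where g[measurable]: "g \<in> L2" and coef: "hcoef g = hcoef f" and lim: "L2_tendsto (\<lambda>N. hpoly N (hcoef f)) g"
    using Riesz_Fischer[OF Bessel[OF f]] by blast
  have "AE x in gauss. f x = g x"
    using f g coef by (intro L2_eq_AE) auto
  then have "nrm (\<lambda>x. hpoly N (hcoef f) x - f x) = nrm (\<lambda>x. hpoly N (hcoef f) x - g x)" for N
    unfolding nrm_def by (intro arg_cong[where f = sqrt] integral_cong_AE)
      (use exp_growth_borel[OF exp_growth_hpoly[of N "hcoef f"]] in \<open>auto elim: eventually_mono\<close>)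
  then show ?thesis
    using lim f by (simp add: L2_tendsto_def)
qed

lemma Parseval:
  assumes "f \<in> L2"
  shows "(\<lambda>N. \<Sum>\<alpha>\<in>degs N. (hcoef f \<alpha>)\<^sup>2 / mfact \<alpha>) \<longlonglongrightarrow> (nrm f)\<^sup>2"
proof -
  have "(\<lambda>N. \<integral>x. hpoly N (hcoef f) x * hpoly N (hcoef f) x \<partial>gauss) \<longlonglongrightarrow> (\<integral>x. f x * f x \<partial>gauss)"
    by (intro L2_tendsto_inner L2_tendsto_hpoly assms)
  then show ?thesis
    unfolding nrm_hpoly[symmetric] nrm_square' .
qed

section \<open>Chaos components and the inverse Ornstein--Uhlenbeck operator\<close>

definition hpart :: "nat \<Rightarrow> (('n::finite \<Rightarrow> nat) \<Rightarrow> real) \<Rightarrow> real ^ 'n \<Rightarrow> real" where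
  "hpart n a x = (\<Sum>\<alpha> | deg \<alpha> = n. a \<alpha> / mfact \<alpha> * hermite_multi \<alpha> x)"

lemma finite_deg_eq [simp]: "finite {\<alpha> :: 'n::finite \<Rightarrow> nat. deg \<alpha> = n}"
  by (rule finite_subset[OF _ finite_degs[of "Suc n"]]) (auto simp: degs_def)

lemma hpoly_eq_sum_hpart: "hpoly N a x = (\<Sum>n<N. hpart n a x)"
proof -
  have "(\<Sum>n<N. hpart n a x) = (\<Sum>n<N. \<Sum>\<alpha> | \<alpha> \<in> degs N \<and> deg \<alpha> = n. a \<alpha> / mfact \<alpha> * hermite_multi \<alpha> x)"
    unfolding hpart_def by (intro sum.cong) (auto simp: degs_def)
  also have "\<dots> = hpoly N a x"
    unfolding hpoly_def by (rule sum.group[OF finite_degs]) (auto simp: degs_def)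
  finally show ?thesis ..
qed

lemma hpart_chaos: "hpart n a \<in> chaos n"
  unfolding chaos_def hpart_def[abs_def] deg_def
  by (auto intro!: exI[of _ "\<lambda>\<alpha>. a \<alpha> / mfact \<alpha>"])

lemma hpart_L2 [simp]: "hpart n a \<in> L2"
  unfolding hpart_def[abs_def] by (intro L2_sum L2_cmult) auto

lemma chaosE:
  assumes "u \<in> chaos n"
  obtains a where "u = hpart n a"
proof -
  obtain c where "u = (\<lambda>x. \<Sum>\<alpha> | deg \<alpha> = n. c \<alpha> * hermite_multi \<alpha> x)"
    using assms unfolding chaos_def deg_def by auto
  then show ?thesis
    using that[of "\<lambda>\<alpha>. c \<alpha> * mfact \<alpha>"] by (simp add: hpart_def[abs_def])
qed

lemma L2_sums_iff:
  "L2_sums U u \<longleftrightarrow> (\<forall>n. U n \<in> L2) \<and> L2_tendsto (\<lambda>N x. \<Sum>n<N. U n x) u"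
proof -
  have "(\<lambda>N. \<integral>x. (u x - (\<Sum>n<N. U n x))\<^sup>2 \<partial>gauss) \<longlonglongrightarrow> 0 \<longleftrightarrow>
     (\<lambda>N. nrm (\<lambda>x. (\<Sum>n<N. U n x) - u x)) \<longlonglongrightarrow> 0"
  proof -
    have "(\<lambda>N. \<integral>x. (u x - (\<Sum>n<N. U n x))\<^sup>2 \<partial>gauss) = (\<lambda>N. (nrm (\<lambda>x. (\<Sum>n<N. U n x) - u x))\<^sup>2)"
      by (simp add: nrm_square power2_commute)
    moreover have "X \<longlonglongrightarrow> 0 \<longleftrightarrow> (\<lambda>N. (X N)\<^sup>2) \<longlonglongrightarrow> 0" for X :: "nat \<Rightarrow> real"
      using tendsto_power[of X 0 sequentially 2] tendsto_real_sqrt[of "\<lambda>N. (X N)\<^sup>2" 0 sequentially]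
      by (auto simp: tendsto_rabs_zero_iff)
    ultimately show ?thesis
      by simp
  qed
  then show ?thesis
    unfolding L2_sums_def L2_tendsto_def by (auto intro: L2_sum)
qed

lemma hcoef_sum:
  "(\<And>n. n \<in> S \<Longrightarrow> U n \<in> L2) \<Longrightarrow> hcoef (\<lambda>x. \<Sum>n\<in>S. U n x) \<alpha> = (\<Sum>n\<in>S. hcoef (U n) \<alpha>)"
  by (induction S rule: infinite_finite_induct) (auto simp: hcoef_add L2_sum hcoef_const)

lemma hcoef_hpart: "hcoef (hpart n a) \<alpha> = (if deg \<alpha> = n then a \<alpha> else 0)"
proof -
  have "hpart n a = (\<lambda>x. hpoly (Suc n) a x - hpoly n a x)"
    by (simp add: hpoly_eq_sum_hpart)
  then show ?thesis
    by (simp add: hcoef_diff hcoef_hpoly)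
qed

text \<open>Shows that the definite description is proper. The components of any competitor are
  Hermite sums, and continuity of each \<open>hcoef\<close> under norm convergence forces their
  coefficients to be those of \<open>u\<close>, so they agree as functions.\<close>

lemma chaos_part_eq:
  assumes u: "u \<in> L2"
  shows "chaos_part u = (\<lambda>n. hpart n (hcoef u))"
  unfolding chaos_part_def
proof (rule the_equality)
  show "(\<forall>n. hpart n (hcoef u) \<in> chaos n) \<and> L2_sums (\<lambda>n. hpart n (hcoef u)) u"
    using L2_tendsto_hpoly[OF u] by (auto simp: L2_sums_iff hpart_chaos hpoly_eq_sum_hpart[abs_def])
next
  fix U :: "nat \<Rightarrow> real ^ 'a \<Rightarrow> real"
  assume U: "(\<forall>n. U n \<in> chaos n) \<and> L2_sums U u"
  then have "\<exists>a. U n = hpart n a" for n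
    using chaosE by metis
  then obtain a where a: "\<And>n. U n = hpart n (a n)"
    by metis
  have coef: "hcoef u \<alpha> = a (deg \<alpha>) \<alpha>" for \<alpha>
  proof (rule LIMSEQ_unique)
    show "(\<lambda>N. hcoef (\<lambda>x. \<Sum>n<N. U n x) \<alpha>) \<longlonglongrightarrow> hcoef u \<alpha>"
      using U by (intro hcoef_tendsto) (auto simp: L2_sums_iff)
    have "\<forall>\<^sub>F N in sequentially. hcoef (\<lambda>x. \<Sum>n<N. U n x) \<alpha> = a (deg \<alpha>) \<alpha>"
      using eventually_gt_at_top[of "deg \<alpha>"]
      by eventually_elim (simp add: hcoef_sum a hcoef_hpart)
    then show "(\<lambda>N. hcoef (\<lambda>x. \<Sum>n<N. U n x) \<alpha>) \<longlonglongrightarrow> a (deg \<alpha>) \<alpha>"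
      by (rule tendsto_eventually)
  qed
  show "U = (\<lambda>n. hpart n (hcoef u))"
    by (auto simp: a hpart_def fun_eq_iff coef intro!: sum.cong)
qed

lemma L2_tendsto_subseq: "L2_tendsto F f \<Longrightarrow> strict_mono r \<Longrightarrow> L2_tendsto (\<lambda>n. F (r n)) f"
  unfolding L2_tendsto_def using LIMSEQ_subseq_LIMSEQ by (force simp: comp_def)

text \<open>The series starts at degree 1 and leaves coefficient 0 at degree 0, which is also the
  value of a division by zero, so one formula covers all degrees. \<open>Riesz_Fischer\<close> shows
  that the chosen representative exists.\<close>

lemma OU_inv:
  assumes u: "u \<in> L2"
  shows "OU_inv u \<in> L2" "hcoef (OU_inv u) \<alpha> = hcoef u \<alpha> / real (deg \<alpha>)"
proof -
  define a where "a \<alpha> = hcoef u \<alpha> / real (deg \<alpha>)" for \<alpha>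
  let ?U = "\<lambda>n x. chaos_part u (Suc n) x / real (Suc n)"
  have part: "chaos_part u (Suc n) x / real (Suc n) = hpart (Suc n) a x" for n x
    unfolding chaos_part_eq[OF u] hpart_def sum_divide_distrib
    by (intro sum.cong) (auto simp: a_def)
  \<comment> \<open>The shift by one comes from the part of degree 0, which is included in
    \<open>hpoly\<close> but has coefficient 0 in \<open>a\<close>.\<close>
  have sum: "(\<Sum>n<N. ?U n x) = hpoly (Suc N) a x" for N x
  proof -
    have "hpart 0 a x = 0"
      by (simp add: hpart_def a_def)
    then show ?thesis
      unfolding part hpoly_eq_sum_hpart by (subst sum.lessThan_Suc_shift) simp
  qed
  have "(a \<alpha>)\<^sup>2 \<le> (hcoef u \<alpha>)\<^sup>2" for \<alpha>
  proof (cases "deg \<alpha> = 0")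
    case False
    then have "1 \<le> (real (deg \<alpha>))\<^sup>2"
      by (simp add: one_le_power)
    then show ?thesis
      by (simp add: a_def power_divide divide_le_eq mult_le_cancel_left1 not_less mult_right_mono[of 1])
  qed (simp add: a_def)
  then have "(\<Sum>\<alpha>\<in>degs N. (a \<alpha>)\<^sup>2 / mfact \<alpha>) \<le> (\<Sum>\<alpha>\<in>degs N. (hcoef u \<alpha>)\<^sup>2 / mfact \<alpha>)" for N
    by (intro sum_mono divide_right_mono) auto
  then obtain v where v: "L2_tendsto (\<lambda>N. hpoly N a) v"
    using Riesz_Fischer[of a "(nrm u)\<^sup>2"] order_trans[OF _ Bessel[OF u]] by metis
  have "L2_tendsto (\<lambda>N x. \<Sum>n<N. ?U n x) v"
    using L2_tendsto_subseq[OF v, of Suc] unfolding sum by (simp add: strict_mono_def)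
  then have "L2_sums ?U v"
    by (simp add: L2_sums_iff part del: of_nat_Suc)
  then have *: "L2_sums ?U (OU_inv u)"
    unfolding OU_inv_def by (rule someI[of "L2_sums ?U"])
  then show "OU_inv u \<in> L2"
    by (simp add: L2_sums_iff L2_tendsto_def)
  show "hcoef (OU_inv u) \<alpha> = hcoef u \<alpha> / real (deg \<alpha>)"
  proof (rule LIMSEQ_unique)
    show "(\<lambda>N. hcoef (\<lambda>x. \<Sum>n<N. ?U n x) \<alpha>) \<longlonglongrightarrow> hcoef (OU_inv u) \<alpha>"
      using * by (intro hcoef_tendsto) (auto simp: L2_sums_iff)
    have "\<forall>\<^sub>F N in sequentially. hcoef (\<lambda>x. \<Sum>n<N. ?U n x) \<alpha> = a \<alpha>"
      using eventually_gt_at_top[of "deg \<alpha>"]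
      by eventually_elim (simp only: sum hcoef_hpoly, simp)
    then show "(\<lambda>N. hcoef (\<lambda>x. \<Sum>n<N. ?U n x) \<alpha>) \<longlonglongrightarrow> hcoef u \<alpha> / real (deg \<alpha>)"
      unfolding a_def by (rule tendsto_eventually)
  qed
qed

section \<open>Gaussian Sobolev derivatives\<close>

lemma borel_hpoly [measurable]: "hpoly N a \<in> borel_measurable borel"
  by (rule exp_growth_borel) simp

lemma borel_hermite_multi [measurable]: "hermite_multi \<alpha> \<in> borel_measurable borel"
  by (rule exp_growth_borel) simp

text \<open>By Gaussian integration by parts, \<open>k\<close> is the weak partial derivative of \<open>h\<close>.\<close>
definition gderiv :: "'n::finite \<Rightarrow> (real ^ 'n \<Rightarrow> real) \<Rightarrow> (real ^ 'n \<Rightarrow> real) \<Rightarrow> bool" where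
  "gderiv i h k \<longleftrightarrow> h \<in> L2 \<and> k \<in> L2 \<and> (\<forall>\<beta>. hcoef k \<beta> = hcoef h (up i \<beta>))"

text \<open>\<open>up i\<close> is injective and maps \<open>degs N\<close> onto the indices of
  \<open>degs (Suc N)\<close> with positive \<open>i\<close>-th entry, the only ones that
  contribute.\<close>

lemma sum_degs_Suc:
  fixes g :: "('n::finite \<Rightarrow> nat) \<Rightarrow> real"
  assumes "\<And>\<alpha>. \<alpha> i = 0 \<Longrightarrow> g \<alpha> = 0"
  shows "(\<Sum>\<alpha>\<in>degs (Suc N). g \<alpha>) = (\<Sum>\<beta>\<in>degs N. g (up i \<beta>))"
proof -
  have inj: "inj_on (up i) (degs N)"
  proof (rule inj_onI)
    fix \<alpha> \<beta> :: "'n \<Rightarrow> nat"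
    assume eq: "up i \<alpha> = up i \<beta>"
    have "\<alpha> j = \<beta> j" for j
      using fun_cong[OF eq, of j] by (cases "j = i") auto
    then show "\<alpha> = \<beta>" ..
  qed
  have sub: "up i ` degs N \<subseteq> degs (Suc N)"
    by (auto simp: degs_def)
  have "g \<alpha> = 0" if "\<alpha> \<in> degs (Suc N) - up i ` degs N" for \<alpha>
  proof (rule ccontr)
    assume "g \<alpha> \<noteq> 0"
    then have "\<alpha> i \<noteq> 0"
      using assms by blast
    then have \<alpha>: "\<alpha> = up i (down i \<alpha>)"
      by auto
    have "Suc (deg (down i \<alpha>)) = deg \<alpha>"
      by (subst (2) \<alpha>) (rule deg_up[symmetric])
    then have "down i \<alpha> \<in> degs N"
      using that by (auto simp: degs_def)
    then show False
      using that \<alpha> by blast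
  qed
  then have "(\<Sum>\<alpha>\<in>degs (Suc N). g \<alpha>) = (\<Sum>\<alpha>\<in>up i ` degs N. g \<alpha>)"
    by (intro sum.mono_neutral_right sub) auto
  also have "\<dots> = (\<Sum>\<beta>\<in>degs N. g (up i \<beta>))"
    by (simp add: sum.reindex[OF inj])
  finally show ?thesis .
qed

text \<open>Raising an index multiplies \<open>mfact\<close> by the new entry, so reindexing yields
  the weight \<open>real (\<alpha> i)\<close>, and these add up to \<open>deg \<alpha>\<close>. This
  is the energy identity between gradient and Ornstein-Uhlenbeck operator; an arbitrary
  \<open>X\<close> admits products of two coefficient families and a second application for
  Hessians.\<close>

lemma sum_up_mfact:
  fixes X :: "('n::finite \<Rightarrow> nat) \<Rightarrow> real"
  shows "(\<Sum>i\<in>UNIV. \<Sum>\<beta>\<in>degs N. X (up i \<beta>) / mfact \<beta>) = (\<Sum>\<alpha>\<in>degs (Suc N). real (deg \<alpha>) * X \<alpha> / mfact \<alpha>)"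
proof -
  have "(\<Sum>\<beta>\<in>degs N. X (up i \<beta>) / mfact \<beta>) = (\<Sum>\<alpha>\<in>degs (Suc N). real (\<alpha> i) * (X \<alpha> / mfact \<alpha>))" for i
  proof -
    have "(\<Sum>\<alpha>\<in>degs (Suc N). real (\<alpha> i) * (X \<alpha> / mfact \<alpha>)) =
        (\<Sum>\<beta>\<in>degs N. real ((up i \<beta>) i) * (X (up i \<beta>) / mfact (up i \<beta>)))"
      by (rule sum_degs_Suc) simp
    also have "\<dots> = (\<Sum>\<beta>\<in>degs N. X (up i \<beta>) / mfact \<beta>)"
      by (intro sum.cong refl) (simp only: mfact_up fun_upd_same, simp del: of_nat_Suc)
    finally show ?thesis ..
  qed
  then have "(\<Sum>i\<in>UNIV. \<Sum>\<beta>\<in>degs N. X (up i \<beta>) / mfact \<beta>) =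
      (\<Sum>\<alpha>\<in>degs (Suc N). \<Sum>i\<in>UNIV. real (\<alpha> i) * (X \<alpha> / mfact \<alpha>))"
    by (simp only: sum.swap[of _ _ UNIV])
  also have "\<dots> = (\<Sum>\<alpha>\<in>degs (Suc N). real (deg \<alpha>) * X \<alpha> / mfact \<alpha>)"
    by (simp add: sum_distrib_right deg_def sum_divide_distrib)
  finally show ?thesis .
qed

text \<open>The factor \<open>real (\<alpha> i)\<close> of the derivative cancels against
  \<open>mfact \<alpha>\<close>, so differentiation is a plain shift of coefficients that costs one
  degree.\<close>

lemma has_partial_hpoly:
  "has_partial i (hpoly (Suc N) a) (hpoly N (\<lambda>\<beta>. a (up i \<beta>)))"
proof -
  have "has_partial i (\<lambda>x. \<Sum>\<alpha>\<in>degs (Suc N). a \<alpha> / mfact \<alpha> * hermite_multi \<alpha> x)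
     (\<lambda>x. \<Sum>\<alpha>\<in>degs (Suc N). a \<alpha> / mfact \<alpha> * (real (\<alpha> i) * hermite_multi (down i \<alpha>) x))"
    by (intro has_partial_sum has_partial_cmult has_partial_hermite_multi)
  moreover have "(\<Sum>\<alpha>\<in>degs (Suc N). a \<alpha> / mfact \<alpha> * (real (\<alpha> i) * hermite_multi (down i \<alpha>) x)) =
      hpoly N (\<lambda>\<beta>. a (up i \<beta>)) x" for x
  proof -
    have "(\<Sum>\<alpha>\<in>degs (Suc N). a \<alpha> / mfact \<alpha> * (real (\<alpha> i) * hermite_multi (down i \<alpha>) x)) =
       (\<Sum>\<beta>\<in>degs N. a (up i \<beta>) / mfact (up i \<beta>) * (real ((up i \<beta>) i) * hermite_multi (down i (up i \<beta>)) x))"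
      by (rule sum_degs_Suc) simp
    also have "\<dots> = hpoly N (\<lambda>\<beta>. a (up i \<beta>)) x"
      unfolding hpoly_def by (intro sum.cong refl) (simp add: mfact_up del: of_nat_Suc)
    finally show ?thesis .
  qed
  ultimately show ?thesis
    by (simp add: hpoly_def[abs_def])
qed

text \<open>The exact derivative of a truncation of \<open>h\<close> is a truncation of
  \<open>k\<close> one degree lower, so a single polynomial sequence approximates both; hence
  \<open>Suc N\<close> against \<open>N\<close>.\<close>

lemma gderiv_approx:
  assumes "gderiv i h k"
  shows "L2_tendsto (\<lambda>N. hpoly (Suc N) (hcoef h)) h"
    "L2_tendsto (\<lambda>N. hpoly N (\<lambda>\<beta>. hcoef h (up i \<beta>))) k"
proof -
  show "L2_tendsto (\<lambda>N. hpoly (Suc N) (hcoef h)) h"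
    using assms L2_tendsto_subseq[OF L2_tendsto_hpoly, of h Suc] by (auto simp: gderiv_def strict_mono_def)
  have "hcoef k = (\<lambda>\<beta>. hcoef h (up i \<beta>))"
    using assms by (auto simp: gderiv_def)
  then show "L2_tendsto (\<lambda>N. hpoly N (\<lambda>\<beta>. hcoef h (up i \<beta>))) k"
    using L2_tendsto_hpoly[of k] assms by (simp add: gderiv_def)
qed

text \<open>Split b_n F_n - c f into b_n (F_n - f) and (b_n - c) f. The first is small in norm; the
  second tends to 0 by dominated convergence, as |b_n - c| <= 2 B.\<close>

lemma L2_tendsto_bounded_mult:
  assumes [measurable]: "\<And>n. b n \<in> borel_measurable borel" "c \<in> borel_measurable borel"
    and B: "\<And>n x. \<bar>b n x\<bar> \<le> B" "\<And>x. \<bar>c x\<bar> \<le> B"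
    and lim: "AE x in gauss. (\<lambda>n. b n x) \<longlonglongrightarrow> c x"
    and F: "L2_tendsto F f"
  shows "L2_tendsto (\<lambda>n x. b n x * F n x) (\<lambda>x. c x * f x)"
  unfolding L2_tendsto_def
proof (intro conjI allI)
  have L2: "F n \<in> L2" "f \<in> L2" for n
    using F by (auto simp: L2_tendsto_def)
  then have [measurable]: "F n \<in> borel_measurable borel" "f \<in> borel_measurable borel" for n
    by auto
  show "(\<lambda>x. b n x * F n x) \<in> L2" "(\<lambda>x. c x * f x) \<in> L2" for n
    by (rule L2_bounded_mult[OF L2(1) assms(1) B(1)], rule L2_bounded_mult[OF L2(2) assms(2) B(2)])
  have "(\<lambda>n. \<integral>x. ((b n x - c x) * f x)\<^sup>2 \<partial>gauss) \<longlonglongrightarrow> (\<integral>x. 0 \<partial>(gauss :: (real ^ 'a) measure))"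
  proof (rule integral_dominated_convergence[where w = "\<lambda>x. (2 * B)\<^sup>2 * (f x)\<^sup>2"])
    show "integrable gauss (\<lambda>x. (2 * B)\<^sup>2 * (f x)\<^sup>2)"
      by (intro integrable_mult_right L2_integrable_square L2)
    show "AE x in gauss. (\<lambda>n. ((b n x - c x) * f x)\<^sup>2) \<longlonglongrightarrow> 0"
      using lim
    proof eventually_elim
      case (elim x)
      then have "(\<lambda>n. ((b n x - c x) * f x)\<^sup>2) \<longlonglongrightarrow> ((c x - c x) * f x)\<^sup>2"
        by (intro tendsto_intros)
      then show ?case by simp
    qed
    show "AE x in gauss. norm (((b n x - c x) * f x)\<^sup>2) \<le> (2 * B)\<^sup>2 * (f x)\<^sup>2" for n
    proof (rule AE_I2)
      fix x
      have "\<bar>b n x - c x\<bar> \<le> 2 * B"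
        using B(1)[of n x] B(2)[of x] by linarith
      then have "(b n x - c x)\<^sup>2 \<le> (2 * B)\<^sup>2"
        by (metis abs_ge_zero power2_abs power_mono)
      then show "norm (((b n x - c x) * f x)\<^sup>2) \<le> (2 * B)\<^sup>2 * (f x)\<^sup>2"
        by (simp add: power_mult_distrib mult_right_mono)
    qed
  qed measurable
  then have "(\<lambda>n. (nrm (\<lambda>x. (b n x - c x) * f x))\<^sup>2) \<longlonglongrightarrow> 0"
    by (simp add: nrm_square)
  then have "(\<lambda>n. sqrt ((nrm (\<lambda>x. (b n x - c x) * f x))\<^sup>2)) \<longlonglongrightarrow> sqrt 0"
    by (rule tendsto_real_sqrt)
  then have 1: "(\<lambda>n. nrm (\<lambda>x. (b n x - c x) * f x)) \<longlonglongrightarrow> 0"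
    by simp
  have 2: "(\<lambda>n. B * nrm (\<lambda>x. F n x - f x)) \<longlonglongrightarrow> 0"
    using F by (intro tendsto_mult_right_zero) (auto simp: L2_tendsto_def)
  have "B \<ge> 0"
    using B(2)[of 0] by linarith
  have le: "nrm (\<lambda>x. b n x * F n x - c x * f x) \<le> B * nrm (\<lambda>x. F n x - f x) + nrm (\<lambda>x. (b n x - c x) * f x)" for n
  proof -
    have "nrm (\<lambda>x. b n x * F n x - c x * f x) = nrm (\<lambda>x. b n x * (F n x - f x) + (b n x - c x) * f x)"
      by (simp add: algebra_simps)
    also have "\<dots> \<le> nrm (\<lambda>x. b n x * (F n x - f x)) + nrm (\<lambda>x. (b n x - c x) * f x)"
    proof (rule nrm_triangle)
      show "(\<lambda>x. b n x * (F n x - f x)) \<in> L2"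
        using L2 B by (intro L2_bounded_mult[where B = B] L2_diff) auto
      show "(\<lambda>x. (b n x - c x) * f x) \<in> L2"
      proof (rule L2_bounded_mult[where B = "2 * B"])
        show "\<bar>b n x - c x\<bar> \<le> 2 * B" for x
          using B(1)[of n x] B(2)[of x] by linarith
      qed (use L2 in auto)
    qed
    also have "nrm (\<lambda>x. b n x * (F n x - f x)) \<le> nrm (\<lambda>x. B * (F n x - f x))"
      unfolding nrm_def
    proof (intro real_sqrt_le_mono integral_mono)
      show "integrable gauss (\<lambda>x. (b n x * (F n x - f x))\<^sup>2)"
        using L2 B by (intro L2_integrable_square L2_bounded_mult[where B = B] L2_diff) auto
      show "integrable gauss (\<lambda>x. (B * (F n x - f x))\<^sup>2)"
        using L2 by (intro L2_integrable_square L2_cmult L2_diff) auto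
      have "(b n x)\<^sup>2 \<le> B\<^sup>2" for x
        using B(1)[of n x] by (metis abs_ge_zero power2_abs power_mono)
      then show "(b n x * (F n x - f x))\<^sup>2 \<le> (B * (F n x - f x))\<^sup>2" for x
        by (simp add: power_mult_distrib mult_right_mono)
    qed
    finally show ?thesis
      using \<open>B \<ge> 0\<close> by (simp add: nrm_cmult)
  qed
  show "(\<lambda>n. nrm (\<lambda>x. b n x * F n x - c x * f x)) \<longlonglongrightarrow> 0"
    by (rule tendsto_sandwich[OF _ _ tendsto_const tendsto_add_zero[OF 2 1]])
      (use le in \<open>auto intro!: always_eventually\<close>)
qed

text \<open>One smooth bounded family serves twice: for growing \<open>m\<close> it tends to pi / 2
  times the sign, which gives the test function of the obstacle problem, and its derivative divided
  by \<open>m\<close> tends to the indicator of {0}.\<close>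

definition sarctan :: "real \<Rightarrow> real \<Rightarrow> real" where
  "sarctan m y = arctan (m * y)"

lemma DERIV_sarctan: "(sarctan m has_real_derivative m / (1 + (m * y)\<^sup>2)) (at y)"
  unfolding sarctan_def[abs_def] by (auto intro!: derivative_eq_intros simp: field_simps)

lemma sarctan_bounded: "\<bar>sarctan m y\<bar> \<le> pi / 2"
  unfolding sarctan_def using arctan_bounded[of "m * y"] by (auto simp: abs_if)

lemma borel_sarctan [measurable]: "sarctan m \<in> borel_measurable borel"
  unfolding sarctan_def[abs_def] by measurable

lemma divide_one_plus_square_le: "\<bar>c / (1 + y\<^sup>2)\<bar> \<le> \<bar>c\<bar>" for c y :: real
proof -
  have "\<bar>c / (1 + y\<^sup>2)\<bar> = \<bar>c\<bar> / (1 + y\<^sup>2)"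
    by (simp add: abs_divide abs_of_nonneg)
  also have "\<dots> \<le> \<bar>c\<bar> / 1"
    by (intro divide_left_mono) (auto simp: add_pos_nonneg)
  finally show ?thesis
    by simp
qed

lemma exp_growth_sarctan:
  assumes "exp_growth p"
  shows "exp_growth (\<lambda>x. sarctan m (p x))" "exp_growth (\<lambda>x. m / (1 + (m * p x)\<^sup>2))"
proof -
  have c: "continuous_on UNIV p"
    using assms by (rule exp_growth_continuous)
  show "exp_growth (\<lambda>x. sarctan m (p x))"
  proof (rule exp_growth_bounded)
    show "continuous_on UNIV (\<lambda>x. sarctan m (p x))"
      unfolding sarctan_def by (intro continuous_intros c)
  qed (rule sarctan_bounded)
  show "exp_growth (\<lambda>x. m / (1 + (m * p x)\<^sup>2))"
  proof (rule exp_growth_bounded)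
    have "1 + (m * y)\<^sup>2 \<noteq> 0" for y
      by (smt (verit) zero_le_power2)
    then show "continuous_on UNIV (\<lambda>x. m / (1 + (m * p x)\<^sup>2))"
      by (intro continuous_intros c) auto
    show "\<bar>m / (1 + (m * p x)\<^sup>2)\<bar> \<le> \<bar>m\<bar>" for x
      by (rule divide_one_plus_square_le)
  qed
qed

lemma sarctan_ibp:
  assumes "has_partial i p p'" "exp_growth p" "exp_growth p'"
  shows "(\<integral>x. (m / (1 + (m * p x)\<^sup>2) * p' x) * hermite_multi \<beta> x \<partial>gauss) =
    (\<integral>x. sarctan m (p x) * hermite_multi (up i \<beta>) x \<partial>gauss)"
  by (intro hermite_ibp has_partial_compose DERIV_sarctan assms exp_growth_sarctan exp_growth_mult)

text \<open>The weak chain rule, inherited from polynomials. The factor built from \<open>h\<close>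
  is nonlinear, so norm convergence is first improved to convergence almost everywhere along a
  subsequence.\<close>

lemma gderiv_sarctan:
  assumes "gderiv i h k"
  shows "(\<integral>x. (m / (1 + (m * h x)\<^sup>2) * k x) * hermite_multi \<beta> x \<partial>gauss) =
    (\<integral>x. sarctan m (h x) * hermite_multi (up i \<beta>) x \<partial>gauss)"
proof -
  let ?h = "\<lambda>N. hpoly (Suc N) (hcoef h)" and ?k = "\<lambda>N. hpoly N (\<lambda>\<beta>. hcoef h (up i \<beta>))"
  have [measurable]: "h \<in> borel_measurable borel" "k \<in> borel_measurable borel"
    using assms by (auto simp: gderiv_def)
  note lim = gderiv_approx[OF assms]
  obtain r where r: "strict_mono r" "AE x in gauss. (\<lambda>n. ?h (r n) x) \<longlonglongrightarrow> h x"
    using L2_tendsto_AE_subseq[OF lim(1)] .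
  have nz: "1 + (m * y)\<^sup>2 \<noteq> 0" for y
    by (smt (verit) zero_le_power2)
  have "L2_tendsto (\<lambda>n x. m / (1 + (m * ?h (r n) x)\<^sup>2) * ?k (r n) x) (\<lambda>x. m / (1 + (m * h x)\<^sup>2) * k x)"
  proof (rule L2_tendsto_bounded_mult[where B = "\<bar>m\<bar>"])
    show "\<bar>m / (1 + (m * ?h (r n) x)\<^sup>2)\<bar> \<le> \<bar>m\<bar>" "\<bar>m / (1 + (m * h x)\<^sup>2)\<bar> \<le> \<bar>m\<bar>" for n x
      by (rule divide_one_plus_square_le)+
    show "L2_tendsto (\<lambda>n. ?k (r n)) k"
      by (rule L2_tendsto_subseq[OF lim(2) r(1)])
    show "AE x in gauss. (\<lambda>n. m / (1 + (m * ?h (r n) x)\<^sup>2)) \<longlonglongrightarrow> m / (1 + (m * h x)\<^sup>2)"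
      using r(2) by eventually_elim (intro tendsto_intros nz)
  qed measurable
  from L2_tendsto_inner_const[OF this hermite_multi_L2[of \<beta>]]
  have 1: "(\<lambda>n. \<integral>x. (m / (1 + (m * ?h (r n) x)\<^sup>2) * ?k (r n) x) * hermite_multi \<beta> x \<partial>gauss) \<longlonglongrightarrow>
     (\<integral>x. (m / (1 + (m * h x)\<^sup>2) * k x) * hermite_multi \<beta> x \<partial>gauss)" .
  have "L2_tendsto (\<lambda>n x. sarctan m (?h (r n) x) * 1) (\<lambda>x. sarctan m (h x) * 1)"
  proof (rule L2_tendsto_bounded_mult[where B = "pi / 2"])
    show "AE x in gauss. (\<lambda>n. sarctan m (?h (r n) x)) \<longlonglongrightarrow> sarctan m (h x)"
      using r(2) unfolding sarctan_def by eventually_elim (intro tendsto_intros)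
  qed (use sarctan_bounded in \<open>auto intro: L2_tendsto_const\<close>)
  from L2_tendsto_inner_const[OF this hermite_multi_L2[of "up i \<beta>"]]
  have 2: "(\<lambda>n. \<integral>x. sarctan m (?h (r n) x) * hermite_multi (up i \<beta>) x \<partial>gauss) \<longlonglongrightarrow>
     (\<integral>x. sarctan m (h x) * hermite_multi (up i \<beta>) x \<partial>gauss)"
    by simp
  have eq: "(\<integral>x. (m / (1 + (m * ?h (r n) x)\<^sup>2) * ?k (r n) x) * hermite_multi \<beta> x \<partial>gauss) =
     (\<integral>x. sarctan m (?h (r n) x) * hermite_multi (up i \<beta>) x \<partial>gauss)" for n
    by (intro sarctan_ibp has_partial_hpoly) auto
  show ?thesis
    using LIMSEQ_unique[OF 1[unfolded eq] 2] .
qed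

text \<open>The functions \<open>arctan (m y) / m\<close> tend to \<open>0\<close> uniformly while their derivatives tend to the
  indicator of \<open>{0}\<close>.\<close>
lemma gderiv_eq_0_on_zero_set:
  assumes d: "gderiv i h k"
  shows "AE x in gauss. h x = 0 \<longrightarrow> k x = 0"
proof -
  have L2: "h \<in> L2" "k \<in> L2"
    using d by (auto simp: gderiv_def)
  then have [measurable]: "h \<in> borel_measurable borel" "k \<in> borel_measurable borel"
    by auto
  let ?m = "\<lambda>n. real (Suc n)"
  let ?b = "\<lambda>n x. 1 / (1 + (?m n * h x)\<^sup>2)"
  let ?c = "\<lambda>x. indicator {0} (h x) :: real"
  have lim: "L2_tendsto (\<lambda>n x. ?b n x * k x) (\<lambda>x. ?c x * k x)"
  proof (rule L2_tendsto_bounded_mult[where B = 1])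
    show "AE x in gauss. (\<lambda>n. ?b n x) \<longlonglongrightarrow> ?c x"
    proof (rule AE_I2)
      fix x
      show "(\<lambda>n. ?b n x) \<longlonglongrightarrow> ?c x"
      proof (cases "h x = 0")
        case False
        have m: "filterlim (\<lambda>n. ?m n) at_top sequentially"
          using filterlim_real_sequentially filterlim_sequentially_Suc by blast
        have "filterlim (\<lambda>n. (?m n)\<^sup>2 * (h x)\<^sup>2) at_top sequentially"
          using False by (intro filterlim_at_top_mult_tendsto_pos[OF tendsto_const] filterlim_pow_at_top m
              filterlim_tendsto_pos_mult_at_top) auto
        then have "filterlim (\<lambda>n. 1 + (?m n * h x)\<^sup>2) at_top sequentially"
          unfolding power_mult_distrib by (intro filterlim_tendsto_add_at_top[OF tendsto_const])
        then have "(\<lambda>n. ?b n x) \<longlonglongrightarrow> 0"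
          by (rule tendsto_divide_0[OF tendsto_const filterlim_at_top_imp_at_infinity])
        then show ?thesis
          using False by simp
      qed simp
    qed
    show "\<bar>?b n x\<bar> \<le> 1" for n x
      using divide_one_plus_square_le[of 1 "?m n * h x"] by simp
  qed (auto intro: L2_tendsto_const L2 simp: indicator_def)
  have "hcoef (\<lambda>x. ?c x * k x) \<beta> = 0" for \<beta>
  proof (rule LIMSEQ_unique)
    show "(\<lambda>n. hcoef (\<lambda>x. ?b n x * k x) \<beta>) \<longlonglongrightarrow> hcoef (\<lambda>x. ?c x * k x) \<beta>"
      by (rule hcoef_tendsto[OF lim])
    let ?I = "\<integral>x. \<bar>hermite_multi (up i \<beta>) x\<bar> \<partial>gauss"
    \<comment> \<open>Multiplication by \<open>?m n\<close> creates the derivative of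
      \<open>sarctan\<close>; after integration by parts only the bounded function itself remains,
      so the coefficient is of order 1 / (n + 1).\<close>
    have "norm (hcoef (\<lambda>x. ?b n x * k x) \<beta>) \<le> (pi / 2 * ?I) * inverse (?m n)" for n
    proof -
      have "?m n * hcoef (\<lambda>x. ?b n x * k x) \<beta> = (\<integral>x. (?m n / (1 + (?m n * h x)\<^sup>2) * k x) * hermite_multi \<beta> x \<partial>gauss)"
        unfolding hcoef_def by (simp flip: integral_mult_right_zero add: mult_ac del: of_nat_Suc)
      also have "\<dots> = (\<integral>x. sarctan (?m n) (h x) * hermite_multi (up i \<beta>) x \<partial>gauss)"
        by (rule gderiv_sarctan[OF d])
      finally have "\<bar>?m n * hcoef (\<lambda>x. ?b n x * k x) \<beta>\<bar> \<le> (\<integral>x. \<bar>sarctan (?m n) (h x) * hermite_multi (up i \<beta>) x\<bar> \<partial>gauss)"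
        using integral_abs_bound[of gauss "\<lambda>x. sarctan (?m n) (h x) * hermite_multi (up i \<beta>) x"] by (simp only:)
      also have "\<dots> \<le> (\<integral>x. pi / 2 * \<bar>hermite_multi (up i \<beta>) x\<bar> \<partial>gauss)"
      proof (rule integral_mono)
        show "integrable gauss (\<lambda>x. \<bar>sarctan (?m n) (h x) * hermite_multi (up i \<beta>) x\<bar>)"
          by (intro integrable_abs L2_integrable L2_bounded_mult[where B = "pi / 2"] sarctan_bounded) auto
        show "integrable gauss (\<lambda>x. pi / 2 * \<bar>hermite_multi (up i \<beta>) x\<bar>)"
          by (intro integrable_mult_right integrable_abs L2_integrable) auto
        show "\<bar>sarctan (?m n) (h x) * hermite_multi (up i \<beta>) x\<bar> \<le> pi / 2 * \<bar>hermite_multi (up i \<beta>) x\<bar>" for x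
          unfolding abs_mult by (intro mult_right_mono sarctan_bounded) simp
      qed
      finally have "?m n * \<bar>hcoef (\<lambda>x. ?b n x * k x) \<beta>\<bar> \<le> pi / 2 * ?I"
        by (simp add: abs_mult del: of_nat_Suc)
      then have "\<bar>hcoef (\<lambda>x. ?b n x * k x) \<beta>\<bar> \<le> (pi / 2 * ?I) / ?m n"
        by (subst pos_le_divide_eq) (simp_all only: mult.commute of_nat_0_less_iff zero_less_Suc)
      then show ?thesis
        by (simp only: divide_inverse real_norm_def)
    qed
    moreover have "(\<lambda>n. (pi / 2 * ?I) * inverse (?m n)) \<longlonglongrightarrow> 0"
      by (intro tendsto_mult_right_zero LIMSEQ_inverse_real_of_nat)
    ultimately show "(\<lambda>n. hcoef (\<lambda>x. ?b n x * k x) \<beta>) \<longlonglongrightarrow> 0"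
      by (rule Lim_null_comparison[OF always_eventually[OF allI]])
  qed
  then have "AE x in gauss. ?c x * k x = 0"
    using lim by (intro tame_AE_eq_0 L2_tame) (auto simp: L2_tendsto_def hcoef_def)
  then show ?thesis
    by eventually_elim (auto simp: indicator_def)
qed

text \<open>The second-order counterpart of \<open>gderiv\<close>, with two index shifts. It
  determines \<open>A\<close> up to null sets and refers to \<open>w\<close> through its
  coefficients alone.\<close>

definition hessian_coeffs :: "(real ^ 'n::finite \<Rightarrow> real) \<Rightarrow> (real ^ 'n \<Rightarrow> real ^ 'n ^ 'n) \<Rightarrow> bool" where
  "hessian_coeffs w A \<longleftrightarrow> (\<forall>i j. (\<lambda>x. A x $ i $ j) \<in> L2 \<and>
     (\<forall>\<beta>. hcoef (\<lambda>x. A x $ i $ j) \<beta> = hcoef w (up i (up j \<beta>))))"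

text \<open>By \<open>sum_up_mfact\<close> the derivatives have total energy \<Sum> n |w_n|^2, and n
  <= n^2 bounds it by the square norm of \<open>k\<close>; \<open>Riesz_Fischer\<close> then
  provides the functions.\<close>

lemma ex_gderiv:
  fixes w :: "real ^ 'n::finite \<Rightarrow> real"
  assumes w: "w \<in> L2" and k: "k \<in> L2" and coef: "\<And>\<alpha>. hcoef k \<alpha> = real (deg \<alpha>) * hcoef w \<alpha>"
  obtains D where "\<And>i. gderiv i w (D i)"
proof -
  have "\<exists>D. gderiv i w D" for i
  proof -
    have "(\<Sum>\<beta>\<in>degs N. (hcoef w (up i \<beta>))\<^sup>2 / mfact \<beta>) \<le> (nrm k)\<^sup>2" for N
    proof -
      have "(\<Sum>\<beta>\<in>degs N. (hcoef w (up i \<beta>))\<^sup>2 / mfact \<beta>) \<le>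
          (\<Sum>i\<in>UNIV. \<Sum>\<beta>\<in>degs N. (hcoef w (up i \<beta>))\<^sup>2 / mfact \<beta>)"
        by (rule member_le_sum[where f = "\<lambda>i. \<Sum>\<beta>\<in>degs N. (hcoef w (up i \<beta>))\<^sup>2 / mfact \<beta>"])
          (auto intro!: sum_nonneg)
      also have "\<dots> = (\<Sum>\<alpha>\<in>degs (Suc N). real (deg \<alpha>) * (hcoef w \<alpha>)\<^sup>2 / mfact \<alpha>)"
        by (rule sum_up_mfact[where N = N and X = "\<lambda>\<alpha>. (hcoef w \<alpha>)\<^sup>2"])
      also have "\<dots> \<le> (\<Sum>\<alpha>\<in>degs (Suc N). (hcoef k \<alpha>)\<^sup>2 / mfact \<alpha>)"
      proof (intro sum_mono divide_right_mono)
        have "real n \<le> (real n)\<^sup>2" for n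
          by (cases n) (auto simp: power2_eq_square)
        then show "real (deg \<alpha>) * (hcoef w \<alpha>)\<^sup>2 \<le> (hcoef k \<alpha>)\<^sup>2" for \<alpha>
          unfolding coef power_mult_distrib by (rule mult_right_mono) simp
      qed simp
      also have "\<dots> \<le> (nrm k)\<^sup>2"
        by (rule Bessel[OF k])
      finally show ?thesis .
    qed
    from Riesz_Fischer[OF this] show ?thesis
      using w by (metis gderiv_def)
  qed
  then show ?thesis
    using that by metis
qed

lemma borel_measurable_matrix:
  fixes A :: "real ^ 'n::finite \<Rightarrow> real ^ 'n ^ 'n"
  assumes "\<And>i j. (\<lambda>x. A x $ i $ j) \<in> borel_measurable borel"
  shows "A \<in> borel_measurable borel"
proof (rule borel_measurable_euclidean_space[THEN iffD2], intro ballI)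
  fix b :: "real ^ 'n ^ 'n"
  assume "b \<in> Basis"
  then obtain i j where "b = axis i (axis j 1)"
    by (auto simp: Basis_vec_def)
  then show "(\<lambda>x. A x \<bullet> b) \<in> borel_measurable borel"
    using assms[of i j] by (simp add: inner_axis)
qed

text \<open>Applying \<open>sum_up_mfact\<close> twice gives the weight n (n - 1) <= n^2. This is
  the contraction property of the transform: all entries are counted at once, so no dimensional
  factor appears.\<close>

lemma ex_hessian_coeffs:
  fixes w :: "real ^ 'n::finite \<Rightarrow> real"
  assumes k: "k \<in> L2" and coef: "\<And>\<alpha>. hcoef k \<alpha> = real (deg \<alpha>) * hcoef w \<alpha>"
  obtains A where "hessian_coeffs w A" "A \<in> borel_measurable borel"
    "(\<Sum>i\<in>UNIV. \<Sum>j\<in>UNIV. (nrm (\<lambda>x. A x $ i $ j))\<^sup>2) \<le> (nrm k)\<^sup>2"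
proof -
  let ?S = "\<lambda>N i j. \<Sum>\<beta>\<in>degs N. (hcoef w (up i (up j \<beta>)))\<^sup>2 / mfact \<beta>"
  have bd: "(\<Sum>i\<in>UNIV. \<Sum>j\<in>UNIV. ?S N i j) \<le> (nrm k)\<^sup>2" for N
  proof -
    \<comment> \<open>The weight \<open>deg \<beta>\<close> left by the inner sum is written as
      \<open>deg (up i \<beta>) - 1\<close>, a function of \<open>up i \<beta>\<close>, so that
      \<open>sum_up_mfact\<close> applies once more to the sum over \<open>i\<close>.\<close>
    have "(\<Sum>j\<in>UNIV. ?S N i j) =
        (\<Sum>\<beta>\<in>degs (Suc N). ((real (deg (up i \<beta>)) - 1) * (hcoef w (up i \<beta>))\<^sup>2) / mfact \<beta>)" for i
      by (subst sum_up_mfact[where N = N and X = "\<lambda>\<alpha>. (hcoef w (up i \<alpha>))\<^sup>2"]) simp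
    then have "(\<Sum>i\<in>UNIV. \<Sum>j\<in>UNIV. ?S N i j) =
        (\<Sum>i\<in>UNIV. \<Sum>\<beta>\<in>degs (Suc N). ((real (deg (up i \<beta>)) - 1) * (hcoef w (up i \<beta>))\<^sup>2) / mfact \<beta>)"
      by (simp only:)
    also have "\<dots> = (\<Sum>\<alpha>\<in>degs (Suc (Suc N)). real (deg \<alpha>) * ((real (deg \<alpha>) - 1) * (hcoef w \<alpha>)\<^sup>2) / mfact \<alpha>)"
      by (rule sum_up_mfact[where N = "Suc N" and X = "\<lambda>\<alpha>. (real (deg \<alpha>) - 1) * (hcoef w \<alpha>)\<^sup>2"])
    also have "\<dots> \<le> (\<Sum>\<alpha>\<in>degs (Suc (Suc N)). (hcoef k \<alpha>)\<^sup>2 / mfact \<alpha>)"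
    proof (intro sum_mono divide_right_mono)
      show "real (deg \<alpha>) * ((real (deg \<alpha>) - 1) * (hcoef w \<alpha>)\<^sup>2) \<le> (hcoef k \<alpha>)\<^sup>2" for \<alpha>
        unfolding coef power_mult_distrib power2_eq_square[of "real (deg \<alpha>)"] mult.assoc
        by (intro mult_left_mono mult_right_mono) auto
    qed simp
    also have "\<dots> \<le> (nrm k)\<^sup>2"
      by (rule Bessel[OF k])
    finally show ?thesis .
  qed
  have "?S N i j \<le> (nrm k)\<^sup>2" for N i j
  proof -
    have "?S N i j \<le> (\<Sum>j\<in>UNIV. ?S N i j)"
      by (rule member_le_sum[where f = "?S N i"]) (auto intro!: sum_nonneg)
    also have "\<dots> \<le> (\<Sum>i\<in>UNIV. \<Sum>j\<in>UNIV. ?S N i j)"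
      by (rule member_le_sum[where f = "\<lambda>i. \<Sum>j\<in>UNIV. ?S N i j"]) (auto intro!: sum_nonneg)
    finally show ?thesis
      using bd[of N] by linarith
  qed
  then have ex: "\<exists>f. f \<in> L2 \<and> hcoef f = (\<lambda>\<beta>. hcoef w (up i (up j \<beta>)))" for i j
    by (rule Riesz_Fischer) blast
  define a where "a i j = (SOME f. f \<in> L2 \<and> hcoef f = (\<lambda>\<beta>. hcoef w (up i (up j \<beta>))))" for i j
  have a: "a i j \<in> L2" "hcoef (a i j) = (\<lambda>\<beta>. hcoef w (up i (up j \<beta>)))" for i j
    using someI_ex[OF ex[where i = i and j = j]] unfolding a_def by blast+
  let ?A = "\<lambda>x. \<chi> i j. a i j x"
  have "(\<lambda>N. \<Sum>i\<in>UNIV. \<Sum>j\<in>UNIV. ?S N i j) \<longlonglongrightarrow> (\<Sum>i\<in>UNIV. \<Sum>j\<in>UNIV. (nrm (a i j))\<^sup>2)"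
    using Parseval[OF a(1)] unfolding a(2) by (intro tendsto_sum) auto
  then have "(\<Sum>i\<in>UNIV. \<Sum>j\<in>UNIV. (nrm (a i j))\<^sup>2) \<le> (nrm k)\<^sup>2"
    by (rule LIMSEQ_le_const2) (use bd in blast)
  moreover have "?A \<in> borel_measurable borel"
    using a(1) by (intro borel_measurable_matrix) auto
  moreover have "hessian_coeffs w ?A"
    using a by (auto simp: hessian_coeffs_def)
  ultimately show ?thesis
    using that[of ?A] by auto
qed

text \<open>The argument for one derivative is applied to \<open>w\<close> and then to each
  \<open>D i\<close>, whose zero set contains that of \<open>w\<close> up to a null set.\<close>

lemma hessian_coeffs_eq_0_on_zero_set:
  fixes w :: "real ^ 'n::finite \<Rightarrow> real"
  assumes D: "\<And>i. gderiv i w (D i)" and A: "hessian_coeffs w A"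
  shows "AE x in gauss. w x = 0 \<longrightarrow> (\<forall>i. D i x = 0) \<and> A x = 0"
proof -
  have d: "gderiv j (D i) (\<lambda>x. A x $ i $ j)" for i j
    using D[of i] A by (auto simp: gderiv_def hessian_coeffs_def)
  have "AE x in gauss. \<forall>i j. D i x = 0 \<longrightarrow> A x $ i $ j = 0"
    using gderiv_eq_0_on_zero_set[OF d] unfolding AE_all_countable by blast
  moreover have "AE x in gauss. \<forall>i. w x = 0 \<longrightarrow> D i x = 0"
    using gderiv_eq_0_on_zero_set[OF D] unfolding AE_all_countable by blast
  ultimately show ?thesis
    by eventually_elim (auto simp: vec_eq_iff)
qed

text \<open>Links the spectral operator to its pointwise expression, so that the equation can be
  read on the set where the derivatives vanish. Direction \<open>i\<close> contributes the
  eigenvalue \<open>\<beta> i\<close>, and these add up to the degree.\<close>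

lemma OU_eq_derivatives:
  fixes w :: "real ^ 'n::finite \<Rightarrow> real"
  assumes D: "\<And>i. gderiv i w (D i)" and A: "hessian_coeffs w A"
    and k: "k \<in> L2" and coef: "\<And>\<alpha>. hcoef k \<alpha> = real (deg \<alpha>) * hcoef w \<alpha>"
  shows "AE x in gauss. k x = (\<Sum>i\<in>UNIV. x $ i * D i x - A x $ i $ i)"
proof (rule tame_eq_AE[OF L2_tame[OF k]])
  have D2: "D i \<in> L2" and A2: "(\<lambda>x. A x $ i $ i) \<in> L2" for i
    using D A by (auto simp: gderiv_def hessian_coeffs_def)
  have "tame (\<lambda>x. D i x * x $ i)" for i
    by (intro tame_mult_exp_growth L2_tame D2 exp_growth_component)
  then have t: "tame (\<lambda>x. x $ i * D i x - A x $ i $ i)" for i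
    using tame_diff[OF _ L2_tame[OF A2]] by (simp add: mult.commute)
  have t_sum: "tame (\<lambda>x. \<Sum>i\<in>S. x $ i * D i x - A x $ i $ i)" for S
  proof (induction S rule: infinite_finite_induct)
    case (insert i S)
    have "tame (\<lambda>x. - (\<Sum>i\<in>S. x $ i * D i x - A x $ i $ i))"
      using tame_mult_exp_growth[OF insert.IH exp_growth_const[of "-1"]] by simp
    from tame_diff[OF t[of i] this] show ?case
      using insert.hyps by simp
  qed (auto intro: L2_tame)
  then show "tame (\<lambda>x. \<Sum>i\<in>UNIV. x $ i * D i x - A x $ i $ i)" .
  fix \<beta> :: "'n \<Rightarrow> nat"
  have 1: "(\<integral>x. (x $ i * D i x - A x $ i $ i) * hermite_multi \<beta> x \<partial>gauss) = real (\<beta> i) * hcoef w \<beta>" for i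
  proof -
    have "(\<integral>x. (x $ i * D i x - A x $ i $ i) * hermite_multi \<beta> x \<partial>gauss) =
        (\<integral>x. (D i x * (x $ i * hermite_multi \<beta> x)) - A x $ i $ i * hermite_multi \<beta> x \<partial>gauss)"
      by (simp add: algebra_simps)
    \<comment> \<open>The raised term will cancel against the coefficient of the second derivative;
      in the lowered term the derivative raises the index back to \<beta>.\<close>
    also have "\<dots> = (\<integral>x. D i x * hermite_multi (up i \<beta>) x + real (\<beta> i) * (D i x * hermite_multi (down i \<beta>) x)
        - A x $ i $ i * hermite_multi \<beta> x \<partial>gauss)"
      unfolding component_times_hermite_multi by (simp add: algebra_simps)
    also have "\<dots> = hcoef (D i) (up i \<beta>) + real (\<beta> i) * hcoef (D i) (down i \<beta>) - hcoef (\<lambda>x. A x $ i $ i) \<beta>"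
      using D2[of i] A2[of i] by (simp add: hcoef_def L2_integrable_mult)
    also have "hcoef (D i) (up i \<beta>) = hcoef (\<lambda>x. A x $ i $ i) \<beta>"
      using D[of i] A by (simp add: gderiv_def hessian_coeffs_def)
    also have "real (\<beta> i) * hcoef (D i) (down i \<beta>) = real (\<beta> i) * hcoef w \<beta>"
    proof (cases "\<beta> i = 0")
      case False
      then have "up i (down i \<beta>) = \<beta>"
        by auto
      moreover have "hcoef (D i) (down i \<beta>) = hcoef w (up i (down i \<beta>))"
        using D[of i] unfolding gderiv_def by blast
      ultimately show ?thesis
        by simp
    qed simp
    finally show ?thesis by simp
  qed
  have "hcoef (\<lambda>x. \<Sum>i\<in>UNIV. x $ i * D i x - A x $ i $ i) \<beta> =
      (\<Sum>i\<in>UNIV. \<integral>x. (x $ i * D i x - A x $ i $ i) * hermite_multi \<beta> x \<partial>gauss)"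
    unfolding hcoef_def sum_distrib_right
    by (intro Bochner_Integration.integral_sum tame_integrable tame_mult_exp_growth t exp_growth_hermite_multi)
  also have "\<dots> = real (deg \<beta>) * hcoef w \<beta>"
    unfolding 1 deg_def by (simp add: sum_distrib_right)
  finally show "hcoef k \<beta> = hcoef (\<lambda>x. \<Sum>i\<in>UNIV. x $ i * D i x - A x $ i $ i) \<beta>"
    using coef by simp
qed

section \<open>The two-sided obstacle problem\<close>

text \<open>Trial and test space of the minimisation. On polynomials the energy is a finite sum, so
  no form domain enters, and they are dense in \<open>L2\<close> by
  \<open>L2_tendsto_hpoly\<close>.\<close>

definition HP :: "nat \<Rightarrow> (real ^ 'n::finite \<Rightarrow> real) set" where
  "HP N = range (hpoly N)"

lemma HP_L2: "p \<in> HP N \<Longrightarrow> p \<in> L2"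
  by (auto simp: HP_def)

lemma hpoly_add: "hpoly N a x + hpoly N b x = hpoly N (\<lambda>\<alpha>. a \<alpha> + b \<alpha>) x"
  by (simp add: hpoly_def sum.distrib[symmetric] add_divide_distrib distrib_right)

lemma hpoly_cmult: "c * hpoly N a x = hpoly N (\<lambda>\<alpha>. c * a \<alpha>) x"
  by (simp add: hpoly_def sum_distrib_left mult.assoc)

lemma HP_add: "p \<in> HP N \<Longrightarrow> q \<in> HP N \<Longrightarrow> (\<lambda>x. p x + q x) \<in> HP N"
  by (auto simp: HP_def hpoly_add)

lemma HP_cmult: "p \<in> HP N \<Longrightarrow> (\<lambda>x. c * p x) \<in> HP N"
  by (auto simp: HP_def hpoly_cmult)

lemma HP_mono: "N \<le> M \<Longrightarrow> HP N \<subseteq> HP M"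
proof
  fix p :: "real ^ 'n::finite \<Rightarrow> real"
  assume "N \<le> M" "p \<in> HP N"
  then obtain a where p: "p = hpoly N a"
    by (auto simp: HP_def)
  have "hpoly N a = hpoly M (\<lambda>\<alpha>. if deg \<alpha> < N then a \<alpha> else 0)"
  proof
    fix x
    show "hpoly N a x = hpoly M (\<lambda>\<alpha>. if deg \<alpha> < N then a \<alpha> else 0) x"
      unfolding hpoly_def using \<open>N \<le> M\<close> degs_mono[OF \<open>N \<le> M\<close>]
      by (intro sum.mono_neutral_cong_left[OF finite_degs]) (auto simp: degs_def)
  qed
  then show "p \<in> HP M"
    by (simp add: p HP_def)
qed

lemma HP_hcoef_eq_0: "p \<in> HP N \<Longrightarrow> \<not> deg \<alpha> < N \<Longrightarrow> hcoef p \<alpha> = 0"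
  by (auto simp: HP_def hcoef_hpoly)

lemma nrm_HP: "p \<in> HP N \<Longrightarrow> (nrm p)\<^sup>2 = (\<Sum>\<alpha>\<in>degs N. (hcoef p \<alpha>)\<^sup>2 / mfact \<alpha>)"
  by (auto simp: HP_def nrm_hpoly hcoef_hpoly degs_def)

text \<open>The form \<open>\<langle>(\<N> + \<delta>) f, g\<rangle>\<close> restricted to degrees below \<open>N\<close>.\<close>
definition eform :: "real \<Rightarrow> nat \<Rightarrow> (real ^ 'n::finite \<Rightarrow> real) \<Rightarrow> (real ^ 'n \<Rightarrow> real) \<Rightarrow> real" where
  "eform \<delta> N f g = (\<Sum>\<alpha>\<in>degs N. (real (deg \<alpha>) + \<delta>) * hcoef f \<alpha> * hcoef g \<alpha> / mfact \<alpha>)"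

lemma eform_add_cmult:
  assumes "f \<in> L2" "g \<in> L2"
  shows "eform \<delta> N (\<lambda>x. f x + s * g x) (\<lambda>x. f x + s * g x) =
    eform \<delta> N f f + 2 * s * eform \<delta> N f g + s\<^sup>2 * eform \<delta> N g g"
  using assms
  by (simp add: eform_def hcoef_add hcoef_cmult L2_cmult sum_distrib_left sum.distrib[symmetric])
    (intro sum.cong refl, simp add: field_simps power2_eq_square)

text \<open>The cut-off is immaterial once one argument is a polynomial of lower degree, so energies
  at different levels can be compared.\<close>

lemma eform_le:
  assumes "p \<in> HP M \<or> q \<in> HP M" "M \<le> N"
  shows "eform \<delta> N p q = eform \<delta> M p q"
  unfolding eform_def
  using assms degs_mono[OF assms(2)]
  by (intro sum.mono_neutral_right[OF finite_degs]) (auto simp: HP_hcoef_eq_0 degs_def)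

lemma nrm_le_eform: "p \<in> HP N \<Longrightarrow> \<delta> * (nrm p)\<^sup>2 \<le> eform \<delta> N p p"
  unfolding nrm_HP eform_def sum_distrib_left
proof (intro sum_mono)
  fix \<alpha>
  have "\<delta> * (hcoef p \<alpha>)\<^sup>2 \<le> (real (deg \<alpha>) + \<delta>) * (hcoef p \<alpha>)\<^sup>2"
    by (intro mult_right_mono) auto
  then show "\<delta> * ((hcoef p \<alpha>)\<^sup>2 / mfact \<alpha>) \<le> (real (deg \<alpha>) + \<delta>) * hcoef p \<alpha> * hcoef p \<alpha> / mfact \<alpha>"
    by (simp add: power2_eq_square divide_right_mono mult.assoc)
qed

definition obst :: "(real ^ 'n::finite \<Rightarrow> real) \<Rightarrow> real \<Rightarrow> real \<Rightarrow> nat \<Rightarrow> (real ^ 'n \<Rightarrow> real) \<Rightarrow> real" where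
  "obst F \<delta> t N p = eform \<delta> N p p / 2 - (\<integral>x. F x * p x \<partial>gauss) + t * (\<integral>x. \<bar>p x\<bar> \<partial>gauss)"

text \<open>Young's inequality with weight \<delta> absorbs the linear term into \<delta> |p|^2 / 2,
  which the regularised form contains. The bound is uniform in \<open>N\<close>, so one infimum over
  all degrees can be taken.\<close>

lemma obst_lower_bound:
  assumes F: "F \<in> L2" and "\<delta> > 0" "t > 0" and p: "p \<in> HP N"
  shows "- ((nrm F)\<^sup>2 / (2 * \<delta>)) \<le> obst F \<delta> t N p"
proof -
  have "(\<integral>x. F x * p x \<partial>gauss) \<le> nrm F * nrm p"
    using gauss_Cauchy_Schwarz[OF F HP_L2[OF p]] by linarith
  moreover have "0 \<le> t * (\<integral>x. \<bar>p x\<bar> \<partial>gauss)"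
    using \<open>t > 0\<close> by simp
  moreover have "0 \<le> (nrm F - \<delta> * nrm p)\<^sup>2 / (2 * \<delta>)"
    using \<open>\<delta> > 0\<close> by simp
  then have "nrm F * nrm p \<le> (nrm F)\<^sup>2 / (2 * \<delta>) + \<delta> * (nrm p)\<^sup>2 / 2"
    using \<open>\<delta> > 0\<close> by (simp add: power2_diff field_simps power2_eq_square)
  ultimately show ?thesis
    using nrm_le_eform[OF p, of \<delta>] unfolding obst_def by linarith
qed

text \<open>Strong convexity, through the parallelogram identity.\<close>
lemma obst_midpoint:
  assumes F: "F \<in> L2" and "t > 0" and p: "p \<in> HP N" and q: "q \<in> HP N"
  shows "obst F \<delta> t N (\<lambda>x. 1/2 * (p x + q x)) + \<delta> * (nrm (\<lambda>x. p x - q x))\<^sup>2 / 8 \<le>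
    (obst F \<delta> t N p + obst F \<delta> t N q) / 2"
proof -
  have L2: "p \<in> L2" "q \<in> L2"
    using p q HP_L2 by auto
  let ?m = "\<lambda>x. 1/2 * (p x + q x)"
  have par: "eform \<delta> N ?m ?m = eform \<delta> N p p / 2 + eform \<delta> N q q / 2 - eform \<delta> N (\<lambda>x. p x - q x) (\<lambda>x. p x - q x) / 4"
  proof -
    have "eform \<delta> N ?m ?m = (1/4) * eform \<delta> N (\<lambda>x. p x + q x) (\<lambda>x. p x + q x)"
      unfolding eform_def hcoef_cmult sum_distrib_left by (auto intro!: sum.cong)
    also have "eform \<delta> N (\<lambda>x. p x + q x) (\<lambda>x. p x + q x) = eform \<delta> N p p + 2 * eform \<delta> N p q + eform \<delta> N q q"
      using eform_add_cmult[OF L2, of \<delta> N 1] by simp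
    moreover have "eform \<delta> N (\<lambda>x. p x - q x) (\<lambda>x. p x - q x) = eform \<delta> N p p - 2 * eform \<delta> N p q + eform \<delta> N q q"
      using eform_add_cmult[OF L2, of \<delta> N "-1"] by simp
    ultimately show ?thesis
      by linarith
  qed
  have diff: "(\<lambda>x. p x - q x) \<in> HP N"
    using HP_add[OF p HP_cmult[OF q, of "-1"]] by simp
  have lin: "(\<integral>x. F x * ?m x \<partial>gauss) = ((\<integral>x. F x * p x \<partial>gauss) + (\<integral>x. F x * q x \<partial>gauss)) / 2"
  proof -
    have eq: "F x * ?m x = (F x * p x + F x * q x) / 2" for x
      by (simp add: distrib_left)
    show ?thesis
      unfolding eq using L2_integrable_mult[OF F L2(1)] L2_integrable_mult[OF F L2(2)] by simp
  qed
  have abs: "(\<integral>x. \<bar>?m x\<bar> \<partial>gauss) \<le> ((\<integral>x. \<bar>p x\<bar> \<partial>gauss) + (\<integral>x. \<bar>q x\<bar> \<partial>gauss)) / 2"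
  proof -
    have "(\<integral>x. \<bar>?m x\<bar> \<partial>gauss) \<le> (\<integral>x. (\<bar>p x\<bar> + \<bar>q x\<bar>) / 2 \<partial>gauss)"
    proof (rule integral_mono)
      show "integrable gauss (\<lambda>x. \<bar>?m x\<bar>)"
        using L2 by (intro integrable_abs L2_integrable L2_cmult L2_add)
      show "integrable gauss (\<lambda>x. (\<bar>p x\<bar> + \<bar>q x\<bar>) / 2)"
        using L2 by (intro integrable_divide Bochner_Integration.integrable_add integrable_abs L2_integrable)
    qed (simp add: abs_mult)
    then show ?thesis
      using L2_integrable[OF L2(1)] L2_integrable[OF L2(2)] by simp
  qed
  then have "t * (\<integral>x. \<bar>?m x\<bar> \<partial>gauss) \<le> t * (((\<integral>x. \<bar>p x\<bar> \<partial>gauss) + (\<integral>x. \<bar>q x\<bar> \<partial>gauss)) / 2)"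
    using \<open>t > 0\<close> by (intro mult_left_mono) auto
  then show ?thesis
    using nrm_le_eform[OF diff, of \<delta>] unfolding obst_def par lin by (simp add: field_simps)
qed

text \<open>The one-sided derivative of the absolute value. For nonzero \<open>w\<close> no sign
  change occurs once the step is small, so the quotient is eventually constant; at the kink it
  equals |q|, which is not linear in \<open>q\<close> and leaves only an inequality below.\<close>

lemma tendsto_abs_difference_quotient:
  "(\<lambda>n. (\<bar>w + q * inverse (real (Suc n))\<bar> - \<bar>w\<bar>) * real (Suc n)) \<longlonglongrightarrow> sgn w * q + indicator {0} w * \<bar>q\<bar>"
  for w q :: real
proof (rule tendsto_eventually)
  have "(\<lambda>n. \<bar>q\<bar> * inverse (real (Suc n))) \<longlonglongrightarrow> 0"
    by (intro tendsto_mult_right_zero LIMSEQ_inverse_real_of_nat)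
  then have ev: "\<forall>\<^sub>F n in sequentially. \<bar>q\<bar> * inverse (real (Suc n)) < \<bar>w\<bar>" if "w \<noteq> 0"
    using that by (auto elim!: order_tendstoD)
  show "\<forall>\<^sub>F n in sequentially. (\<bar>w + q * inverse (real (Suc n))\<bar> - \<bar>w\<bar>) * real (Suc n) = sgn w * q + indicator {0} w * \<bar>q\<bar>"
  proof (cases "w = 0")
    case True
    then show ?thesis
      by (simp add: abs_mult)
  next
    case False
    from ev[OF False] show ?thesis
    proof eventually_elim
      case (elim n)
      define s where "s = inverse (real (Suc n))"
      have s: "s * real (Suc n) = 1"
        by (simp add: s_def)
      have "\<bar>q * s\<bar> < \<bar>w\<bar>"
        using elim by (simp add: s_def abs_mult)
      then have "\<bar>w + q * s\<bar> - \<bar>w\<bar> = sgn w * q * s"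
        by (cases "w > 0") (auto simp: abs_if sgn_if split: if_splits)
      then have "(\<bar>w + q * s\<bar> - \<bar>w\<bar>) * real (Suc n) = sgn w * q * (s * real (Suc n))"
        by simp
      then show ?case
        using False unfolding s by (simp add: s_def)
    qed
  qed
qed

text \<open>A minimising sequence of polynomials converges, but its limit \<open>w\<close> need not
  be a polynomial and its own energy is never formed. Only energy differences pass to the limit;
  they involve finitely many coefficients of \<open>w\<close> and L1 norms.\<close>

lemma obstacle_variational_inequality:
  fixes F :: "real ^ 'n::finite \<Rightarrow> real"
  assumes F: "F \<in> L2" and \<delta>: "\<delta> > 0" and t: "t > 0"
  obtains w where "w \<in> L2"
    "\<And>M q. q \<in> HP M \<Longrightarrow> 0 \<le> eform \<delta> M w q - (\<integral>x. F x * q x \<partial>gauss) +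
       t * (\<integral>x. sgn (w x) * q x + indicator {0} (w x) * \<bar>q x\<bar> \<partial>gauss)"
proof -
  define S where "S = {obst F \<delta> t N p | N p. p \<in> HP N}"
  have bdd: "bdd_below S"
    unfolding S_def by (rule bdd_belowI[of _ "- ((nrm F)\<^sup>2 / (2 * \<delta>))"]) (use obst_lower_bound[OF F \<delta> t] in auto)
  define m where "m = Inf S"
  have m_le: "m \<le> obst F \<delta> t N p" if "p \<in> HP N" for N p
    unfolding m_def using that by (intro cInf_lower bdd) (auto simp: S_def)
  have "\<exists>N p. p \<in> HP N \<and> obst F \<delta> t N p < m + inverse (real (Suc k))" for k
  proof -
    have "S \<noteq> {}"
      by (auto simp: S_def HP_def)
    then have "\<exists>s\<in>S. s < m + inverse (real (Suc k))"
      by (intro cInf_lessD) (auto simp: m_def)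
    then show ?thesis
      unfolding S_def by blast
  qed
  then obtain N p where p: "\<And>k. p k \<in> HP (N k)" and p_less: "\<And>k. obst F \<delta> t (N k) (p k) < m + inverse (real (Suc k))"
    by metis
  have pL2: "p k \<in> L2" for k
    using p HP_L2 by blast
  have obst_K: "obst F \<delta> t K (p k) = obst F \<delta> t (N k) (p k)" if "N k \<le> K" for K k
    unfolding obst_def using eform_le[OF disjI1[OF p] that] by simp
  \<comment> \<open>The midpoint has energy at least \<open>m\<close>, and both ends exceed
    \<open>m\<close> by less than 1 / (min k l + 1), so strong convexity bounds their
    distance.\<close>
  have dist: "\<delta> * (nrm (\<lambda>x. p k x - p l x))\<^sup>2 / 8 \<le> inverse (real (Suc (min k l)))" for k l
  proof -
    let ?K = "max (N k) (N l)"
    have K: "p k \<in> HP ?K" "p l \<in> HP ?K"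
      using p[of k] p[of l] HP_mono[of "N k" ?K] HP_mono[of "N l" ?K] by auto
    have "m \<le> obst F \<delta> t ?K (\<lambda>x. 1/2 * (p k x + p l x))"
      by (intro m_le HP_cmult HP_add K)
    moreover have "obst F \<delta> t ?K (p k) < m + inverse (real (Suc k))" "obst F \<delta> t ?K (p l) < m + inverse (real (Suc l))"
      using p_less[of k] p_less[of l] obst_K[of k ?K] obst_K[of l ?K] by auto
    moreover have "inverse (real (Suc k)) \<le> inverse (real (Suc (min k l)))"
      "inverse (real (Suc l)) \<le> inverse (real (Suc (min k l)))"
      by (auto intro!: le_imp_inverse_le)
    ultimately show ?thesis
      using obst_midpoint[OF F t K, of \<delta>] by argo
  qed
  obtain w where w: "L2_tendsto p w"
  proof (rule L2_complete[of p])
    fix e :: real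
    assume "e > 0"
    then obtain n where n: "inverse (real (Suc n)) < \<delta> * e\<^sup>2 / 8"
      using reals_Archimedean[of "\<delta> * e\<^sup>2 / 8"] \<delta> by auto
    have "nrm (\<lambda>x. p k x - p l x) < e" if "k \<ge> n" "l \<ge> n" for k l
    proof (rule power2_less_imp_less)
      have "inverse (real (Suc (min k l))) \<le> inverse (real (Suc n))"
        using that by (auto intro!: le_imp_inverse_le)
      then have "\<delta> * (nrm (\<lambda>x. p k x - p l x))\<^sup>2 < \<delta> * e\<^sup>2"
        using dist[of k l] n by linarith
      then show "(nrm (\<lambda>x. p k x - p l x))\<^sup>2 < e\<^sup>2"
        using \<delta> by simp
    qed (use \<open>e > 0\<close> in simp)
    then show "\<exists>N. \<forall>m\<ge>N. \<forall>n\<ge>N. nrm (\<lambda>x. p m x - p n x) < e"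
      by blast
  qed (use pL2 in auto)
  have wL2: "w \<in> L2"
    using w by (simp add: L2_tendsto_def)
  \<comment> \<open>At a fixed step \<open>s\<close> the energy of \<open>p k\<close> cancels up to
    the minimisation error \<open>inverse (real (Suc k))\<close>, and the rest is continuous in
    \<open>p k\<close>. The limit in \<open>k\<close> precedes the division by the step.\<close>
  have *: "0 \<le> s * eform \<delta> M w q + s\<^sup>2 * eform \<delta> M q q / 2 - s * (\<integral>x. F x * q x \<partial>gauss) +
      t * ((\<integral>x. \<bar>w x + q x * s\<bar> \<partial>gauss) - (\<integral>x. \<bar>w x\<bar> \<partial>gauss))" if q: "q \<in> HP M" for M q s
  proof -
    have qL2: "q \<in> L2"
      using q by (rule HP_L2)
    let ?R = "\<lambda>k. inverse (real (Suc k)) + s * eform \<delta> M (p k) q + s\<^sup>2 * eform \<delta> M q q / 2 - s * (\<integral>x. F x * q x \<partial>gauss) +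
      t * ((\<integral>x. \<bar>p k x + q x * s\<bar> * 1 \<partial>gauss) - (\<integral>x. \<bar>p k x\<bar> * 1 \<partial>gauss))"
    have "0 \<le> ?R k" for k
    proof -
      let ?K = "max (N k) M"
      have K: "p k \<in> HP ?K" "q \<in> HP ?K"
        using p[of k] q HP_mono[of "N k" ?K] HP_mono[of M ?K] by auto
      have "m \<le> obst F \<delta> t ?K (\<lambda>x. p k x + s * q x)"
        by (intro m_le HP_add HP_cmult K)
      also have "\<dots> = obst F \<delta> t ?K (p k) + s * eform \<delta> ?K (p k) q + s\<^sup>2 * eform \<delta> ?K q q / 2
          - s * (\<integral>x. F x * q x \<partial>gauss) + t * ((\<integral>x. \<bar>p k x + q x * s\<bar> \<partial>gauss) - (\<integral>x. \<bar>p k x\<bar> \<partial>gauss))"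
      proof -
        have "(\<integral>x. F x * (p k x + s * q x) \<partial>gauss) = (\<integral>x. F x * p k x + s * (F x * q x) \<partial>gauss)"
          by (simp add: algebra_simps)
        also have "\<dots> = (\<integral>x. F x * p k x \<partial>gauss) + s * (\<integral>x. F x * q x \<partial>gauss)"
          using L2_integrable_mult[OF F pL2[of k]] L2_integrable_mult[OF F qL2] by simp
        finally show ?thesis
          unfolding obst_def eform_add_cmult[OF pL2 qL2] by (simp add: field_simps)
      qed
      also have "eform \<delta> ?K (p k) q = eform \<delta> M (p k) q"
        using q by (intro eform_le) auto
      also have "eform \<delta> ?K q q = eform \<delta> M q q"
        using q by (intro eform_le) auto
      finally show ?thesis
        using p_less[of k] obst_K[of k ?K] by simp
    qed
    moreover have "?R \<longlonglongrightarrow> 0 + s * eform \<delta> M w q + s\<^sup>2 * eform \<delta> M q q / 2 - s * (\<integral>x. F x * q x \<partial>gauss) +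
      t * ((\<integral>x. \<bar>w x + q x * s\<bar> * 1 \<partial>gauss) - (\<integral>x. \<bar>w x\<bar> * 1 \<partial>gauss))"
    proof (intro tendsto_intros LIMSEQ_inverse_real_of_nat)
      show "(\<lambda>k. eform \<delta> M (p k) q) \<longlonglongrightarrow> eform \<delta> M w q"
        unfolding eform_def by (intro tendsto_intros hcoef_tendsto[OF w]) auto
      show "(\<lambda>k. \<integral>x. \<bar>p k x\<bar> * 1 \<partial>gauss) \<longlonglongrightarrow> (\<integral>x. \<bar>w x\<bar> * 1 \<partial>gauss)"
        by (intro L2_tendsto_inner_const L2_tendsto_abs w) simp
      have "(\<lambda>x. q x * s) \<in> L2"
        using L2_cmult[OF qL2, of s] by (simp add: mult.commute)
      then show "(\<lambda>k. \<integral>x. \<bar>p k x + q x * s\<bar> * 1 \<partial>gauss) \<longlonglongrightarrow> (\<integral>x. \<bar>w x + q x * s\<bar> * 1 \<partial>gauss)"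
        by (intro L2_tendsto_inner_const L2_tendsto_abs L2_tendsto_add w L2_tendsto_const) auto
    qed
    ultimately show ?thesis
      by (intro LIMSEQ_le_const[where X = ?R]) auto
  qed
  have "0 \<le> eform \<delta> M w q - (\<integral>x. F x * q x \<partial>gauss) +
       t * (\<integral>x. sgn (w x) * q x + indicator {0} (w x) * \<bar>q x\<bar> \<partial>gauss)" if q: "q \<in> HP M" for M q
  proof -
    have qL2: "q \<in> L2"
      using q by (rule HP_L2)
    have [measurable]: "w \<in> borel_measurable borel" "q \<in> borel_measurable borel"
      using wL2 qL2 by auto
    let ?i = "\<lambda>n. inverse (real (Suc n))"
    let ?Q = "\<lambda>n. \<integral>x. (\<bar>w x + q x * ?i n\<bar> - \<bar>w x\<bar>) * real (Suc n) \<partial>gauss"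
    have Qlim: "?Q \<longlonglongrightarrow> (\<integral>x. sgn (w x) * q x + indicator {0} (w x) * \<bar>q x\<bar> \<partial>gauss)"
    proof (rule integral_dominated_convergence[where w = "\<lambda>x. \<bar>q x\<bar>"])
      show "integrable gauss (\<lambda>x. \<bar>q x\<bar>)"
        using L2_integrable[OF qL2] by simp
      show "AE x in gauss. (\<lambda>n. (\<bar>w x + q x * ?i n\<bar> - \<bar>w x\<bar>) * real (Suc n)) \<longlonglongrightarrow>
          sgn (w x) * q x + indicator {0} (w x) * \<bar>q x\<bar>"
        by (intro AE_I2 tendsto_abs_difference_quotient)
      show "AE x in gauss. norm ((\<bar>w x + q x * ?i n\<bar> - \<bar>w x\<bar>) * real (Suc n)) \<le> \<bar>q x\<bar>" for n
      proof (rule AE_I2)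
        fix x
        have "norm ((\<bar>w x + q x * ?i n\<bar> - \<bar>w x\<bar>) * real (Suc n)) \<le> \<bar>q x * ?i n\<bar> * real (Suc n)"
          unfolding real_norm_def abs_mult[of _ "real (Suc n)"] by (intro mult_mono) auto
        also have "\<dots> = \<bar>q x\<bar>"
          by (simp add: abs_mult del: of_nat_Suc)
        finally show "norm ((\<bar>w x + q x * ?i n\<bar> - \<bar>w x\<bar>) * real (Suc n)) \<le> \<bar>q x\<bar>" .
      qed
    qed measurable
    let ?R = "\<lambda>n. eform \<delta> M w q + ?i n * eform \<delta> M q q / 2 - (\<integral>x. F x * q x \<partial>gauss) + t * ?Q n"
    have "0 \<le> ?R n" for n
    proof -
      have int: "integrable gauss (\<lambda>x. \<bar>w x + q x * ?i n\<bar>)" "integrable gauss (\<lambda>x. \<bar>w x\<bar>)"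
        using L2_add[OF wL2 L2_cmult[OF qL2, of "?i n"]] L2_integrable[OF wL2]
        by (auto simp: mult.commute dest: L2_integrable)
      have Q: "?Q n = ((\<integral>x. \<bar>w x + q x * ?i n\<bar> \<partial>gauss) - (\<integral>x. \<bar>w x\<bar> \<partial>gauss)) * real (Suc n)"
        using int by simp
      have i: "?i n * real (Suc n) = 1"
        by simp
      have distr: "(i * a + i * i * b / 2 - i * c + t * d) * r =
          (i * r) * a + i * (i * r) * b / 2 - (i * r) * c + t * (d * r)" for i r a b c d :: real
        by (simp add: algebra_simps)
      have "0 \<le> (?i n * eform \<delta> M w q + (?i n)\<^sup>2 * eform \<delta> M q q / 2 - ?i n * (\<integral>x. F x * q x \<partial>gauss) +
          t * ((\<integral>x. \<bar>w x + q x * ?i n\<bar> \<partial>gauss) - (\<integral>x. \<bar>w x\<bar> \<partial>gauss))) * real (Suc n)"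
        using *[OF q, of "?i n"] by (intro mult_nonneg_nonneg) auto
      also have "\<dots> = (?i n * real (Suc n)) * eform \<delta> M w q + ?i n * (?i n * real (Suc n)) * eform \<delta> M q q / 2
          - (?i n * real (Suc n)) * (\<integral>x. F x * q x \<partial>gauss) +
          t * (((\<integral>x. \<bar>w x + q x * ?i n\<bar> \<partial>gauss) - (\<integral>x. \<bar>w x\<bar> \<partial>gauss)) * real (Suc n))"
        unfolding power2_eq_square by (rule distr)
      also have "\<dots> = ?R n"
        unfolding i Q by simp
      finally show ?thesis .
    qed
    moreover have "?R \<longlonglongrightarrow> eform \<delta> M w q + 0 * eform \<delta> M q q / 2 - (\<integral>x. F x * q x \<partial>gauss) +
       t * (\<integral>x. sgn (w x) * q x + indicator {0} (w x) * \<bar>q x\<bar> \<partial>gauss)"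
      by (intro tendsto_intros LIMSEQ_inverse_real_of_nat Qlim) auto
    ultimately show ?thesis
      by (intro LIMSEQ_le_const[where X = ?R]) auto
  qed
  with wL2 show ?thesis
    using that by blast
qed

lemma L2_sgn: "w \<in> L2 \<Longrightarrow> (\<lambda>x. sgn (w x)) \<in> L2"
  by (intro L2_bounded[where B = 1]) (auto simp: sgn_if)

text \<open>By the variational inequality, the residual of the equation after subtracting
  \<open>t\<close> times the sign of \<open>w\<close> is a functional bounded by \<open>t\<close>
  times the L1 norm on {w = 0}. Hence it is a function \<open>g0\<close> with |g0| <= t there and 0
  elsewhere, and \<open>g\<close> adds the sign term back.\<close>

lemma obstacle_problem:
  fixes F :: "real ^ 'n::finite \<Rightarrow> real"
  assumes F: "F \<in> L2" and \<delta>: "\<delta> > 0" and t: "t > 0"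
  obtains w g where "w \<in> L2" "g \<in> L2"
    "\<And>\<alpha>. (real (deg \<alpha>) + \<delta>) * hcoef w \<alpha> = hcoef F \<alpha> - hcoef g \<alpha>"
    "AE x in gauss. \<bar>g x\<bar> \<le> t \<and> (w x \<noteq> 0 \<longrightarrow> g x = t * sgn (w x))"
proof -
  obtain w where w: "w \<in> L2" and vi: "\<And>M q. q \<in> HP M \<Longrightarrow> 0 \<le> eform \<delta> M w q - (\<integral>x. F x * q x \<partial>gauss) +
       t * (\<integral>x. sgn (w x) * q x + indicator {0} (w x) * \<bar>q x\<bar> \<partial>gauss)"
    using obstacle_variational_inequality[OF F \<delta> t] by blast
  have [measurable]: "w \<in> borel_measurable borel"
    using w by auto
  let ?sg = "\<lambda>x. sgn (w x)" and ?z = "\<lambda>x. indicator {0} (w x) :: real"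
  have zL2: "(\<lambda>x. ?z x * q x) \<in> L2" if "q \<in> L2" for q
    using that by (intro L2_bounded_mult[where B = 1]) (auto simp: indicator_def)
  define l where "l \<alpha> = hcoef F \<alpha> - (real (deg \<alpha>) + \<delta>) * hcoef w \<alpha> - t * hcoef ?sg \<alpha>" for \<alpha>
  have l_le: "(\<Sum>\<alpha>\<in>degs M. l \<alpha> * b \<alpha> / mfact \<alpha>) \<le> t * (\<integral>x. ?z x * \<bar>hpoly M b x\<bar> \<partial>gauss)" for M b
  proof -
    have "(\<integral>x. ?sg x * hpoly M b x + ?z x * \<bar>hpoly M b x\<bar> \<partial>gauss) =
      (\<Sum>\<alpha>\<in>degs M. hcoef ?sg \<alpha> * b \<alpha> / mfact \<alpha>) + (\<integral>x. ?z x * \<bar>hpoly M b x\<bar> \<partial>gauss)"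
      using L2_integrable[OF zL2[OF L2_abs[OF hpoly_L2]]] L2_integrable_mult[OF L2_sgn[OF w] hpoly_L2]
      by (simp add: inner_hpoly[OF L2_sgn[OF w]])
    moreover have "eform \<delta> M w (hpoly M b) = (\<Sum>\<alpha>\<in>degs M. (real (deg \<alpha>) + \<delta>) * hcoef w \<alpha> * b \<alpha> / mfact \<alpha>)"
      unfolding eform_def by (intro sum.cong) (auto simp: hcoef_hpoly degs_def)
    moreover have "(\<Sum>\<alpha>\<in>degs M. l \<alpha> * b \<alpha> / mfact \<alpha>) = (\<Sum>\<alpha>\<in>degs M. hcoef F \<alpha> * b \<alpha> / mfact \<alpha>) -
        (\<Sum>\<alpha>\<in>degs M. (real (deg \<alpha>) + \<delta>) * hcoef w \<alpha> * b \<alpha> / mfact \<alpha>) - t * (\<Sum>\<alpha>\<in>degs M. hcoef ?sg \<alpha> * b \<alpha> / mfact \<alpha>)"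
      by (simp add: l_def left_diff_distrib diff_divide_distrib sum_subtractf sum_distrib_left mult.assoc)
    ultimately show ?thesis
      using vi[of "hpoly M b" M] by (simp add: HP_def inner_hpoly[OF F] distrib_left)
  qed
  \<comment> \<open>The residual is tested against the polynomial with its own coefficients: the
    square norm of that polynomial is at most \<open>t\<close> times its norm. This bound makes
    \<open>l\<close> the coefficients of a function.\<close>
  have "(\<Sum>\<alpha>\<in>degs M. (l \<alpha>)\<^sup>2 / mfact \<alpha>) \<le> t\<^sup>2" for M
  proof -
    let ?q = "hpoly M l"
    have "(nrm ?q)\<^sup>2 = (\<Sum>\<alpha>\<in>degs M. l \<alpha> * l \<alpha> / mfact \<alpha>)"
      unfolding nrm_hpoly by (simp add: power2_eq_square)
    also have "\<dots> \<le> t * (\<integral>x. ?z x * \<bar>?q x\<bar> \<partial>gauss)"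
      by (rule l_le)
    also have "\<dots> \<le> t * (\<integral>x. \<bar>?q x\<bar> \<partial>gauss)"
      using t by (intro mult_left_mono integral_mono L2_integrable zL2 L2_abs hpoly_L2) (auto simp: indicator_def)
    also have "\<dots> \<le> t * nrm ?q"
      using t by (intro mult_left_mono L1_le_nrm hpoly_L2) auto
    finally have "nrm ?q * nrm ?q \<le> t * nrm ?q"
      by (simp add: power2_eq_square)
    then have "nrm ?q \<le> t"
      using t nrm_nonneg[of ?q] by (cases "nrm ?q = 0") (auto simp: less_le)
    then show ?thesis
      unfolding nrm_hpoly[symmetric] by (intro power_mono) auto
  qed
  then obtain g0 where g0: "g0 \<in> L2" and coef: "hcoef g0 = l"
    by (rule Riesz_Fischer)
  have [measurable]: "g0 \<in> borel_measurable borel"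
    using g0 by auto
  \<comment> \<open>Polynomials are dense and both sides are continuous in norm, so the inequality
    extends to discontinuous test functions.\<close>
  have g0_le: "(\<integral>x. g0 x * \<phi> x \<partial>gauss) \<le> t * (\<integral>x. ?z x * \<bar>\<phi> x\<bar> \<partial>gauss)" if \<phi>: "\<phi> \<in> L2" for \<phi>
  proof -
    let ?p = "\<lambda>N. hpoly N (hcoef \<phi>)"
    have "(\<lambda>N. \<integral>x. ?p N x * g0 x \<partial>gauss) \<longlonglongrightarrow> (\<integral>x. \<phi> x * g0 x \<partial>gauss)"
      by (intro L2_tendsto_inner_const L2_tendsto_hpoly \<phi> g0)
    moreover have "(\<lambda>N. t * (\<integral>x. \<bar>?p N x\<bar> * ?z x \<partial>gauss)) \<longlonglongrightarrow> t * (\<integral>x. \<bar>\<phi> x\<bar> * ?z x \<partial>gauss)"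
      using zL2[of "\<lambda>_. 1"] by (intro tendsto_mult_left L2_tendsto_inner_const L2_tendsto_abs L2_tendsto_hpoly \<phi>) auto
    moreover have "(\<integral>x. ?p N x * g0 x \<partial>gauss) \<le> t * (\<integral>x. \<bar>?p N x\<bar> * ?z x \<partial>gauss)" for N
      using l_le[where M = N and b = "hcoef \<phi>"] inner_hpoly[OF g0, of N "hcoef \<phi>"] unfolding coef by (simp add: mult.commute)
    ultimately have "(\<integral>x. \<phi> x * g0 x \<partial>gauss) \<le> t * (\<integral>x. \<bar>\<phi> x\<bar> * ?z x \<partial>gauss)"
      by (intro LIMSEQ_le) auto
    then show ?thesis
      by (simp add: mult.commute)
  qed
  \<comment> \<open>The test function is the sign of \<open>g0\<close> on the set where the desired
    bound fails; the excess \<open>?D\<close> then has integral at most 0.\<close>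
  let ?B = "{x. \<bar>g0 x\<bar> > t * ?z x}"
  have [measurable]: "?B \<in> sets borel"
    by measurable
  let ?\<phi> = "\<lambda>x. indicator ?B x * sgn (g0 x)"
  have \<phi>L2: "?\<phi> \<in> L2"
    by (intro L2_bounded[where B = 1]) (auto simp: indicator_def sgn_if)
  let ?D = "\<lambda>x. indicator ?B x * (\<bar>g0 x\<bar> - t * ?z x)"
  have Dnn: "?D x \<ge> 0" for x
    by (auto simp: indicator_def)
  have D_eq: "?D x = g0 x * ?\<phi> x - t * (?z x * \<bar>?\<phi> x\<bar>)" for x
    using t by (auto simp: indicator_def sgn_if abs_if)
  have int: "integrable gauss (\<lambda>x. g0 x * ?\<phi> x)" "integrable gauss (\<lambda>x. t * (?z x * \<bar>?\<phi> x\<bar>))"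
    using L2_integrable_mult[OF g0 \<phi>L2] L2_integrable[OF L2_cmult[OF zL2[OF L2_abs[OF \<phi>L2]]]] by auto
  have "(\<integral>x. ?D x \<partial>gauss) \<le> 0"
    unfolding D_eq using g0_le[OF \<phi>L2] int by simp
  moreover have "(\<integral>x. ?D x \<partial>gauss) \<ge> 0"
    by (intro Bochner_Integration.integral_nonneg Dnn)
  moreover have "integrable gauss ?D"
    unfolding D_eq by (intro Bochner_Integration.integrable_diff int)
  ultimately have "AE x in gauss. ?D x = 0"
    using integral_nonneg_eq_0_iff_AE[of gauss ?D] Dnn by auto
  then have g0_bound: "AE x in gauss. \<bar>g0 x\<bar> \<le> t * ?z x"
    by eventually_elim (auto simp: indicator_def split: if_splits)
  define g where "g x = g0 x + t * ?sg x" for x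
  have gL2: "g \<in> L2"
    unfolding g_def by (intro L2_add g0 L2_cmult L2_sgn w)
  have "hcoef g \<alpha> = l \<alpha> + t * hcoef ?sg \<alpha>" for \<alpha>
    unfolding g_def coef[symmetric] hcoef_cmult[symmetric] by (intro hcoef_add g0 L2_cmult L2_sgn w)
  then have "(real (deg \<alpha>) + \<delta>) * hcoef w \<alpha> = hcoef F \<alpha> - hcoef g \<alpha>" for \<alpha>
    by (simp add: l_def)
  moreover have "AE x in gauss. \<bar>g x\<bar> \<le> t \<and> (w x \<noteq> 0 \<longrightarrow> g x = t * sgn (w x))"
    using g0_bound
  proof eventually_elim
    case (elim x)
    then show ?case
      using t by (cases "w x = 0") (auto simp: g_def sgn_if)
  qed
  ultimately show ?thesis
    using that[OF w gL2] by blast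
qed

section \<open>The weak-type estimate for Hermite Hessians\<close>

text \<open>For polynomials \<open>p\<close> this is \<open>\<Sum>i. E (\<psi>'(p) (\<partial>\<^sub>i p)\<^sup>2) \<ge> 0\<close> after an integration by parts.\<close>
lemma inner_sarctan_nonneg:
  assumes w: "w \<in> L2" and k: "k \<in> L2" and coef: "\<And>\<alpha>. hcoef k \<alpha> = real (deg \<alpha>) * hcoef w \<alpha>"
    and "m \<ge> 0"
  shows "0 \<le> (\<integral>x. sarctan m (w x) * k x \<partial>gauss)"
proof -
  let ?p = "\<lambda>N. hpoly (Suc N) (hcoef w)" and ?d = "\<lambda>N i. hpoly N (\<lambda>\<beta>. hcoef w (up i \<beta>))"
  have [measurable]: "w \<in> borel_measurable borel"
    using w by auto
  \<comment> \<open>\<open>hpoly (Suc N) (hcoef k)\<close> is the Ornstein-Uhlenbeck operator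
    applied to \<open>?p N\<close>, and \<open>sum_up_mfact\<close> carries out the integration by
    parts on coefficients.\<close>
  have pos: "0 \<le> (\<integral>x. sarctan m (?p N x) * hpoly (Suc N) (hcoef k) x \<partial>gauss)" for N
  proof -
    let ?s = "\<lambda>x. sarctan m (?p N x)"
    have s: "?s \<in> L2"
      by (intro exp_growth_L2 exp_growth_sarctan exp_growth_hpoly)
    have "(\<integral>x. (m / (1 + (m * ?p N x)\<^sup>2) * ?d N i x) * ?d N i x \<partial>gauss) =
        (\<Sum>\<beta>\<in>degs N. (hcoef ?s (up i \<beta>) * hcoef w (up i \<beta>)) / mfact \<beta>)" for i
    proof -
      have L2: "(\<lambda>x. m / (1 + (m * ?p N x)\<^sup>2) * ?d N i x) \<in> L2"
        by (intro exp_growth_L2 exp_growth_mult exp_growth_sarctan exp_growth_hpoly)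
      have "hcoef (\<lambda>x. m / (1 + (m * ?p N x)\<^sup>2) * ?d N i x) \<beta> = hcoef ?s (up i \<beta>)" for \<beta>
        unfolding hcoef_def by (intro sarctan_ibp has_partial_hpoly) auto
      then show ?thesis
        unfolding inner_hpoly[OF L2] by (simp only:)
    qed
    then have "(\<Sum>i\<in>UNIV. \<integral>x. (m / (1 + (m * ?p N x)\<^sup>2) * ?d N i x) * ?d N i x \<partial>gauss) =
        (\<Sum>i\<in>UNIV. \<Sum>\<beta>\<in>degs N. (hcoef ?s (up i \<beta>) * hcoef w (up i \<beta>)) / mfact \<beta>)"
      by (simp only:)
    also have "\<dots> = (\<Sum>\<alpha>\<in>degs (Suc N). real (deg \<alpha>) * (hcoef ?s \<alpha> * hcoef w \<alpha>) / mfact \<alpha>)"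
      by (rule sum_up_mfact[where X = "\<lambda>\<alpha>. hcoef ?s \<alpha> * hcoef w \<alpha>"])
    also have "\<dots> = (\<integral>x. ?s x * hpoly (Suc N) (hcoef k) x \<partial>gauss)"
      unfolding inner_hpoly[OF s] coef by (simp add: mult_ac)
    finally have eq: "(\<integral>x. ?s x * hpoly (Suc N) (hcoef k) x \<partial>gauss) =
      (\<Sum>i\<in>UNIV. \<integral>x. (m / (1 + (m * ?p N x)\<^sup>2) * ?d N i x) * ?d N i x \<partial>gauss)" ..
    have "0 \<le> (m / (1 + (m * y)\<^sup>2) * z) * z" for y z
      unfolding mult.assoc using \<open>m \<ge> 0\<close>
      by (intro mult_nonneg_nonneg[OF _ zero_le_square] divide_nonneg_nonneg) auto
    then show ?thesis
      unfolding eq by (intro sum_nonneg Bochner_Integration.integral_nonneg)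
  qed
  have lim: "L2_tendsto ?p w" "L2_tendsto (\<lambda>N. hpoly (Suc N) (hcoef k)) k"
    using L2_tendsto_subseq[OF L2_tendsto_hpoly[OF w], of Suc] L2_tendsto_subseq[OF L2_tendsto_hpoly[OF k], of Suc]
    by (simp_all add: strict_mono_def)
  obtain r where r: "strict_mono r" "AE x in gauss. (\<lambda>n. ?p (r n) x) \<longlonglongrightarrow> w x"
    using L2_tendsto_AE_subseq[OF lim(1)] .
  have "L2_tendsto (\<lambda>n x. sarctan m (?p (r n) x) * 1) (\<lambda>x. sarctan m (w x) * 1)"
  proof (rule L2_tendsto_bounded_mult[where B = "pi / 2"])
    show "AE x in gauss. (\<lambda>n. sarctan m (?p (r n) x)) \<longlonglongrightarrow> sarctan m (w x)"
      using r(2) unfolding sarctan_def by eventually_elim (intro tendsto_intros)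
  qed (use sarctan_bounded in \<open>auto intro: L2_tendsto_const\<close>)
  from L2_tendsto_inner[OF this L2_tendsto_subseq[OF lim(2) r(1)]]
  have "(\<lambda>n. \<integral>x. sarctan m (?p (r n) x) * hpoly (Suc (r n)) (hcoef k) x \<partial>gauss) \<longlonglongrightarrow>
      (\<integral>x. sarctan m (w x) * k x \<partial>gauss)"
    by simp
  then show ?thesis
    by (rule LIMSEQ_le_const) (use pos in blast)
qed

text \<open>The sign is too rough to be tested directly. The functions
  \<open>sarctan (real n) (w x)\<close> tend boundedly to \<open>pi / 2 * sgn (w x)\<close>, with
  the right value 0 where \<open>w x = 0\<close>.\<close>

lemma inner_sgn_nonneg:
  assumes w[measurable]: "w \<in> L2" and h[measurable]: "h \<in> L2"
    and pos: "\<And>m. m \<ge> 0 \<Longrightarrow> 0 \<le> (\<integral>x. sarctan m (w x) * h x \<partial>gauss)"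
  shows "0 \<le> (\<integral>x. sgn (w x) * h x \<partial>gauss)"
proof -
  have "L2_tendsto (\<lambda>n x. sarctan (real n) (w x) * h x) (\<lambda>x. pi / 2 * sgn (w x) * h x)"
  proof (rule L2_tendsto_bounded_mult[where B = "pi / 2"])
    show "AE x in gauss. (\<lambda>n. sarctan (real n) (w x)) \<longlonglongrightarrow> pi / 2 * sgn (w x)"
    proof (rule AE_I2)
      fix x
      consider "w x = 0" | "w x > 0" | "w x < 0"
        by linarith
      then show "(\<lambda>n. sarctan (real n) (w x)) \<longlonglongrightarrow> pi / 2 * sgn (w x)"
      proof cases
        case 1
        then show ?thesis
          by (simp add: sarctan_def)
      next
        case 2
        have "filterlim (\<lambda>n. real n * w x) at_top sequentially"
          using 2 by (intro filterlim_at_top_mult_tendsto_pos[OF tendsto_const] filterlim_real_sequentially)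
        then have "(\<lambda>n. arctan (real n * w x)) \<longlonglongrightarrow> pi / 2"
          by (rule filterlim_compose[OF tendsto_arctan_at_top])
        then show ?thesis
          using 2 by (simp add: sarctan_def)
      next
        case 3
        have "filterlim (\<lambda>n. real n * - w x) at_top sequentially"
          using 3 by (intro filterlim_at_top_mult_tendsto_pos[OF tendsto_const] filterlim_real_sequentially) auto
        then have "(\<lambda>n. arctan (real n * - w x)) \<longlonglongrightarrow> pi / 2"
          by (rule filterlim_compose[OF tendsto_arctan_at_top])
        from tendsto_minus[OF this] show ?thesis
          using 3 by (simp add: sarctan_def arctan_minus)
      qed
    qed
    show "\<bar>pi / 2 * sgn (w x)\<bar> \<le> pi / 2" for x
      by (simp add: sgn_if)
  qed (use sarctan_bounded h in \<open>auto intro: L2_tendsto_const\<close>)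
  from L2_tendsto_inner_const[OF this, of "\<lambda>_. 1"]
  have "(\<lambda>n. \<integral>x. sarctan (real n) (w x) * h x \<partial>gauss) \<longlonglongrightarrow> (\<integral>x. pi / 2 * sgn (w x) * h x \<partial>gauss)"
    by simp
  then have "0 \<le> (\<integral>x. pi / 2 * sgn (w x) * h x \<partial>gauss)"
    by (rule LIMSEQ_le_const) (use pos in auto)
  also have "(\<integral>x. pi / 2 * sgn (w x) * h x \<partial>gauss) = pi / 2 * (\<integral>x. sgn (w x) * h x \<partial>gauss)"
    unfolding integral_mult_right_zero[symmetric] by (simp only: mult.assoc)
  finally show ?thesis
    using pi_gt_zero by (simp add: zero_le_mult_iff)
qed

lemma nrm_mono_hcoef:
  assumes f: "f \<in> L2" and g: "g \<in> L2" and le: "\<And>\<alpha>. \<bar>hcoef f \<alpha>\<bar> \<le> \<bar>hcoef g \<alpha>\<bar>"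
  shows "(nrm f)\<^sup>2 \<le> (nrm g)\<^sup>2"
proof (rule LIMSEQ_le[OF Parseval[OF f] Parseval[OF g]])
  show "\<exists>N. \<forall>n\<ge>N. (\<Sum>\<alpha>\<in>degs n. (hcoef f \<alpha>)\<^sup>2 / mfact \<alpha>) \<le> (\<Sum>\<alpha>\<in>degs n. (hcoef g \<alpha>)\<^sup>2 / mfact \<alpha>)"
    using le by (intro exI allI impI sum_mono divide_right_mono) (auto simp: abs_le_square_iff)
qed

lemma hs_norm_square: "(hs_norm A)\<^sup>2 = (\<Sum>i\<in>UNIV. \<Sum>j\<in>UNIV. (A $ i $ j)\<^sup>2)"
  unfolding hs_norm_def by (intro real_sqrt_pow2 sum_nonneg) simp

lemma borel_hs_norm [measurable]: "hs_norm \<in> borel_measurable borel"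
  unfolding hs_norm_eq_norm[abs_def] by measurable

lemma measure_hs_norm_le:
  fixes B :: "real ^ 'n::finite \<Rightarrow> real ^ 'n ^ 'n"
  assumes [measurable]: "B \<in> borel_measurable borel" and L2: "\<And>i j. (\<lambda>x. B x $ i $ j) \<in> L2" and t: "t > 0"
  shows "measure gauss {x. hs_norm (B x) > t} \<le> (\<Sum>i\<in>UNIV. \<Sum>j\<in>UNIV. (nrm (\<lambda>x. B x $ i $ j))\<^sup>2) / t\<^sup>2"
proof -
  have int: "integrable gauss (\<lambda>x. (hs_norm (B x))\<^sup>2)"
    unfolding hs_norm_square by (intro Bochner_Integration.integrable_sum L2_integrable_square L2)
  have "measure gauss {x. hs_norm (B x) > t} \<le> measure gauss {x \<in> space gauss. (hs_norm (B x))\<^sup>2 \<ge> t\<^sup>2}"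
    using t by (intro gauss.finite_measure_mono) (auto intro: power_mono)
  also have "\<dots> \<le> (\<integral>x. (hs_norm (B x))\<^sup>2 \<partial>gauss) / t\<^sup>2"
    using t by (intro integral_Markov_inequality_measure[OF int, where A = "{}"]) auto
  also have "(\<integral>x. (hs_norm (B x))\<^sup>2 \<partial>gauss) = (\<Sum>i\<in>UNIV. \<Sum>j\<in>UNIV. (nrm (\<lambda>x. B x $ i $ j))\<^sup>2)"
    unfolding hs_norm_square nrm_square
    by (subst Bochner_Integration.integral_sum; intro sum.cong refl Bochner_Integration.integral_sum
        Bochner_Integration.integrable_sum L2_integrable_square L2)+
  finally show ?thesis .
qed

text \<open>Second derivatives do not see degrees 0 and 1, because two raised indices have degree at
  least 2; equality of coefficients is asked from there on.\<close>

lemma hessian_coeffs_unique: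
  assumes "hessian_coeffs v A" "hessian_coeffs w B" "\<And>\<alpha>. deg \<alpha> \<ge> 2 \<Longrightarrow> hcoef v \<alpha> = hcoef w \<alpha>"
  shows "AE x in gauss. A x = B x"
proof -
  have "AE x in gauss. A x $ i $ j = B x $ i $ j" for i j
  proof (rule L2_eq_AE)
    fix \<beta>
    have "deg (up i (up j \<beta>)) \<ge> 2"
      by (simp only: deg_up)
    then show "hcoef (\<lambda>x. A x $ i $ j) \<beta> = hcoef (\<lambda>x. B x $ i $ j) \<beta>"
      using assms by (simp add: hessian_coeffs_def)
  qed (use assms in \<open>auto simp: hessian_coeffs_def\<close>)
  then have "AE x in gauss. \<forall>i j. A x $ i $ j = B x $ i $ j"
    unfolding AE_all_countable by blast
  then show ?thesis
    by eventually_elim (simp add: vec_eq_iff)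
qed

text \<open>The regularisation \<open>\<delta>\<close> makes the obstacle problem coercive; it is harmless since
  \<open>v = (\<N> + \<delta>)\<^sup>-\<^sup>1 (f + \<delta> v)\<close> up to constants. With \<open>w, g\<close> from the obstacle problem for \<open>f + \<delta> v\<close>,
  the Hessian of \<open>w\<close> vanishes where \<open>w = 0\<close>, and the Hessian of \<open>v - w = (\<N> + \<delta>)\<^sup>-\<^sup>1 g\<close> is bounded
  in \<open>L\<^sup>2\<close> by \<open>\<parallel>g\<parallel>\<^sub>2\<^sup>2 \<le> t \<parallel>g\<parallel>\<^sub>1\<close>.\<close>
lemma weak_type_regularised:
  fixes f :: "real ^ 'n::finite \<Rightarrow> real"
  assumes f: "f \<in> L2" and v: "v \<in> L2" and coef_v: "\<And>\<alpha>. hcoef v \<alpha> = hcoef f \<alpha> / real (deg \<alpha>)"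
    and A: "hessian_coeffs v A" "A \<in> borel_measurable borel"
    and \<delta>: "\<delta> > 0" and t: "t > 0"
  shows "measure gauss {x. hs_norm (A x) > t} \<le> 2 * (\<integral>x. \<bar>f x + \<delta> * v x\<bar> \<partial>gauss) / t"
proof -
  define F where "F x = f x + \<delta> * v x" for x
  have F: "F \<in> L2"
    unfolding F_def using f v by auto
  have coef_F: "hcoef F \<alpha> = hcoef f \<alpha> + \<delta> * hcoef v \<alpha>" for \<alpha>
    unfolding F_def hcoef_cmult[symmetric] by (intro hcoef_add f L2_cmult v)
  obtain w g where w: "w \<in> L2" and g: "g \<in> L2"
    and wg: "\<And>\<alpha>. (real (deg \<alpha>) + \<delta>) * hcoef w \<alpha> = hcoef F \<alpha> - hcoef g \<alpha>"
    and gt: "AE x in gauss. \<bar>g x\<bar> \<le> t \<and> (w x \<noteq> 0 \<longrightarrow> g x = t * sgn (w x))"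
    using obstacle_problem[OF F \<delta> t] by blast
  note [measurable] = L2_borel[OF F] L2_borel[OF w] L2_borel[OF g] L2_borel[OF f] L2_borel[OF v] A(2)
  \<comment> \<open>By the obstacle equation \<open>k\<close> is the Ornstein-Uhlenbeck operator
    applied to \<open>w\<close>; its square integrability gives \<open>w\<close> both orders of
    derivatives.\<close>
  define k where "k x = F x - g x - \<delta> * w x" for x
  have k: "k \<in> L2"
    unfolding k_def by (intro L2_diff L2_cmult F g w)
  have coef_k: "hcoef k \<alpha> = real (deg \<alpha>) * hcoef w \<alpha>" for \<alpha>
  proof -
    have "hcoef k \<alpha> = hcoef F \<alpha> - hcoef g \<alpha> - \<delta> * hcoef w \<alpha>"
      unfolding k_def hcoef_cmult[symmetric] using F g w by (simp add: hcoef_diff L2_diff L2_cmult)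
    then show ?thesis
      using wg[of \<alpha>] by (simp add: algebra_simps)
  qed
  obtain D where D: "\<And>i. gderiv i w (D i)"
    using ex_gderiv[OF w k coef_k] by blast
  obtain C where C: "hessian_coeffs w C"
    using ex_hessian_coeffs[OF k coef_k] by blast
  have zero: "AE x in gauss. w x = 0 \<longrightarrow> C x = 0 \<and> F x = g x"
    using hessian_coeffs_eq_0_on_zero_set[OF D C] OU_eq_derivatives[OF D C k coef_k]
    by eventually_elim (auto simp: k_def)
  define W where "W = {x. w x \<noteq> 0}"
  have [measurable]: "W \<in> sets borel"
    unfolding W_def by measurable
  \<comment> \<open>\<open>F - g\<close> equals \<open>k + \<delta> * w\<close>, and both terms pair
    nonnegatively with a nondecreasing odd function of \<open>w\<close>.\<close>
  have "0 \<le> (\<integral>x. sarctan m (w x) * (F x - g x) \<partial>gauss)" if "m \<ge> 0" for m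
  proof -
    have s: "(\<lambda>x. sarctan m (w x) * q x) \<in> L2" if "q \<in> L2" for q
      using that by (intro L2_bounded_mult[where B = "pi / 2"] sarctan_bounded) auto
    have "0 \<le> sarctan m y * y" for y
      using \<open>m \<ge> 0\<close> unfolding sarctan_def
      by (cases "y \<ge> 0") (auto intro: mult_nonneg_nonneg mult_nonpos_nonpos simp: mult_nonneg_nonpos)
    then have "0 \<le> (\<integral>x. sarctan m (w x) * w x \<partial>gauss)"
      by (intro Bochner_Integration.integral_nonneg)
    moreover have "(\<integral>x. sarctan m (w x) * (F x - g x) \<partial>gauss) =
        (\<integral>x. sarctan m (w x) * k x + \<delta> * (sarctan m (w x) * w x) \<partial>gauss)"
      by (simp add: k_def algebra_simps)
    ultimately show ?thesis
      using inner_sarctan_nonneg[OF w k coef_k \<open>m \<ge> 0\<close>] \<delta> L2_integrable[OF s[OF k]] L2_integrable[OF s[OF w]]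
      by (simp add: less_imp_le)
  qed
  from inner_sgn_nonneg[OF w L2_diff[OF F g] this]
  have sgn_le: "(\<integral>x. sgn (w x) * g x \<partial>gauss) \<le> (\<integral>x. sgn (w x) * F x \<partial>gauss)"
    using L2_integrable_mult[OF L2_sgn[OF w] F] L2_integrable_mult[OF L2_sgn[OF w] g]
    by (simp add: right_diff_distrib)
  have WF: "integrable gauss (\<lambda>x. indicator W x * \<bar>F x\<bar>)"
    by (intro L2_integrable L2_bounded_mult[where B = 1] L2_abs F) (auto simp: indicator_def)
  have gW: "t * measure gauss W = (\<integral>x. sgn (w x) * g x \<partial>gauss)"
  proof -
    have "t * measure gauss W = (\<integral>x. t * indicator W x \<partial>gauss)"
      by simp
    also have "\<dots> = (\<integral>x. sgn (w x) * g x \<partial>gauss)"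
      by (rule integral_cong_AE; (measurable)?)
        (use gt in \<open>eventually_elim, auto simp: W_def indicator_def sgn_if\<close>)
    finally show ?thesis .
  qed
  also have "\<dots> \<le> (\<integral>x. indicator W x * \<bar>F x\<bar> \<partial>gauss)"
    by (rule order_trans[OF sgn_le], intro integral_mono WF L2_integrable_mult L2_sgn w F)
      (auto simp: W_def indicator_def sgn_if)
  finally have W_le: "t * measure gauss W \<le> (\<integral>x. indicator W x * \<bar>F x\<bar> \<partial>gauss)" .
  have F1: "integrable gauss (\<lambda>x. \<bar>F x\<bar>)"
    by (intro integrable_abs L2_integrable F)
  have W_le': "t * measure gauss W \<le> (\<integral>x. \<bar>F x\<bar> \<partial>gauss)"
    by (rule order_trans[OF W_le], intro integral_mono WF F1) (auto simp: indicator_def)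
  \<comment> \<open>On \<open>W\<close> the absolute value of \<open>g\<close> is \<open>t\<close>,
    off \<open>W\<close> it is that of \<open>F\<close>; by \<open>W_le\<close> the replacement on
    \<open>W\<close> does not increase the integral.\<close>
  have gF: "(\<integral>x. \<bar>g x\<bar> \<partial>gauss) \<le> (\<integral>x. \<bar>F x\<bar> \<partial>gauss)"
  proof -
    have "(\<integral>x. \<bar>g x\<bar> \<partial>gauss) = (\<integral>x. t * indicator W x + (\<bar>F x\<bar> - indicator W x * \<bar>F x\<bar>) \<partial>gauss)"
      by (rule integral_cong_AE; (measurable)?)
        (use gt zero in \<open>eventually_elim, use t in \<open>auto simp: W_def indicator_def sgn_if\<close>\<close>)
    also have "\<dots> = t * measure gauss W + ((\<integral>x. \<bar>F x\<bar> \<partial>gauss) - (\<integral>x. indicator W x * \<bar>F x\<bar> \<partial>gauss))"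
    proof -
      have "integrable gauss (\<lambda>x. t * indicator W x :: real)"
        by (intro integrable_mult_right integrable_real_indicator) (auto simp: gauss.emeasure_finite less_top[symmetric])
      then show ?thesis
        using F1 WF by simp
    qed
    finally show ?thesis
      using W_le by linarith
  qed
  have g2: "(nrm g)\<^sup>2 \<le> t * (\<integral>x. \<bar>g x\<bar> \<partial>gauss)"
  proof -
    have "(nrm g)\<^sup>2 \<le> (\<integral>x. t * \<bar>g x\<bar> \<partial>gauss)"
      unfolding nrm_square
    proof (rule integral_mono_AE)
      show "AE x in gauss. (g x)\<^sup>2 \<le> t * \<bar>g x\<bar>"
        using gt
      proof eventually_elim
        case (elim x)
        then have "\<bar>g x\<bar> * \<bar>g x\<bar> \<le> t * \<bar>g x\<bar>"
          by (intro mult_right_mono) auto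
        then show ?case
          by (simp add: power2_eq_square)
      qed
    qed (intro L2_integrable_square g integrable_mult_right integrable_abs L2_integrable)+
    then show ?thesis
      by simp
  qed
  define u where "u x = v x - w x" for x
  \<comment> \<open>\<open>k'\<close> is the Ornstein-Uhlenbeck operator applied to
    \<open>u\<close>. The coefficient of \<open>f\<close> at index 0 is its mean, which must go
    because the range of the operator has no constant component.\<close>
  define k' where "k' x = f x - hcoef f (\<lambda>_. 0) - k x" for x
  have u: "u \<in> L2" and k': "k' \<in> L2"
    unfolding u_def k'_def by (intro L2_diff v w f k L2_const)+
  have coef_u: "hcoef u \<alpha> = hcoef v \<alpha> - hcoef w \<alpha>" for \<alpha>
    unfolding u_def by (rule hcoef_diff[OF v w])
  have coef_k': "hcoef k' \<alpha> = real (deg \<alpha>) * hcoef u \<alpha>" for \<alpha>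
  proof -
    have "hcoef k' \<alpha> = hcoef f \<alpha> - (if \<alpha> = (\<lambda>_. 0) then hcoef f (\<lambda>_. 0) else 0) - hcoef k \<alpha>"
      unfolding k'_def using f k by (simp add: hcoef_diff L2_diff hcoef_const)
    then show ?thesis
      unfolding coef_u coef_k coef_v by (cases "deg \<alpha> = 0") (auto simp: deg_eq_0_iff algebra_simps)
  qed
  \<comment> \<open>In degree n >= 1 the coefficients of \<open>k'\<close> and \<open>g\<close> are
    n and n + \<delta> times that of \<open>u\<close>.\<close>
  have "\<bar>hcoef k' \<alpha>\<bar> \<le> \<bar>hcoef g \<alpha>\<bar>" for \<alpha>
  proof (cases "deg \<alpha> = 0")
    case False
    let ?d = "real (deg \<alpha>)"
    have d: "?d > 0"
      using False by simp
    have "hcoef F \<alpha> = (?d + \<delta>) * hcoef v \<alpha>"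
      unfolding coef_F coef_v using False by (simp add: field_simps)
    then have g_eq: "hcoef g \<alpha> = (?d + \<delta>) * hcoef u \<alpha>"
      using wg[of \<alpha>] by (simp add: coef_u algebra_simps)
    show ?thesis
      unfolding coef_k' g_eq abs_mult using d \<delta> by (intro mult_right_mono) auto
  qed (simp add: coef_k')
  then have k'_le: "(nrm k')\<^sup>2 \<le> (nrm g)\<^sup>2"
    by (rule nrm_mono_hcoef[OF k' g])
  obtain B where B: "hessian_coeffs u B" and [measurable]: "B \<in> borel_measurable borel"
    and B_le: "(\<Sum>i\<in>UNIV. \<Sum>j\<in>UNIV. (nrm (\<lambda>x. B x $ i $ j))\<^sup>2) \<le> (nrm k')\<^sup>2"
    using ex_hessian_coeffs[OF k' coef_k'] by blast
  have "hessian_coeffs v (\<lambda>x. B x + C x)"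
    using B C by (simp add: hessian_coeffs_def L2_add hcoef_add coef_u)
  then have "AE x in gauss. A x = B x + C x"
    by (intro hessian_coeffs_unique[OF A(1)]) auto
  then have AW: "AE x in gauss. hs_norm (A x) > t \<longrightarrow> x \<in> W \<or> hs_norm (B x) > t"
    using zero by eventually_elim (auto simp: W_def)
  have "measure gauss {x. hs_norm (A x) > t} \<le> measure gauss (W \<union> {x. hs_norm (B x) > t})"
    using AW by (intro gauss.finite_measure_mono_AE) (auto elim: eventually_mono)
  also have "\<dots> \<le> measure gauss W + measure gauss {x. hs_norm (B x) > t}"
    by (intro measure_subadditive gauss.emeasure_finite) auto
  also have "measure gauss {x. hs_norm (B x) > t} \<le> (\<Sum>i\<in>UNIV. \<Sum>j\<in>UNIV. (nrm (\<lambda>x. B x $ i $ j))\<^sup>2) / t\<^sup>2"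
    using B by (intro measure_hs_norm_le t) (auto simp: hessian_coeffs_def)
  also have "\<dots> \<le> (t * (\<integral>x. \<bar>F x\<bar> \<partial>gauss)) / t\<^sup>2"
  proof (rule divide_right_mono)
    have "t * (\<integral>x. \<bar>g x\<bar> \<partial>gauss) \<le> t * (\<integral>x. \<bar>F x\<bar> \<partial>gauss)"
      using gF t by (intro mult_left_mono) auto
    then show "(\<Sum>i\<in>UNIV. \<Sum>j\<in>UNIV. (nrm (\<lambda>x. B x $ i $ j))\<^sup>2) \<le> t * (\<integral>x. \<bar>F x\<bar> \<partial>gauss)"
      using B_le k'_le g2 by linarith
  qed simp
  also have "\<dots> = (\<integral>x. \<bar>F x\<bar> \<partial>gauss) / t"
    using t by (simp add: power2_eq_square)
  also have "measure gauss W \<le> (\<integral>x. \<bar>F x\<bar> \<partial>gauss) / t"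
    using W_le' t by (simp add: pos_le_divide_eq mult.commute)
  finally show ?thesis
    unfolding F_def by simp
qed

text \<open>\<open>v\<close> and its Hessian do not depend on \<delta>, so the regularisation costs
  only \<delta> times the L1 norm of \<open>v\<close>, which vanishes along \<delta> = 1 / (n +
  1).\<close>

lemma weak_type_hessian_coeffs:
  fixes f :: "real ^ 'n::finite \<Rightarrow> real"
  assumes f: "f \<in> L2" and v: "v \<in> L2" and coef_v: "\<And>\<alpha>. hcoef v \<alpha> = hcoef f \<alpha> / real (deg \<alpha>)"
    and A: "hessian_coeffs v A" "A \<in> borel_measurable borel" and t: "t > 0"
  shows "measure gauss {x. hs_norm (A x) > t} \<le> 2 * L1_norm f / t"
proof (rule LIMSEQ_le_const)
  let ?R = "\<lambda>n. 2 * ((\<integral>x. \<bar>f x\<bar> \<partial>gauss) + inverse (real (Suc n)) * (\<integral>x. \<bar>v x\<bar> \<partial>gauss)) / t"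
  have "?R \<longlonglongrightarrow> 2 * ((\<integral>x. \<bar>f x\<bar> \<partial>gauss) + 0 * (\<integral>x. \<bar>v x\<bar> \<partial>gauss)) / t"
    using t by (intro tendsto_intros LIMSEQ_inverse_real_of_nat) auto
  then show "?R \<longlonglongrightarrow> 2 * L1_norm f / t"
    by (simp add: L1_norm_def)
  have "measure gauss {x. hs_norm (A x) > t} \<le> ?R n" for n
  proof -
    let ?d = "inverse (real (Suc n))"
    have int: "integrable gauss (\<lambda>x. \<bar>f x\<bar>)" "integrable gauss (\<lambda>x. \<bar>v x\<bar>)" "integrable gauss (\<lambda>x. \<bar>f x + ?d * v x\<bar>)"
      by (intro integrable_abs L2_integrable f v L2_add L2_cmult)+
    have "(\<integral>x. \<bar>f x + ?d * v x\<bar> \<partial>gauss) \<le> (\<integral>x. \<bar>f x\<bar> + ?d * \<bar>v x\<bar> \<partial>gauss)"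
      using int by (intro integral_mono Bochner_Integration.integrable_add integrable_mult_right)
        (auto intro!: order_trans[OF abs_triangle_ineq] simp: abs_mult)
    also have "\<dots> = (\<integral>x. \<bar>f x\<bar> \<partial>gauss) + ?d * (\<integral>x. \<bar>v x\<bar> \<partial>gauss)"
      using int by simp
    finally have le: "2 * (\<integral>x. \<bar>f x + ?d * v x\<bar> \<partial>gauss) / t \<le> ?R n"
      using t by (intro divide_right_mono mult_left_mono) auto
    have "measure gauss {x. hs_norm (A x) > t} \<le> 2 * (\<integral>x. \<bar>f x + ?d * v x\<bar> \<partial>gauss) / t"
      by (rule weak_type_regularised[OF f v coef_v A _ t]) simp
    with le show ?thesis
      by linarith
  qed
  then show "\<exists>N. \<forall>n\<ge>N. measure gauss {x. hs_norm (A x) > t} \<le> ?R n"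
    by blast
qed

section \<open>Test functions\<close>

lemma has_partial_frechet:
  assumes "\<And>x. \<phi> differentiable at x"
  shows "has_partial i \<phi> (partial i \<phi>)"
  unfolding has_partial_def
proof
  fix x
  have "(\<phi> has_derivative frechet_derivative \<phi> (at (x + 0 *\<^sub>R axis i 1))) (at (x + 0 *\<^sub>R axis i 1))"
    using assms frechet_derivative_works by blast
  moreover have "((\<lambda>s. x + s *\<^sub>R axis i 1) has_derivative (\<lambda>s. s *\<^sub>R axis i 1)) (at 0)"
    by (auto intro!: derivative_eq_intros)
  ultimately have "((\<lambda>s. \<phi> (x + s *\<^sub>R axis i 1)) has_derivative
      (\<lambda>s. frechet_derivative \<phi> (at (x + 0 *\<^sub>R axis i 1)) (s *\<^sub>R axis i 1))) (at 0)"
    by (rule has_derivative_compose[rotated])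
  moreover have "frechet_derivative \<phi> (at x) (s *\<^sub>R axis i 1) = partial i \<phi> x * s" for s
    using linear_frechet_derivative[OF assms[of x]] by (simp add: linear_scale partial_def mult.commute)
  ultimately show "((\<lambda>s. \<phi> (x + s *\<^sub>R axis i 1)) has_real_derivative partial i \<phi> x) (at 0)"
    by (simp add: has_field_derivative_def)
qed

lemma partial_eqI:
  assumes "(\<phi> has_derivative D) (at x)"
  shows "partial i \<phi> x = D (axis i 1)"
  unfolding partial_def using frechet_derivative_at[OF assms] by simp

lemma partial_eq_0_outside:
  assumes "closed K" "\<And>x. x \<notin> K \<Longrightarrow> \<phi> x = 0" "x \<notin> K"
  shows "partial i \<phi> x = 0"
proof -
  have "((\<lambda>x. 0) has_derivative (\<lambda>_. 0)) (at x)"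
    by simp
  then have "(\<phi> has_derivative (\<lambda>_. 0)) (at x)"
    by (rule has_derivative_transform_within_open[where s = "- K"]) (use assms in auto)
  then show ?thesis
    by (rule partial_eqI)
qed

text \<open>For the product rule, where one factor stays undifferentiated and has an order to spare.
  The base case is continuity of differentiable functions.\<close>

lemma Ck_Suc_imp: "Ck (Suc k) \<phi> \<Longrightarrow> Ck k \<phi>"
proof (induction k arbitrary: \<phi>)
  case 0
  then show ?case
    by (auto intro!: continuous_at_imp_continuous_on differentiable_imp_continuous_within)
next
  case (Suc k)
  show ?case
    unfolding Ck.simps(2)[of k]
  proof (intro conjI allI)
    show "\<phi> differentiable at x" for x
      using Suc.prems by simp
    show "Ck k (partial i \<phi>)" for i
      using Suc.prems Suc.IH unfolding Ck.simps(2)[of "Suc k"] by blast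
  qed
qed

section \<open>Closure of the C^k classes under sums and products\<close>

lemma Ck_const: "Ck k (\<lambda>x. c)"
proof (induction k arbitrary: c)
  case (Suc k)
  have "partial i (\<lambda>x :: real ^ 'a. c) = (\<lambda>x. 0)" for i
    by (rule ext, rule partial_eqI[where D = "\<lambda>_. 0"]) simp
  then show ?case
    using Suc by simp
qed simp

lemma partial_add:
  assumes "f differentiable at x" "g differentiable at x"
  shows "partial i (\<lambda>x. f x + g x) x = partial i f x + partial i g x"
  by (subst partial_eqI[OF has_derivative_add[OF assms[unfolded frechet_derivative_works]]])
    (simp add: partial_def)

lemma partial_mult:
  assumes "f differentiable at x" "g differentiable at x"
  shows "partial i (\<lambda>x. f x * g x) x = f x * partial i g x + partial i f x * g x"
  by (subst partial_eqI[OF has_derivative_mult[OF assms[unfolded frechet_derivative_works]]])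
    (simp add: partial_def)

lemma Ck_add: "Ck k f \<Longrightarrow> Ck k g \<Longrightarrow> Ck k (\<lambda>x. f x + g x)"
proof (induction k arbitrary: f g)
  case (Suc k)
  then have "partial i (\<lambda>x. f x + g x) = (\<lambda>x. partial i f x + partial i g x)" for i
    by (intro ext partial_add) auto
  then show ?case
    using Suc by simp
qed (auto intro: continuous_intros)

lemma Ck_mult: "Ck k f \<Longrightarrow> Ck k g \<Longrightarrow> Ck k (\<lambda>x. f x * g x)"
proof (induction k arbitrary: f g)
  case (Suc k)
  then have p: "partial i (\<lambda>x. f x * g x) = (\<lambda>x. f x * partial i g x + partial i f x * g x)" for i
    by (intro ext partial_mult) auto
  have "Ck k f" "Ck k g"
    using Suc.prems Ck_Suc_imp by blast+
  then have "Ck k (\<lambda>x. f x * partial i g x + partial i f x * g x)" for i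
    using Suc.prems by (intro Ck_add Suc.IH) auto
  then show ?case
    using Suc.prems by (simp add: p)
qed (auto intro: continuous_intros)

lemma Ck_prod: "(\<And>a. a \<in> S \<Longrightarrow> Ck k (f a)) \<Longrightarrow> Ck k (\<lambda>x. \<Prod>a\<in>S. f a x)"
  by (induction S rule: infinite_finite_induct) (auto intro: Ck_const Ck_mult)

text \<open>The derivatives of \<open>exp (-1/x)\<close>, extended by \<open>0\<close>, are combinations of these functions.\<close>
definition flat :: "nat \<Rightarrow> real \<Rightarrow> real" where
  "flat j x = (if x > 0 then exp (- 1 / x) / x ^ j else 0)"

text \<open>A single term of the exponential series gives (1/x)^(j+1) <= (j+1)! exp (1/x). The
  linear bound provides the limit at the origin in \<open>DERIV_flat\<close>.\<close>

lemma flat_le: "\<bar>flat j x\<bar> \<le> fact (Suc j) * \<bar>x\<bar>"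
proof (cases "x > 0")
  case True
  have "(inverse x) ^ Suc j / fact (Suc j) \<le> (\<Sum>n. (inverse x) ^ n / fact n)"
    using True sum_le_suminf[of "\<lambda>n. (inverse x) ^ n / fact n" "{Suc j}"] summable_exp[of "inverse x"]
    by (simp add: divide_inverse mult.commute del: power_Suc fact_Suc)
  also have "\<dots> = exp (inverse x)"
    by (simp add: exp_def divide_inverse scaleR_conv_of_real mult.commute)
  finally have "(inverse x) ^ Suc j \<le> fact (Suc j) * exp (inverse x)"
    by (simp add: divide_le_eq mult.commute del: power_Suc fact_Suc)
  then have "(inverse x) ^ Suc j * exp (- inverse x) \<le> fact (Suc j) * exp (inverse x) * exp (- inverse x)"
    by (rule mult_right_mono) simp
  also have "\<dots> = fact (Suc j)"
    by (simp add: mult.assoc flip: exp_add)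
  finally have "(inverse x) ^ Suc j * exp (- inverse x) * x \<le> fact (Suc j) * x"
    using True by (intro mult_right_mono) auto
  moreover have "(inverse x) ^ Suc j * exp (- inverse x) * x = flat j x"
    using True by (simp add: flat_def divide_inverse power_inverse mult_ac)
  moreover have "\<bar>flat j x\<bar> = flat j x" "\<bar>x\<bar> = x"
    using True by (simp_all add: flat_def)
  ultimately show ?thesis
    by (simp only:)
qed (simp add: flat_def mult_le_0_iff del: fact_Suc)

text \<open>At 0 the difference quotient of \<open>flat j\<close> is \<open>flat (Suc j)\<close>,
  which tends to 0. The family spans a space closed under differentiation, so smoothness follows by
  induction.\<close>

lemma DERIV_flat: "(flat j has_real_derivative flat (j + 2) x - real j * flat (Suc j) x) (at x)"
proof -
  consider "x > 0" | "x < 0" | "x = 0"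
    by linarith
  then show ?thesis
  proof cases
    case 1
    have "((\<lambda>x. exp (- 1 / x) / x ^ j) has_real_derivative
        (exp (- 1 / x) * (1 / x\<^sup>2) * x ^ j - exp (- 1 / x) * (real j * x ^ (j - 1))) / (x ^ j * x ^ j)) (at x)"
      using 1 by (auto intro!: derivative_eq_intros simp: power2_eq_square)
    moreover have "(exp (- 1 / x) * (1 / x\<^sup>2) * x ^ j - exp (- 1 / x) * (real j * x ^ (j - 1))) / (x ^ j * x ^ j) =
        flat (j + 2) x - real j * flat (Suc j) x"
      using 1 by (cases j) (simp_all add: flat_def field_simps power2_eq_square)
    ultimately have "((\<lambda>x. exp (- 1 / x) / x ^ j) has_real_derivative flat (j + 2) x - real j * flat (Suc j) x) (at x)"
      by (simp only:)
    then show ?thesis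
      by (rule has_field_derivative_transform_within_open[where S = "{0<..}"]) (use 1 in \<open>auto simp: flat_def\<close>)
  next
    case 2
    have "((\<lambda>x. 0) has_real_derivative 0) (at x)"
      by simp
    then have "(flat j has_real_derivative 0) (at x)"
      by (rule has_field_derivative_transform_within_open[where S = "{..<0}"]) (use 2 in \<open>auto simp: flat_def\<close>)
    then show ?thesis
      using 2 by (simp add: flat_def)
  next
    case 3
    have q: "(flat j (0 + h) - flat j 0) / h = flat (Suc j) h" for h
      by (simp add: flat_def)
    have "((\<lambda>h. fact (Suc (Suc j)) * \<bar>h\<bar>) \<longlongrightarrow> fact (Suc (Suc j)) * \<bar>0 :: real\<bar>) (at 0)"
      by (intro tendsto_intros)
    then have "((\<lambda>h. fact (Suc (Suc j)) * \<bar>h :: real\<bar>) \<longlongrightarrow> 0) (at 0)"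
      by simp
    then have "(flat (Suc j) \<longlongrightarrow> 0) (at 0)"
      by (rule Lim_null_comparison[rotated]) (use flat_le[of "Suc j"] in \<open>auto intro!: always_eventually\<close>)
    then have "(flat j has_real_derivative 0) (at 0)"
      unfolding DERIV_def q .
    then show ?thesis
      using 3 by (simp add: flat_def)
  qed
qed

lemma flat_0_bounds: "0 \<le> flat 0 x" "flat 0 x \<le> 1"
  by (auto simp: flat_def)

lemma Ck_flat_component:
  fixes i :: "'n::finite"
  shows "Ck k (\<lambda>x :: real ^ 'n. flat j (c * x $ i + d))"
proof (induction k arbitrary: j)
  let ?D = "\<lambda>j x v. (flat (j + 2) (c * x $ i + d) - real j * flat (Suc j) (c * x $ i + d)) * (c * v $ i)"
  have D: "((\<lambda>x :: real ^ 'n. flat j (c * x $ i + d)) has_derivative ?D j x) (at x)" for j x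
  proof -
    have "((\<lambda>x :: real ^ 'n. c * x $ i + d) has_derivative (\<lambda>v. c * v $ i)) (at x)"
      by (auto intro!: derivative_eq_intros bounded_linear_imp_has_derivative[OF bounded_linear_vec_nth])
    from has_derivative_compose[OF this DERIV_flat[of j "c * x $ i + d", unfolded has_field_derivative_def]]
    show ?thesis .
  qed
  then have diff: "(\<lambda>x :: real ^ 'n. flat j (c * x $ i + d)) differentiable at x" for j x
    unfolding differentiable_def by blast
  {
    case 0
    show ?case
      using diff by (auto intro!: continuous_at_imp_continuous_on differentiable_imp_continuous_within)
  next
    case (Suc k)
    have p: "partial l (\<lambda>x :: real ^ 'n. flat j (c * x $ i + d)) = (\<lambda>x.
        (c * axis l 1 $ i) * (flat (j + 2) (c * x $ i + d) + (- real j) * flat (Suc j) (c * x $ i + d)))" for l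
    proof
      fix x :: "real ^ 'n"
      show "partial l (\<lambda>x :: real ^ 'n. flat j (c * x $ i + d)) x =
        (c * axis l 1 $ i) * (flat (j + 2) (c * x $ i + d) + (- real j) * flat (Suc j) (c * x $ i + d))"
        unfolding partial_eqI[OF D] by (simp add: mult_ac)
    qed
    have "Ck k (partial l (\<lambda>x :: real ^ 'n. flat j (c * x $ i + d)))" for l
      unfolding p by (intro Ck_mult Ck_add Ck_const Suc.IH)
    then show ?case
      using diff by simp
  }
qed

text \<open>For \<open>m > 0\<close> positive exactly on \<open>box a b\<close>; a growing
  \<open>m\<close> drives every factor to 1 inside the box, so indicators of boxes are reached
  without mollification. The arguments have the affine shape of
  \<open>Ck_flat_component\<close>.\<close>

definition bump :: "real \<Rightarrow> real ^ 'n::finite \<Rightarrow> real ^ 'n \<Rightarrow> real ^ 'n \<Rightarrow> real" where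
  "bump m a b x = (\<Prod>i\<in>UNIV. flat 0 (m * x $ i + - m * a $ i) * flat 0 (- m * x $ i + m * b $ i))"

lemma bump_eq_0: "m > 0 \<Longrightarrow> x \<notin> box a b \<Longrightarrow> bump m a b x = 0"
proof -
  assume m: "m > 0" and "x \<notin> box a b"
  then obtain i where "x $ i \<le> a $ i \<or> b $ i \<le> x $ i"
    by (auto simp: mem_box_cart not_less)
  then have "m * x $ i + - m * a $ i \<le> 0 \<or> - m * x $ i + m * b $ i \<le> 0"
    using m by auto
  then have "flat 0 (m * x $ i + - m * a $ i) * flat 0 (- m * x $ i + m * b $ i) = 0"
    by (auto simp: flat_def)
  then show ?thesis
    unfolding bump_def by (intro prod_zero) auto
qed

lemma test_function_bump: "m > 0 \<Longrightarrow> test_function (bump m a b)"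
  unfolding test_function_def
proof (intro conjI allI)
  assume "m > 0"
  show "Ck k (bump m a b)" for k
    unfolding bump_def by (intro Ck_prod Ck_mult Ck_flat_component)
  have "{x. bump m a b x \<noteq> 0} \<subseteq> box a b"
    using bump_eq_0[OF \<open>m > 0\<close>] by blast
  then have "bounded {x. bump m a b x \<noteq> 0}"
    by (rule bounded_subset[OF bounded_box])
  then show "compact (closure {x. bump m a b x \<noteq> 0})"
    by (simp add: compact_closure)
qed

lemma borel_bump [measurable]: "bump m a b \<in> borel_measurable borel"
proof -
  have "Ck 0 (bump m a b)"
    unfolding bump_def by (intro Ck_prod Ck_mult Ck_flat_component)
  then show ?thesis
    by (simp add: borel_measurable_continuous_onI)
qed

lemma bump_bounds: "0 \<le> bump m a b x" "bump m a b x \<le> 1"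
  unfolding bump_def using flat_0_bounds by (auto intro!: prod_nonneg prod_le_1 mult_le_one)

lemma bump_tendsto: "(\<lambda>n. bump (real (Suc n)) a b x) \<longlonglongrightarrow> indicator (box a b) x"
proof (cases "x \<in> box a b")
  case False
  then show ?thesis
    by (simp add: bump_eq_0)
next
  case True
  have 1: "(\<lambda>n. flat 0 (real (Suc n) * y)) \<longlonglongrightarrow> 1" if "y > 0" for y
  proof -
    have "(\<lambda>n. exp (- (inverse (real (Suc n)) * inverse y))) \<longlonglongrightarrow> exp (- (0 * inverse y))"
      by (intro tendsto_intros LIMSEQ_inverse_real_of_nat)
    moreover have "flat 0 (real (Suc n) * y) = exp (- (inverse (real (Suc n)) * inverse y))" for n
      using that by (simp add: flat_def divide_inverse mult.commute)
    ultimately show ?thesis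
      by simp
  qed
  have "(\<lambda>n. \<Prod>i\<in>UNIV. flat 0 (real (Suc n) * (x $ i - a $ i)) * flat 0 (real (Suc n) * (b $ i - x $ i))) \<longlonglongrightarrow>
      (\<Prod>i\<in>(UNIV :: 'a set). 1 * 1)"
    using True by (intro tendsto_prod tendsto_mult 1) (auto simp: mem_box_cart)
  moreover have "bump (real (Suc n)) a b x =
      (\<Prod>i\<in>UNIV. flat 0 (real (Suc n) * (x $ i - a $ i)) * flat 0 (real (Suc n) * (b $ i - x $ i)))" for n
  proof -
    have "m * y + - m * c = m * (y - c)" "- m * y + m * c = m * (c - y)" for m y c :: real
      by (simp_all add: right_diff_distrib)
    then show ?thesis
      unfolding bump_def by (simp only:)
  qed
  ultimately show ?thesis
    using True by simp
qed

text \<open>The density is bounded below on a compact set. A Lebesgue pairing with a compactly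
  supported \<psi> thereby becomes a Gaussian inner product with \<open>\<psi> x / gdens x\<close>,
  through which norm limits pass.\<close>

lemma div_gdens_L2:
  fixes \<psi> :: "real ^ 'n::finite \<Rightarrow> real"
  assumes [measurable]: "\<psi> \<in> borel_measurable borel" and "compact K"
    and B: "\<And>x. \<bar>\<psi> x\<bar> \<le> B" and 0: "\<And>x. x \<notin> K \<Longrightarrow> \<psi> x = 0"
  shows "(\<lambda>x. \<psi> x / gdens x) \<in> L2"
proof (cases "K = {}")
  case True
  then show ?thesis
    using 0 L2_const[of 0] by simp
next
  case False
  then obtain y where y: "y \<in> K" "\<And>x. x \<in> K \<Longrightarrow> gdens y \<le> gdens x"
    using continuous_attains_inf[OF \<open>compact K\<close> False continuous_on_subset[OF continuous_gdens]] by auto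
  show ?thesis
  proof (rule L2_bounded[where B = "B / gdens y"])
    fix x
    have "B \<ge> 0"
      using B[of x] by linarith
    then show "\<bar>\<psi> x / gdens x\<bar> \<le> B / gdens y"
      using y(2)[of x] 0[of x] gdens_pos[of x] gdens_pos[of y] B[of x]
      by (cases "x \<in> K") (auto simp: abs_divide intro!: frac_le)
  qed measurable
qed

lemma lborel_integral_eq_gauss:
  fixes v :: "real ^ 'n::finite \<Rightarrow> real"
  assumes v: "v \<in> L2" and \<psi>: "(\<lambda>x. \<psi> x / gdens x) \<in> L2"
  shows "(\<integral>x. v x * \<psi> x \<partial>lborel) = (\<integral>x. v x * (\<psi> x / gdens x) \<partial>gauss)"
    and "integrable lborel (\<lambda>x. v x * \<psi> x)"
proof -
  have eq: "gdens x * (v x * (\<psi> x / gdens x)) = v x * \<psi> x" for x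
    using gdens_pos[of x] by simp
  have "(\<lambda>x. v x * (\<psi> x / gdens x)) \<in> borel_measurable borel"
    using v \<psi> by measurable
  then show "(\<integral>x. v x * \<psi> x \<partial>lborel) = (\<integral>x. v x * (\<psi> x / gdens x) \<partial>gauss)"
    "integrable lborel (\<lambda>x. v x * \<psi> x)"
    using L2_integrable_mult[OF v \<psi>] by (simp_all only: integral_gauss_eq integrable_gauss_iff eq)
qed

lemma compact_support_div_gdens_L2:
  fixes \<psi> :: "real ^ 'n::finite \<Rightarrow> real"
  assumes c: "continuous_on UNIV \<psi>" and K: "compact K" and 0: "\<And>x. x \<notin> K \<Longrightarrow> \<psi> x = 0"
  shows "(\<lambda>x. \<psi> x / gdens x) \<in> L2"
proof -
  have "bounded (\<psi> ` K)"
    using compact_continuous_image[OF continuous_on_subset[OF c] K] compact_imp_bounded by auto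
  then obtain B where "\<And>x. x \<in> K \<Longrightarrow> \<bar>\<psi> x\<bar> \<le> B"
    unfolding bounded_iff by auto
  then have "\<bar>\<psi> x\<bar> \<le> \<bar>B\<bar>" for x
    using 0[of x] by (cases "x \<in> K") force+
  then show ?thesis
    by (intro div_gdens_L2[OF borel_measurable_continuous_onI[OF c] K _ 0])
qed

section \<open>Hermite Hessians are weak Hessians\<close>

lemma ibp_compact_support:
  fixes p :: "real ^ 'n::finite \<Rightarrow> real"
  assumes p: "has_partial i p p'" "exp_growth p" "exp_growth p'"
    and \<psi>: "has_partial i \<psi> \<psi>'" "continuous_on UNIV \<psi>" "continuous_on UNIV \<psi>'"
    and K: "compact K" "\<And>x. x \<notin> K \<Longrightarrow> \<psi> x = 0" "\<And>x. x \<notin> K \<Longrightarrow> \<psi>' x = 0"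
  shows "(\<integral>x. p x * \<psi>' x \<partial>lborel) = - (\<integral>x. p' x * \<psi> x \<partial>lborel)"
proof -
  note L = compact_support_div_gdens_L2[OF \<psi>(2) K(1,2)] compact_support_div_gdens_L2[OF \<psi>(3) K(1,3)]
  note int = lborel_integral_eq_gauss(2)[OF exp_growth_L2[OF p(2)] L(1)]
    lborel_integral_eq_gauss(2)[OF exp_growth_L2[OF p(2)] L(2)]
    lborel_integral_eq_gauss(2)[OF exp_growth_L2[OF p(3)] L(1)]
  have "(\<integral>x. p' x * \<psi> x + p x * \<psi>' x \<partial>lborel) = 0"
    by (rule integral_partial_eq_0[OF has_partial_mult[OF p(1) \<psi>(1)]])
      (use int exp_growth_continuous[OF p(2)] exp_growth_continuous[OF p(3)] in \<open>auto intro!: continuous_intros \<psi>\<close>)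
  then show ?thesis
    using int by simp
qed

lemma test_function_partials:
  fixes \<phi> :: "real ^ 'n::finite \<Rightarrow> real"
  assumes "test_function \<phi>"
  obtains K where "compact K" "\<And>x. x \<notin> K \<Longrightarrow> \<phi> x = 0" "\<And>i x. x \<notin> K \<Longrightarrow> partial i \<phi> x = 0"
    "\<And>i j x. x \<notin> K \<Longrightarrow> partial i (partial j \<phi>) x = 0"
    "continuous_on UNIV \<phi>" "\<And>i. continuous_on UNIV (partial i \<phi>)" "\<And>i j. continuous_on UNIV (partial i (partial j \<phi>))"
    "\<And>i. has_partial i \<phi> (partial i \<phi>)" "\<And>i j. has_partial i (partial j \<phi>) (partial i (partial j \<phi>))"
proof -
  let ?K = "closure {x. \<phi> x \<noteq> 0}"
  have K: "compact ?K" "closed ?K"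
    using assms by (auto simp: test_function_def)
  have 0: "\<phi> x = 0" if "x \<notin> ?K" for x
    using that closure_subset[of "{x. \<phi> x \<noteq> 0}"] by blast
  have 1: "partial i \<phi> x = 0" if "x \<notin> ?K" for i x
    using partial_eq_0_outside[OF K(2) 0 that] .
  have 2: "partial i (partial j \<phi>) x = 0" if "x \<notin> ?K" for i j x
    using partial_eq_0_outside[OF K(2) 1 that] .
  have "Ck (Suc (Suc 0)) \<phi>"
    using assms unfolding test_function_def by blast
  note C2 = this
  have C: "\<phi> differentiable at x" "Ck (Suc 0) (partial j \<phi>)" "Ck (Suc 0) \<phi>" for x j
    using C2[unfolded Ck.simps(2)[of "Suc 0"]] Ck_Suc_imp[OF C2] by blast+
  have c: "continuous_on UNIV \<phi>" "\<And>j. continuous_on UNIV (partial j \<phi>)"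
    using Ck_Suc_imp[OF C(3)] Ck_Suc_imp[OF C(2)] by simp_all
  have D: "partial j \<phi> differentiable at x" and c2: "continuous_on UNIV (partial i (partial j \<phi>))" for i j x
    using C(2)[of j] by auto
  show ?thesis
    by (rule that[OF K(1) 0 1 2 c c2 has_partial_frechet[OF C(1)] has_partial_frechet[OF D]])
qed

text \<open>Two integrations by parts are exact for the truncations, whose degree drops by two; both
  sides then converge as Gaussian inner products with fixed functions.\<close>

lemma hessian_coeffs_weak_hessian:
  fixes v :: "real ^ 'n::finite \<Rightarrow> real"
  assumes v: "v \<in> L2" and A: "hessian_coeffs v A"
  shows "is_weak_hessian v A"
  unfolding is_weak_hessian_def
proof (intro allI conjI impI)
  fix i j :: 'n
  show AL2: "(\<lambda>x. A x $ i $ j) \<in> L2"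
    using A by (simp add: hessian_coeffs_def)
  fix \<phi> :: "real ^ 'n \<Rightarrow> real"
  assume "test_function \<phi>"
  then obtain K where K: "compact K" "\<And>x. x \<notin> K \<Longrightarrow> \<phi> x = 0" "\<And>i x. x \<notin> K \<Longrightarrow> partial i \<phi> x = 0"
    "\<And>i j x. x \<notin> K \<Longrightarrow> partial i (partial j \<phi>) x = 0"
    and c: "continuous_on UNIV \<phi>" "\<And>i. continuous_on UNIV (partial i \<phi>)" "\<And>i j. continuous_on UNIV (partial i (partial j \<phi>))"
    and d: "\<And>i. has_partial i \<phi> (partial i \<phi>)" "\<And>i j. has_partial i (partial j \<phi>) (partial i (partial j \<phi>))"
    using test_function_partials by blast
  let ?p = "\<lambda>N. hpoly (Suc (Suc N)) (hcoef v)" and ?q = "\<lambda>N. hpoly N (\<lambda>\<beta>. hcoef v (up i (up j \<beta>)))"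
  have eq: "(\<integral>x. ?p N x * partial i (partial j \<phi>) x \<partial>lborel) = (\<integral>x. ?q N x * \<phi> x \<partial>lborel)" for N
  proof -
    let ?r = "hpoly (Suc N) (\<lambda>\<beta>. hcoef v (up i \<beta>))"
    have "(\<integral>x. ?p N x * partial i (partial j \<phi>) x \<partial>lborel) = - (\<integral>x. ?r x * partial j \<phi> x \<partial>lborel)"
      by (rule ibp_compact_support[OF has_partial_hpoly exp_growth_hpoly exp_growth_hpoly d(2) c(2,3) K(1,3,4)])
    also have "(\<integral>x. ?r x * partial j \<phi> x \<partial>lborel) = - (\<integral>x. ?q N x * \<phi> x \<partial>lborel)"
      by (rule ibp_compact_support[OF has_partial_hpoly exp_growth_hpoly exp_growth_hpoly d(1) c(1,2) K(1,2,3)])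
    finally show ?thesis
      by simp
  qed
  note L = compact_support_div_gdens_L2[OF c(1) K(1,2)] compact_support_div_gdens_L2[OF c(3) K(1,4)]
  have "hcoef (\<lambda>x. A x $ i $ j) = (\<lambda>\<beta>. hcoef v (up i (up j \<beta>)))"
    using A by (auto simp: hessian_coeffs_def)
  then have "L2_tendsto ?q (\<lambda>x. A x $ i $ j)"
    using L2_tendsto_hpoly[OF AL2] by simp
  from L2_tendsto_inner_const[OF this L(1)]
  have 1: "(\<lambda>N. \<integral>x. ?q N x * \<phi> x \<partial>lborel) \<longlonglongrightarrow> (\<integral>x. A x $ i $ j * \<phi> x \<partial>lborel)"
    by (simp add: lborel_integral_eq_gauss(1)[OF _ L(1)] AL2)
  have "L2_tendsto ?p v"
    using L2_tendsto_subseq[OF L2_tendsto_hpoly[OF v], of "\<lambda>N. Suc (Suc N)"] by (simp add: strict_mono_def)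
  from L2_tendsto_inner_const[OF this L(2)]
  have 2: "(\<lambda>N. \<integral>x. ?p N x * partial i (partial j \<phi>) x \<partial>lborel) \<longlonglongrightarrow> (\<integral>x. v x * partial i (partial j \<phi>) x \<partial>lborel)"
    by (simp add: lborel_integral_eq_gauss(1)[OF _ L(2)] v)
  show "(\<integral>x. v x * partial i (partial j \<phi>) x \<partial>lborel) = (\<integral>x. A x $ i $ j * \<phi> x \<partial>lborel)"
    using LIMSEQ_unique[OF 2[unfolded eq] 1] .
qed

text \<open>\<open>weak_hessian\<close> is an arbitrary choice, so its values must be pinned down.
  Bumps are test functions tending to indicators of boxes, and vanishing integrals over boxes
  determine the difference.\<close>

lemma weak_hessian_unique:
  fixes v :: "real ^ 'n::finite \<Rightarrow> real"
  assumes A: "is_weak_hessian v A" and B: "is_weak_hessian v B"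
  shows "AE x in gauss. A x = B x"
proof -
  have "AE x in gauss. A x $ i $ j = B x $ i $ j" for i j
  proof -
    define h where "h x = A x $ i $ j - B x $ i $ j" for x
    have AB: "(\<lambda>x. A x $ i $ j) \<in> L2" "(\<lambda>x. B x $ i $ j) \<in> L2"
      using A B by (auto simp: is_weak_hessian_def)
    then have h: "h \<in> L2"
      unfolding h_def by auto
    have [measurable]: "h \<in> borel_measurable borel"
      using h by auto
    have box: "(\<lambda>x. indicator (box a b) x / gdens x) \<in> L2" for a b :: "real ^ 'n"
      by (rule div_gdens_L2[where B = 1 and K = "cbox a b"])
        (use box_subset_cbox[of a b] in \<open>auto simp: indicator_def compact_cbox\<close>)
    have test: "(\<integral>x. h x * \<phi> x \<partial>lborel) = 0" if \<phi>: "test_function \<phi>" for \<phi>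
    proof -
      obtain K where K: "compact K" "\<And>x. x \<notin> K \<Longrightarrow> \<phi> x = 0" and c: "continuous_on UNIV \<phi>"
        by (rule test_function_partials[OF \<phi>]) (use that in blast)
      note L = compact_support_div_gdens_L2[OF c K]
      have "(\<integral>x. A x $ i $ j * \<phi> x \<partial>lborel) = (\<integral>x. B x $ i $ j * \<phi> x \<partial>lborel)"
        using A[unfolded is_weak_hessian_def, THEN spec, THEN spec, THEN conjunct2, THEN spec, THEN mp, OF \<phi>, of i j]
          B[unfolded is_weak_hessian_def, THEN spec, THEN spec, THEN conjunct2, THEN spec, THEN mp, OF \<phi>, of i j]
        by (rule trans[OF sym])
      then show ?thesis
        using lborel_integral_eq_gauss(2)[OF AB(1) L] lborel_integral_eq_gauss(2)[OF AB(2) L]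
        by (simp add: h_def left_diff_distrib)
    qed
    have "AE x in lborel. h x = 0"
    proof (rule AE_eq_0_if_integral_box_eq_0)
      fix a b :: "real ^ 'n"
      show int: "integrable lborel (\<lambda>x. indicator (box a b) x * h x)"
        using lborel_integral_eq_gauss(2)[OF h box[of a b]] by (simp add: mult.commute)

      have "(\<lambda>n. \<integral>x. h x * bump (real (Suc n)) a b x \<partial>lborel) \<longlonglongrightarrow> (\<integral>x. h x * indicator (box a b) x \<partial>lborel)"
      proof (rule integral_dominated_convergence[where w = "\<lambda>x. \<bar>indicator (box a b) x * h x\<bar>"])
        show "integrable lborel (\<lambda>x. \<bar>indicator (box a b) x * h x\<bar>)"
          using int by (rule integrable_abs)
        show "AE x in lborel. (\<lambda>n. h x * bump (real (Suc n)) a b x) \<longlonglongrightarrow> h x * indicator (box a b) x"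
          by (intro AE_I2 tendsto_mult tendsto_const bump_tendsto)
        show "AE x in lborel. norm (h x * bump (real (Suc n)) a b x) \<le> \<bar>indicator (box a b) x * h x\<bar>" for n
        proof (rule AE_I2)
          fix x
          show "norm (h x * bump (real (Suc n)) a b x) \<le> \<bar>indicator (box a b) x * h x\<bar>"
          proof (cases "x \<in> box a b")
            case True
            then show ?thesis
              using bump_bounds[of "real (Suc n)" a b x] by (simp add: abs_mult mult_left_le)
          next
            case False
            then show ?thesis
              by (simp add: bump_eq_0)
          qed
        qed
      qed auto
      then have "(\<lambda>n. 0) \<longlonglongrightarrow> (\<integral>x. h x * indicator (box a b) x \<partial>lborel)"
        by (simp add: test test_function_bump)
      from LIMSEQ_unique[OF this tendsto_const]
      show "(\<integral>x. indicator (box a b) x * h x \<partial>lborel) = 0"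
        by (simp add: mult.commute)
    qed measurable
    then have "AE x in gauss. h x = 0"
      by (simp add: AE_gauss_iff)
    then show ?thesis
      by eventually_elim (simp add: h_def)
  qed
  then have "AE x in gauss. \<forall>i j. A x $ i $ j = B x $ i $ j"
    unfolding AE_all_countable by blast
  then show ?thesis
    by eventually_elim (simp add: vec_eq_iff)
qed

text \<open>The bridge from definitions by choice to Hermite coefficients: a coefficient Hessian
  exists and is a weak Hessian, so the chosen one agrees with it almost everywhere and has the same
  coefficients.\<close>

lemma riesz2_hessian_coeffs:
  fixes f :: "real ^ 'n::finite \<Rightarrow> real"
  assumes f: "f \<in> L2"
  obtains v where "v \<in> L2" "\<And>\<alpha>. hcoef v \<alpha> = hcoef f \<alpha> / real (deg \<alpha>)"
    "hessian_coeffs v (riesz2 f)" "riesz2 f \<in> borel_measurable borel"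
proof -
  let ?u = "\<lambda>x. f x - (\<integral>y. f y \<partial>gauss)"
  have u: "?u \<in> L2"
    using f by auto
  define v where "v = OU_inv ?u"
  have v: "v \<in> L2"
    unfolding v_def by (rule OU_inv(1)[OF u])
  \<comment> \<open>Subtracting the mean removes the coefficient at degree 0, so \<open>?u\<close>
    is the Ornstein-Uhlenbeck operator applied to \<open>v\<close> in every degree.\<close>
  have coef_u: "real (deg \<alpha>) * hcoef v \<alpha> = hcoef ?u \<alpha>" for \<alpha>
  proof (cases "deg \<alpha> = 0")
    case True
    then have \<alpha>: "\<alpha> = (\<lambda>_. 0)"
      by (simp add: deg_eq_0_iff)
    have "hcoef ?u \<alpha> = 0"
      by (simp add: hcoef_diff[OF f L2_const] hcoef_const) (simp add: hcoef_def \<alpha>)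
    then show ?thesis
      using True by simp
  qed (simp add: v_def OU_inv(2)[OF u])
  have coef_v: "hcoef v \<alpha> = hcoef f \<alpha> / real (deg \<alpha>)" for \<alpha>
    unfolding v_def OU_inv(2)[OF u]
    by (cases "deg \<alpha> = 0") (auto simp: hcoef_diff[OF f L2_const] hcoef_const deg_eq_0_iff)
  obtain A where A: "hessian_coeffs v A" "A \<in> borel_measurable borel"
    using ex_hessian_coeffs[OF u coef_u[symmetric]] by blast
  have R: "is_weak_hessian v (riesz2 f)"
    unfolding riesz2_def v_def[symmetric] weak_hessian_def
    by (rule someI[of "is_weak_hessian v"]) (rule hessian_coeffs_weak_hessian[OF v A(1)])
  have RL2: "(\<lambda>x. riesz2 f x $ i $ j) \<in> L2" for i j
    using R by (simp add: is_weak_hessian_def)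
  have ae: "AE x in gauss. riesz2 f x = A x"
    by (rule weak_hessian_unique[OF R hessian_coeffs_weak_hessian[OF v A(1)]])
  have "hcoef (\<lambda>x. riesz2 f x $ i $ j) \<beta> = hcoef (\<lambda>x. A x $ i $ j) \<beta>" for i j \<beta>
  proof -
    have "(\<lambda>x. A x $ i $ j) \<in> L2"
      using A by (simp add: hessian_coeffs_def)
    note [measurable] = L2_borel[OF this] L2_borel[OF RL2[of i j]]
    show ?thesis
      unfolding hcoef_def by (rule integral_cong_AE; (measurable)?) (use ae in \<open>auto elim: eventually_mono\<close>)
  qed
  then have "hessian_coeffs v (riesz2 f)"
    using A(1) RL2 by (simp add: hessian_coeffs_def)
  moreover have "riesz2 f \<in> borel_measurable borel"
    using RL2 by (intro borel_measurable_matrix) auto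
  ultimately show ?thesis
    using that[OF v coef_v] by blast
qed

section \<open>The second-order Riesz transform\<close>

lemma riesz2_borel: "f \<in> L2 \<Longrightarrow> riesz2 f \<in> borel_measurable borel"
  using riesz2_hessian_coeffs by blast

lemma riesz2_weak_type:
  assumes "f \<in> L2" "t > 0"
  shows "measure gauss {x. norm (riesz2 f x) > t} \<le> 2 * L1_norm f / t"
  using riesz2_hessian_coeffs[OF assms(1)] weak_type_hessian_coeffs[OF assms(1) _ _ _ _ assms(2)]
  by (metis (no_types, lifting) hs_norm_eq_norm Collect_cong)

text \<open>Linearity is available only almost everywhere, since the three transforms are separate
  choices; it comes from linearity of the coefficients.\<close>

lemma riesz2_diff:
  assumes f: "f \<in> L2" and g: "g \<in> L2"
  shows "AE x in gauss. riesz2 (\<lambda>x. f x - g x) x = riesz2 f x - riesz2 g x"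
proof -
  obtain v where v: "v \<in> L2" "\<And>\<alpha>. hcoef v \<alpha> = hcoef f \<alpha> / real (deg \<alpha>)" "hessian_coeffs v (riesz2 f)"
    using riesz2_hessian_coeffs[OF f] by blast
  obtain w where w: "w \<in> L2" "\<And>\<alpha>. hcoef w \<alpha> = hcoef g \<alpha> / real (deg \<alpha>)" "hessian_coeffs w (riesz2 g)"
    using riesz2_hessian_coeffs[OF g] by blast
  obtain u where u: "u \<in> L2" "\<And>\<alpha>. hcoef u \<alpha> = hcoef (\<lambda>x. f x - g x) \<alpha> / real (deg \<alpha>)"
    "hessian_coeffs u (riesz2 (\<lambda>x. f x - g x))"
    using riesz2_hessian_coeffs[OF L2_diff[OF f g]] by blast
  have "hessian_coeffs (\<lambda>x. v x - w x) (\<lambda>x. riesz2 f x - riesz2 g x)"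
    using v w by (simp add: hessian_coeffs_def L2_diff hcoef_diff)
  then show ?thesis
    by (rule hessian_coeffs_unique[OF u(3)])
      (simp add: u(2) v w hcoef_diff f g diff_divide_distrib)
qed

lemma riesz2_diff_weak_type:
  assumes f: "f \<in> L2" and g: "g \<in> L2" and t: "t > 0"
  shows "measure gauss {x. norm (riesz2 f x - riesz2 g x) > t} \<le> 2 * L1_norm (\<lambda>x. f x - g x) / t"
proof -
  note [measurable] = riesz2_borel[OF f] riesz2_borel[OF g] riesz2_borel[OF L2_diff[OF f g]]
  have "measure gauss {x. norm (riesz2 f x - riesz2 g x) > t} = measure gauss {x. norm (riesz2 (\<lambda>x. f x - g x) x) > t}"
    by (rule gauss.finite_measure_eq_AE) (use riesz2_diff[OF f g] in \<open>auto elim: eventually_mono\<close>)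
  then show ?thesis
    using riesz2_weak_type[OF L2_diff[OF f g] t] by simp
qed

lemma L1_norm_triangle:
  assumes "integrable gauss f" "integrable gauss g" "integrable gauss h"
  shows "L1_norm (\<lambda>x. f x - h x) \<le> L1_norm (\<lambda>x. f x - g x) + L1_norm (\<lambda>x. g x - h x)"
proof -
  have "L1_norm (\<lambda>x. f x - h x) \<le> (\<integral>x. \<bar>f x - g x\<bar> + \<bar>g x - h x\<bar> \<partial>gauss)"
    unfolding L1_norm_def using assms by (intro integral_mono) auto
  also have "\<dots> = L1_norm (\<lambda>x. f x - g x) + L1_norm (\<lambda>x. g x - h x)"
    unfolding L1_norm_def using assms by simp
  finally show ?thesis .
qed

lemma L1_norm_minus_commute: "L1_norm (\<lambda>x. f x - g x) = L1_norm (\<lambda>x. g x - f x)"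
  by (simp add: L1_norm_def abs_minus_commute)

lemma L1_norm_nonneg [simp]: "L1_norm f \<ge> 0"
  by (simp add: L1_norm_def)

lemma L1_approx:
  fixes f :: "real ^ 'n::finite \<Rightarrow> real"
  assumes f: "integrable gauss f"
  obtains F where "\<And>k. F k \<in> L1 \<inter> L2" "(\<lambda>k. L1_norm (\<lambda>x. F k x - f x)) \<longlonglongrightarrow> 0"
proof
  have [measurable]: "f \<in> borel_measurable borel"
    using f by (simp add: borel_measurable_integrable measurable_cong_sets[OF sets_gauss refl, symmetric])
  let ?F = "\<lambda>k x. if \<bar>f x\<bar> \<le> real k then f x else 0"
  show "?F k \<in> L1 \<inter> L2" for k
  proof -
    have "?F k \<in> L2"
      by (rule L2_bounded[where B = "real k"]) auto
    then show ?thesis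
      using L2_integrable by (auto simp: L1_def)
  qed
  have "(\<lambda>k. \<integral>x. \<bar>?F k x - f x\<bar> \<partial>gauss) \<longlonglongrightarrow> (\<integral>x. 0 \<partial>(gauss :: (real ^ 'n) measure))"
  proof (rule integral_dominated_convergence[where w = "\<lambda>x. \<bar>f x\<bar>"])
    show "AE x in gauss. (\<lambda>k. \<bar>?F k x - f x\<bar>) \<longlonglongrightarrow> 0"
    proof (intro AE_I2 tendsto_eventually)
      fix x
      show "\<forall>\<^sub>F k in sequentially. \<bar>?F k x - f x\<bar> = 0"
        using eventually_ge_at_top[of "nat \<lceil>\<bar>f x\<bar>\<rceil>"] by eventually_elim (auto simp: nat_ceiling_le_eq)
    qed
  qed (use f in auto)
  then show "(\<lambda>k. L1_norm (\<lambda>x. ?F k x - f x)) \<longlonglongrightarrow> 0"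
    by (simp add: L1_norm_def)
qed

section \<open>Convergence in measure\<close>

lemma converges_in_measure_iff_norm:
  "converges_in_measure F G \<longleftrightarrow> (\<forall>\<epsilon>>0. (\<lambda>k. measure gauss {x. norm (F k x - G x) > \<epsilon>}) \<longlonglongrightarrow> 0)"
  by (simp add: converges_in_measure_def hs_norm_eq_norm)

lemma measure_norm_diff_le:
  fixes A B C :: "real ^ 'n::finite \<Rightarrow> real ^ 'n ^ 'n"
  assumes [measurable]: "A \<in> borel_measurable borel" "B \<in> borel_measurable borel" "C \<in> borel_measurable borel"
  shows "measure gauss {x. norm (A x - C x) > a + b} \<le>
    measure gauss {x. norm (A x - B x) > a} + measure gauss {x. norm (B x - C x) > b}"
proof -
  have "norm (A x - C x) \<le> norm (A x - B x) + norm (B x - C x)" for x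
    using norm_triangle_ineq[of "A x - B x" "B x - C x"] by simp
  then have "{x. norm (A x - C x) > a + b} \<subseteq> {x. norm (A x - B x) > a} \<union> {x. norm (B x - C x) > b}"
    by (auto simp: not_less) (meson add_mono leD le_less_linear order_trans)
  then have "measure gauss {x. norm (A x - C x) > a + b} \<le>
      measure gauss ({x. norm (A x - B x) > a} \<union> {x. norm (B x - C x) > b})"
    by (intro gauss.finite_measure_mono) auto
  also have "\<dots> \<le> measure gauss {x. norm (A x - B x) > a} + measure gauss {x. norm (B x - C x) > b}"
    by (intro measure_subadditive gauss.emeasure_finite) auto
  finally show ?thesis .
qed

lemma AE_eq_if_measure_norm_diff_eq_0:
  fixes A B :: "real ^ 'n::finite \<Rightarrow> real ^ 'n ^ 'n"
  assumes [measurable]: "A \<in> borel_measurable borel" "B \<in> borel_measurable borel"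
    and zero: "\<And>\<epsilon>. \<epsilon> > 0 \<Longrightarrow> measure gauss {x. norm (A x - B x) > \<epsilon>} \<le> 0"
  shows "AE x in gauss. A x = B x"
proof -
  have "AE x in gauss. \<not> norm (A x - B x) > inverse (real (Suc n))" for n
  proof (rule AE_I)
    have "measure gauss {x. norm (A x - B x) > inverse (real (Suc n))} = 0"
      using zero[of "inverse (real (Suc n))"] measure_nonneg[of gauss] by (intro antisym) auto
    then show "emeasure gauss {x. norm (A x - B x) > inverse (real (Suc n))} = 0"
      by (simp add: gauss.emeasure_eq_measure)
  qed auto
  then have "AE x in gauss. \<forall>n. \<not> norm (A x - B x) > inverse (real (Suc n))"
    unfolding AE_all_countable by blast
  then show ?thesis
  proof eventually_elim
    case (elim x)
    show ?case
    proof (rule ccontr)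
      assume "A x \<noteq> B x"
      then have "norm (A x - B x) > 0"
        by simp
      then show False
        using reals_Archimedean[of "norm (A x - B x)"] elim by auto
    qed
  qed
qed

lemma AE_tendsto_imp_measure:
  fixes A :: "nat \<Rightarrow> real ^ 'n::finite \<Rightarrow> real ^ 'n ^ 'n"
  assumes [measurable]: "\<And>n. A n \<in> borel_measurable borel" "B \<in> borel_measurable borel"
    and lim: "AE x in gauss. (\<lambda>n. A n x) \<longlonglongrightarrow> B x" and "\<epsilon> > 0"
  shows "(\<lambda>n. measure gauss {x. norm (A n x - B x) > \<epsilon>}) \<longlonglongrightarrow> 0"
proof -
  let ?S = "\<lambda>n. {x. norm (A n x - B x) > \<epsilon>}"
  have "(\<lambda>n. \<integral>x. indicator (?S n) x \<partial>gauss) \<longlonglongrightarrow> (\<integral>x. (0 :: real) \<partial>(gauss :: (real ^ 'n) measure))"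
  proof (rule integral_dominated_convergence[where w = "\<lambda>_. 1"])
    show "AE x in gauss. (\<lambda>n. indicator (?S n) x :: real) \<longlonglongrightarrow> 0"
      using lim
    proof eventually_elim
      case (elim x)
      then have "(\<lambda>n. norm (A n x - B x)) \<longlonglongrightarrow> 0"
        using LIM_zero tendsto_norm_zero by blast
      then have "\<forall>\<^sub>F n in sequentially. norm (A n x - B x) < \<epsilon>"
        using \<open>\<epsilon> > 0\<close> by (rule order_tendstoD)
      then have "\<forall>\<^sub>F n in sequentially. indicator (?S n) x = (0 :: real)"
        by eventually_elim auto
      then show ?case
        by (rule tendsto_eventually)
    qed
  qed auto
  then show ?thesis
    by simp
qed

text \<open>Along a sequence \<open>G\<close> converging to \<open>f\<close> in \<open>L\<^sup>1\<close> at a geometric rate, the transforms converge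
  almost everywhere by the weak-type estimate and Borel--Cantelli.\<close>
lemma riesz2_limit:
  fixes f :: "real ^ 'n::finite \<Rightarrow> real"
  assumes f: "f \<in> L1"
  obtains H where "H \<in> borel_measurable borel"
    "\<And>F. (\<And>k. F k \<in> L1 \<inter> L2) \<Longrightarrow> (\<lambda>k. L1_norm (\<lambda>x. F k x - f x)) \<longlonglongrightarrow> 0 \<Longrightarrow>
       converges_in_measure (\<lambda>k. riesz2 (F k)) H"
proof -
  have fi: "integrable gauss f"
    using f by (simp add: L1_def)
  obtain F0 where F0: "\<And>k. F0 k \<in> L1 \<inter> L2" "(\<lambda>k. L1_norm (\<lambda>x. F0 k x - f x)) \<longlonglongrightarrow> 0"
    using L1_approx[OF fi] by blast
  have "\<exists>k. L1_norm (\<lambda>x. F0 k x - f x) < (1/4) ^ n" for n :: nat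
  proof -
    have "\<forall>\<^sub>F k in sequentially. L1_norm (\<lambda>x. F0 k x - f x) < (1/4) ^ n"
      using F0(2) by (rule order_tendstoD) simp
    then show ?thesis
      by (rule eventually_happens'[OF sequentially_bot])
  qed
  then obtain \<kappa> where \<kappa>: "\<And>n. L1_norm (\<lambda>x. F0 (\<kappa> n) x - f x) < (1/4) ^ n"
    by metis
  define G where "G n = F0 (\<kappa> n)" for n
  have G: "G n \<in> L2" "integrable gauss (G n)" for n
    using F0(1)[of "\<kappa> n"] by (auto simp: G_def L1_def)
  have G_less: "L1_norm (\<lambda>x. G n x - f x) < (1/4) ^ n" for n
    using \<kappa> by (simp add: G_def)
  have G_lim: "(\<lambda>n. L1_norm (\<lambda>x. G n x - f x)) \<longlonglongrightarrow> 0"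
    by (rule tendsto_sandwich[OF _ _ tendsto_const LIMSEQ_realpow_zero[of "1/4"]])
      (use G_less in \<open>auto intro!: always_eventually less_imp_le\<close>)
  note [measurable] = riesz2_borel[OF G(1)]
  \<comment> \<open>At height (1/2)^n the weak-type bound divides an L1 distance of order (1/4)^n by
    (1/2)^n, which stays summable.\<close>
  let ?S = "\<lambda>n. {x. norm (riesz2 (G (Suc n)) x - riesz2 (G n) x) > (1/2) ^ n}"
  have S_le: "measure gauss (?S n) \<le> 4 * (1/2) ^ n" for n
  proof -
    have "L1_norm (\<lambda>x. G (Suc n) x - G n x) \<le> L1_norm (\<lambda>x. G (Suc n) x - f x) + L1_norm (\<lambda>x. f x - G n x)"
      by (intro L1_norm_triangle G fi)
    also have "\<dots> \<le> (1/4) ^ Suc n + (1/4) ^ n"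
      using G_less[of "Suc n"] G_less[of n] by (simp add: L1_norm_minus_commute[of f])
    also have "\<dots> \<le> 2 * (1/4) ^ n"
      by simp
    finally have "2 * L1_norm (\<lambda>x. G (Suc n) x - G n x) / (1/2) ^ n \<le> 2 * (2 * (1/4) ^ n) / (1/2) ^ n"
      by (intro divide_right_mono mult_left_mono) auto
    also have "\<dots> = 4 * (1/2) ^ n"
      by (simp add: field_simps flip: power_mult_distrib)
    finally show ?thesis
      using riesz2_diff_weak_type[OF G(1) G(1), of "(1/2) ^ n" "Suc n" n] by simp
  qed
  have "AE x in gauss. \<forall>\<^sub>F n in sequentially. x \<in> space gauss - ?S n"
  proof (rule borel_cantelli_AE1)
    show "summable (\<lambda>n. measure gauss (?S n))"
      by (rule summable_comparison_test'[where g = "\<lambda>n. 4 * (1/2) ^ n" and N = 0])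
        (use S_le in \<open>auto intro!: summable_mult summable_geometric\<close>)
  qed (auto simp: gauss.emeasure_finite less_top[symmetric])
  then have conv: "AE x in gauss. convergent (\<lambda>n. riesz2 (G n) x)"
  proof eventually_elim
    case (elim x)
    then have ev: "\<forall>\<^sub>F n in sequentially. norm (riesz2 (G (Suc n)) x - riesz2 (G n) x) \<le> (1/2) ^ n"
      by eventually_elim auto
    have "summable (\<lambda>n. riesz2 (G (Suc n)) x - riesz2 (G n) x)"
      by (rule summable_comparison_test_ev[OF ev]) (auto intro!: summable_geometric)
    then have "convergent (\<lambda>n. (\<Sum>k<n. riesz2 (G (Suc k)) x - riesz2 (G k) x) + riesz2 (G 0) x)"
      by (intro convergent_add convergent_const) (simp add: summable_iff_convergent)
    then show ?case
      by (simp only: sum_lessThan_telescope[of "\<lambda>k. riesz2 (G k) x"]) simp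
  qed
  define H where "H x = lim (\<lambda>n. riesz2 (G n) x)" for x
  have H[measurable]: "H \<in> borel_measurable borel"
    unfolding H_def by measurable
  have lim: "AE x in gauss. (\<lambda>n. riesz2 (G n) x) \<longlonglongrightarrow> H x"
    using conv by eventually_elim (simp add: H_def convergent_LIMSEQ_iff)
  have "converges_in_measure (\<lambda>k. riesz2 (F k)) H"
    if F: "\<And>k. F k \<in> L1 \<inter> L2" and F_lim: "(\<lambda>k. L1_norm (\<lambda>x. F k x - f x)) \<longlonglongrightarrow> 0" for F
    unfolding converges_in_measure_iff_norm
  proof (intro allI impI)
    fix \<epsilon> :: real
    assume \<epsilon>: "\<epsilon> > 0"
    have FL2: "F k \<in> L2" and Fi: "integrable gauss (F k)" for k
      using F[of k] by (auto simp: L1_def)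
    note [measurable] = riesz2_borel[OF FL2]
    \<comment> \<open>Comparison with \<open>G n\<close> at height \<epsilon> / 2 turns the constant
      2 into 4, and the distance from \<open>G n\<close> to \<open>H\<close> disappears in the
      limit. So \<open>H\<close>, though built from \<open>G\<close>, serves every approximating
      sequence.\<close>
    have le: "measure gauss {x. norm (riesz2 (F k) x - H x) > \<epsilon>} \<le> 4 * L1_norm (\<lambda>x. F k x - f x) / \<epsilon>" for k
    proof (rule LIMSEQ_le_const)
      let ?R = "\<lambda>n. 4 * (L1_norm (\<lambda>x. F k x - f x) + L1_norm (\<lambda>x. G n x - f x)) / \<epsilon> +
        measure gauss {x. norm (riesz2 (G n) x - H x) > \<epsilon> / 2}"
      have "(\<lambda>n. measure gauss {x. norm (riesz2 (G n) x - H x) > \<epsilon> / 2}) \<longlonglongrightarrow> 0"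
        using \<epsilon> by (intro AE_tendsto_imp_measure lim) measurable
      then have "?R \<longlonglongrightarrow> 4 * (L1_norm (\<lambda>x. F k x - f x) + 0) / \<epsilon> + 0"
        using \<epsilon> by (intro tendsto_add tendsto_divide tendsto_mult tendsto_const G_lim) auto
      then show "?R \<longlonglongrightarrow> 4 * L1_norm (\<lambda>x. F k x - f x) / \<epsilon>"
        by simp
      have "measure gauss {x. norm (riesz2 (F k) x - H x) > \<epsilon>} \<le> ?R n" for n
      proof -
        have "measure gauss {x. norm (riesz2 (F k) x - H x) > \<epsilon> / 2 + \<epsilon> / 2} \<le>
            measure gauss {x. norm (riesz2 (F k) x - riesz2 (G n) x) > \<epsilon> / 2} +
            measure gauss {x. norm (riesz2 (G n) x - H x) > \<epsilon> / 2}"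
          by (intro measure_norm_diff_le) measurable
        moreover have "measure gauss {x. norm (riesz2 (F k) x - riesz2 (G n) x) > \<epsilon> / 2} \<le>
            2 * L1_norm (\<lambda>x. F k x - G n x) / (\<epsilon> / 2)"
          using \<epsilon> by (intro riesz2_diff_weak_type FL2 G) auto
        moreover have "2 * L1_norm (\<lambda>x. F k x - G n x) / (\<epsilon> / 2) \<le>
            2 * (L1_norm (\<lambda>x. F k x - f x) + L1_norm (\<lambda>x. G n x - f x)) / (\<epsilon> / 2)"
          using L1_norm_triangle[OF Fi fi G(2), of k n] \<epsilon>
          by (intro divide_right_mono mult_left_mono) (auto simp: L1_norm_minus_commute[of f])
        ultimately show ?thesis
          by simp
      qed
      then show "\<exists>N. \<forall>n\<ge>N. measure gauss {x. norm (riesz2 (F k) x - H x) > \<epsilon>} \<le> ?R n"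
        by blast
    qed
    have "(\<lambda>k. 4 * L1_norm (\<lambda>x. F k x - f x) / \<epsilon>) \<longlonglongrightarrow> 4 * 0 / \<epsilon>"
      using \<epsilon> by (intro tendsto_intros F_lim) auto
    then have "(\<lambda>k. 4 * L1_norm (\<lambda>x. F k x - f x) / \<epsilon>) \<longlonglongrightarrow> 0"
      by simp
    then show "(\<lambda>k. measure gauss {x. norm (riesz2 (F k) x - H x) > \<epsilon>}) \<longlonglongrightarrow> 0"
      by (rule tendsto_sandwich[OF _ _ tendsto_const, rotated 2]) (use le in \<open>auto intro!: always_eventually\<close>)
  qed
  with H show ?thesis
    using that by blast
qed

lemma converges_in_measure_unique:
  assumes [measurable]: "\<And>k. F k \<in> borel_measurable borel" "A \<in> borel_measurable borel" "B \<in> borel_measurable borel"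
    and A: "converges_in_measure F A" and B: "converges_in_measure F B"
  shows "AE x in gauss. A x = B x"
proof (rule AE_eq_if_measure_norm_diff_eq_0)
  fix \<epsilon> :: real
  assume \<epsilon>: "\<epsilon> > 0"
  let ?R = "\<lambda>k. measure gauss {x. norm (F k x - A x) > \<epsilon> / 2} + measure gauss {x. norm (F k x - B x) > \<epsilon> / 2}"
  show "measure gauss {x. norm (A x - B x) > \<epsilon>} \<le> 0"
  proof (rule LIMSEQ_le_const)
    have "\<epsilon> / 2 > 0"
      using \<epsilon> by simp
    then show "?R \<longlonglongrightarrow> 0"
      using A B unfolding converges_in_measure_iff_norm by (intro tendsto_add_zero) blast+
    have "measure gauss {x. norm (A x - B x) > \<epsilon> / 2 + \<epsilon> / 2} \<le> ?R k" for k
      using measure_norm_diff_le[of A "F k" B "\<epsilon> / 2" "\<epsilon> / 2"] by (simp add: norm_minus_commute[of "A _"])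
    then show "\<exists>N. \<forall>k\<ge>N. measure gauss {x. norm (A x - B x) > \<epsilon>} \<le> ?R k"
      by auto
  qed
qed measurable

text \<open>The height is split into \<open>e\<close> and \<open>t - e\<close>: convergence in
  measure removes the first contribution, and then \<open>e\<close> tends to 0. An even split would
  double the constant.\<close>

lemma converges_in_measure_weak_type:
  fixes f :: "real ^ 'n::finite \<Rightarrow> real"
  assumes f: "f \<in> L1" and H[measurable]: "H \<in> borel_measurable borel"
    and F: "\<And>k. F k \<in> L1 \<inter> L2" and F_lim: "(\<lambda>k. L1_norm (\<lambda>x. F k x - f x)) \<longlonglongrightarrow> 0"
    and conv: "converges_in_measure (\<lambda>k. riesz2 (F k)) H" and t: "t > 0"
  shows "measure gauss {x. norm (H x) > t} \<le> 2 * L1_norm f / t"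
proof -
  have FL2: "F k \<in> L2" and Fi: "integrable gauss (F k)" for k
    using F[of k] by (auto simp: L1_def)
  have fi: "integrable gauss f"
    using f by (simp add: L1_def)
  note [measurable] = riesz2_borel[OF FL2]
  have *: "measure gauss {x. norm (H x) > t} \<le> 2 * L1_norm f / (t - e)" if e: "e > 0" "e < t" for e
  proof (rule LIMSEQ_le_const)
    let ?R = "\<lambda>k. measure gauss {x. norm (riesz2 (F k) x - H x) > e} + 2 * (L1_norm (\<lambda>x. F k x - f x) + L1_norm f) / (t - e)"
    have "?R \<longlonglongrightarrow> 0 + 2 * (0 + L1_norm f) / (t - e)"
      using conv e unfolding converges_in_measure_iff_norm by (intro tendsto_intros F_lim) auto
    then show "?R \<longlonglongrightarrow> 2 * L1_norm f / (t - e)"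
      by simp
    have "measure gauss {x. norm (H x) > t} \<le> ?R k" for k
    proof -
      have "measure gauss {x. norm (H x - 0) > e + (t - e)} \<le>
          measure gauss {x. norm (H x - riesz2 (F k) x) > e} + measure gauss {x. norm (riesz2 (F k) x - 0) > t - e}"
        by (rule measure_norm_diff_le) measurable
      moreover have "measure gauss {x. norm (riesz2 (F k) x - 0) > t - e} \<le> 2 * L1_norm (F k) / (t - e)"
        using riesz2_weak_type[OF FL2, of "t - e" k] e by simp
      moreover have "2 * L1_norm (F k) / (t - e) \<le> 2 * (L1_norm (\<lambda>x. F k x - f x) + L1_norm f) / (t - e)"
        using L1_norm_triangle[OF Fi fi, of "\<lambda>_. 0" k] e by (intro divide_right_mono mult_left_mono) auto
      ultimately show ?thesis
        by (simp add: norm_minus_commute[of "H _"])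
    qed
    then show "\<exists>N. \<forall>k\<ge>N. measure gauss {x. norm (H x) > t} \<le> ?R k"
      by blast
  qed
  show ?thesis
  proof (rule LIMSEQ_le_const)
    let ?e = "\<lambda>n. t / 2 * inverse (real (Suc n))"
    have "(\<lambda>n. 2 * L1_norm f / (t - ?e n)) \<longlonglongrightarrow> 2 * L1_norm f / (t - t / 2 * 0)"
      using t by (intro tendsto_intros LIMSEQ_inverse_real_of_nat) auto
    then show "(\<lambda>n. 2 * L1_norm f / (t - ?e n)) \<longlonglongrightarrow> 2 * L1_norm f / t"
      by simp
    have "?e n > 0" "?e n < t" for n
    proof -
      have "inverse (real (Suc n)) \<le> 1"
        by (simp add: inverse_le_1_iff)
      then have "?e n \<le> t / 2 * 1"
        using t by (intro mult_left_mono) auto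
      then show "?e n < t"
        using t by simp
    qed (use t in simp)
    then show "\<exists>N. \<forall>n\<ge>N. measure gauss {x. norm (H x) > t} \<le> 2 * L1_norm f / (t - ?e n)"
      using * by blast
  qed
qed

theorem theorem3p3:
  shows "(\<forall>f \<in> (L1 :: (real ^ 'n::finite \<Rightarrow> real) set) \<inter> L2. \<forall>t>0.
           measure gauss {x. hs_norm (riesz2 f x) > t} \<le> 2 * L1_norm f / t) \<and>
         (\<exists>T :: (real ^ 'n \<Rightarrow> real) \<Rightarrow> real ^ 'n \<Rightarrow> real ^ 'n ^ 'n.
           extends_in_measure riesz2 T \<and>
           (\<forall>T'. extends_in_measure riesz2 T' \<longrightarrow>
              (\<forall>f\<in>L1. AE x in gauss. T' f x = T f x)) \<and>
           (\<forall>f\<in>L1. \<forall>t>0. measure gauss {x. hs_norm (T f x) > t} \<le> 2 * L1_norm f / t))"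
proof -
  \<comment> \<open>\<open>good\<close> collects what is required of a value at \<open>f\<close>;
    limits in measure are unique up to null sets, so the choice among such values is
    harmless.\<close>
  define good where "good f H \<longleftrightarrow> H \<in> borel_measurable borel \<and>
      (\<forall>F. (\<forall>k. F k \<in> L1 \<inter> L2) \<and> (\<lambda>k. L1_norm (\<lambda>x. F k x - f x)) \<longlonglongrightarrow> 0 \<longrightarrow>
        converges_in_measure (\<lambda>k. riesz2 (F k)) H)"
    for f :: "real ^ 'n \<Rightarrow> real" and H
  define T :: "(real ^ 'n \<Rightarrow> real) \<Rightarrow> real ^ 'n \<Rightarrow> real ^ 'n ^ 'n" where "T f = (SOME H. good f H)" for f
  have T: "good f (T f)" if "f \<in> L1" for f
  proof -
    have "\<exists>H. good f H"
      by (rule riesz2_limit[OF that], unfold good_def) blast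
    then show ?thesis
      unfolding T_def by (rule someI_ex)
  qed
  have T_borel: "T f \<in> borel_measurable borel" if "f \<in> L1" for f
    using T[OF that] by (simp add: good_def)
  have T_conv: "converges_in_measure (\<lambda>k. riesz2 (F k)) (T f)"
    if "f \<in> L1" "\<And>k. F k \<in> L1 \<inter> L2" "(\<lambda>k. L1_norm (\<lambda>x. F k x - f x)) \<longlonglongrightarrow> 0" for f F
    using T[OF that(1)] that(2,3) unfolding good_def by blast
  have approx: "\<exists>F. (\<forall>k. F k \<in> L1 \<inter> L2) \<and> (\<lambda>k. L1_norm (\<lambda>x. F k x - f x)) \<longlonglongrightarrow> 0"
    if "f \<in> L1" for f :: "real ^ 'n \<Rightarrow> real"
    using L1_approx[of f] that unfolding L1_def by blast
  \<comment> \<open>Constant sequences are admissible approximations, and their transforms converge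
    in measure both to \<open>T f\<close> and to \<open>riesz2 f\<close>.\<close>
  have "AE x in gauss. T f x = riesz2 f x" if f: "f \<in> L1 \<inter> L2" for f
  proof (rule converges_in_measure_unique)
    show "converges_in_measure (\<lambda>k. riesz2 f) (T f)"
      using T_conv[of f "\<lambda>_. f"] f by (simp add: L1_norm_def)
    show "converges_in_measure (\<lambda>k. riesz2 f) (riesz2 f)"
      by (simp add: converges_in_measure_iff_norm)
  qed (use f in \<open>auto intro: T_borel riesz2_borel\<close>)
  then have ext: "extends_in_measure riesz2 T"
    unfolding extends_in_measure_def using T_borel T_conv by simp
  have uniq: "AE x in gauss. T' f x = T f x" if T': "extends_in_measure riesz2 T'" and f: "f \<in> L1" for T' f
  proof -
    obtain F where F: "\<And>k. F k \<in> L1 \<inter> L2" "(\<lambda>k. L1_norm (\<lambda>x. F k x - f x)) \<longlonglongrightarrow> 0"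
      using approx[OF f] by blast
    show ?thesis
    proof (rule converges_in_measure_unique)
      show "converges_in_measure (\<lambda>k. riesz2 (F k)) (T' f)"
        using T' f F unfolding extends_in_measure_def by blast
      show "converges_in_measure (\<lambda>k. riesz2 (F k)) (T f)"
        by (intro T_conv f F)
      show "T' f \<in> borel_measurable borel"
        using T' f unfolding extends_in_measure_def measurable_cong_sets[OF sets_gauss refl] by blast
    qed (use F f in \<open>auto intro: T_borel riesz2_borel\<close>)
  qed
  have weak: "measure gauss {x. hs_norm (T f x) > t} \<le> 2 * L1_norm f / t" if f: "f \<in> L1" and t: "t > 0" for f t
  proof -
    obtain F where F: "\<And>k. F k \<in> L1 \<inter> L2" "(\<lambda>k. L1_norm (\<lambda>x. F k x - f x)) \<longlonglongrightarrow> 0"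
      using approx[OF f] by blast
    show ?thesis
      unfolding hs_norm_eq_norm
      by (rule converges_in_measure_weak_type[OF f T_borel[OF f] F T_conv[OF f F] t])
  qed
  have "measure gauss {x. hs_norm (riesz2 f x) > t} \<le> 2 * L1_norm f / t"
    if "f \<in> L1 \<inter> L2" "t > 0" for f :: "real ^ 'n \<Rightarrow> real" and t
    unfolding hs_norm_eq_norm using that by (intro riesz2_weak_type) auto
  then show ?thesis
    using ext uniq weak by blast
qed

end
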